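(* Let $X$ be a finite biquandle and let $S_\ast:\ S_0\subseteq S_1\subseteq\cdots\subseteq S_m$ be a filtration of $\mathrm{End}(X)$. Then the $X$-coloring quiver filtration $\mathcal Q_X^{S_\ast}(L)$ is an invariant of links; that is, if $L_1$ and $L_2$ are virtually equivalent oriented virtual link diagrams, then the filtrations $\mathcal Q_X^{S_\ast}(L_1)$ and $\mathcal Q_X^{S_\ast}(L_2)$ are isomorphic as filtrations of quivers.
   Context: **Links.** A virtual link diagram is an immersion of finitely many circles in the plane with finitely many transversal double points, each being either a classical crossing (with over/under information) or a virtual crossing (no over/under information). Diagrams are oriented. "Link" means oriented virtual link: an equivalence class of oriented virtual link diagrams under virtual equivalence, i.e. planar isotopy and the generalized Reidemeister moves: the classical Reidemeister moves R1, R2, R3 (on classical crossings), the virtual Reidemeister moves (the analogues of R1, R2, R3 with all crossings virtual), and the mixed move (an arc having two consecutive virtual crossings is moved across a classical crossing). A semi-arc is a segment of the diagram between two consecutive classical crossings (it may pass through virtual crossings; a component with no classical crossing is one semi-arc). **Biquandles.** A biquandle is a set $X$ with operations $\underline{\triangleright},\overline{\triangleright}:X\times X\to X$ such that for all $x,y,z\in X$: (1) $x\,\underline{\triangleright}\,x=x\,\overline{\triangleright}\,x$; (2) the maps $\alpha_y(x)=x\,\overline{\triangleright}\,y$, $\beta_y(x)=x\,\underline{\triangleright}\,y$ on $X$ and $S(x,y)=(y\,\overline{\triangleright}\,x,\;x\,\underline{\triangleright}\,y)$ on $X\times X$ are invertible; (3) $(x\underline{\triangleright}y)\underline{\triangleright}(z\underline{\triangleright}y)=(x\underline{\triangleright}z)\underline{\triangleright}(y\overline{\triangleright}z)$,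 $(x\underline{\triangleright}y)\overline{\triangleright}(z\underline{\triangleright}y)=(x\overline{\triangleright}z)\underline{\triangleright}(y\overline{\triangleright}z)$, $(x\overline{\triangleright}y)\overline{\triangleright}(z\overline{\triangleright}y)=(x\overline{\triangleright}z)\overline{\triangleright}(y\underline{\triangleright}z)$. $\mathrm{End}(X)$ is the set of maps $X\to X$ preserving both operations. **Colorings.** An $X$-coloring of a diagram $L$ is a labeling $f$ of the semi-arcs of $L$ by elements of $X$ such that at each classical crossing: if $x$ is the label of the semi-arc of the under-strand lying to the right of the (oriented) over-strand, and $y$ is the label of the semi-arc of the over-strand lying to the right of the (oriented) under-strand, then the other semi-arc of the under-strand (to the left of the over-strand) is labeled $x\,\underline{\triangleright}\,y$ and the other semi-arc of the over-strand (to the left of the under-strand) is labeled $y\,\overline{\triangleright}\,x$. Labels do not change at virtual crossings. $\mathrm{Col}_X(L)$ is the set of $X$-colorings. For $\alpha\in\mathrm{End}(X)$ and $f\in\mathrm{Col}_X(L)$, $\alpha\circ f\in \mathrm{Col}_X(L)$. **Coloring quiver.** A quiver is a directed graph, possibly with loops and multiple edges; $e_{\mathcal Q}(u,v)$ is the number of edges from $u$ to $v$ in $\mathcal Q$. For $S\subseteq\mathrm{End}(X)$, the $X$-coloring quiver $\mathcal Q_X^S(L)$ has vertex set $\{v_f: f\in\mathrm{Col}_X(L)\}$ and, for each $f$ and each $\alpha\in S$, one edge $v_f\to v_{\alpha\circ f}$; thus $e(v_f,v_g)=|\{\alpha\in S:\alpha\circ f=g\}|$. An isomorphism of quivers $\mathcal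 Q_1\to\mathcal Q_2$ is a bijection $\psi$ of vertex sets with $e_{\mathcal Q_1}(u,v)=e_{\mathcal Q_2}(\psi(u),\psi(v))$ for all vertices $u,v$. **Filtrations.** A filtration $S_\ast$ of $\mathrm{End}(X)$ is a nested sequence of subsets $S_0\subseteq\cdots\subseteq S_m$ of $\mathrm{End}(X)$; it is not required that $S_m=\mathrm{End}(X)$. If $S_i\subseteq S_j$ then $\mathcal Q_X^{S_i}(L)$ is naturally a subquiver of $\mathcal Q_X^{S_j}(L)$ with the same vertex set. The $X$-coloring quiver filtration $\mathcal Q_X^{S_\ast}(L)$ is $\mathcal Q_X^{S_0}(L)\subseteq\mathcal Q_X^{S_1}(L)\subseteq\cdots\subseteq\mathcal Q_X^{S_m}(L)$. Two filtrations $A_0\subseteq\cdots\subseteq A_m$ and $B_0\subseteq\cdots\subseteq B_m$ are isomorphic if there are isomorphisms $\varphi_i:A_i\to B_i$ for all $i$ commuting with the inclusions $A_i\hookrightarrow A_{i+1}$ and $B_i\hookrightarrow B_{i+1}$. *)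

theory Defs
  imports "Graph_Theory.Digraph_Component" "HOL-Analysis.Analysis"
begin

section \<open>Oriented virtual link diagrams\<close>

text \<open>
  A diagram is an immersion of \<open>ncomp\<close> unit circles in the plane \<^typ>\<open>complex\<close>, each circle oriented
  counterclockwise; only the values of \<open>curve D i\<close> on \<^term>\<open>sphere (0::complex) 1\<close> for \<open>i < ncomp D\<close>
  matter. Smoothness is taken to be \<open>C\<^sup>1\<close>. The crossing information consists of the pairs
  (preimage on the over-strand, preimage on the under-strand), one for each classical crossing;
  all other double points are virtual crossings.
\<close>

type_synonym pt = "nat \<times> complex"

record vdiagram =
  ncomp :: nat
  curve :: "nat \<Rightarrow> complex \<Rightarrow> complex"
  classical :: "(pt \<times> pt) set"

definition points :: "vdiagram \<Rightarrow> pt set" where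
  "points D = {..<ncomp D} \<times> sphere 0 1"

definition pos :: "vdiagram \<Rightarrow> pt \<Rightarrow> complex" where
  "pos D p = curve D (fst p) (snd p)"

definition velocity :: "vdiagram \<Rightarrow> pt \<Rightarrow> complex" where
  "velocity D p = vector_derivative (\<lambda>t. curve D (fst p) (snd p * cis t)) (at 0)"

text \<open>The determinant of two plane vectors; positive iff \<open>w\<close> points to the left of \<open>v\<close>.\<close>

definition cross2 :: "complex \<Rightarrow> complex \<Rightarrow> real" where
  "cross2 v w = Re v * Im w - Im v * Re w"

definition double_points :: "vdiagram \<Rightarrow> (pt \<times> pt) set" where
  "double_points D = {(p, q). p \<in> points D \<and> q \<in> points D \<and> p \<noteq> q \<and> pos D p = pos D q}"

text \<open>\<^const>\<open>single_valued\<close> excludes points of multiplicity three or more.\<close>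

definition diagram :: "vdiagram \<Rightarrow> bool" where
  "diagram D \<longleftrightarrow>
     (\<forall>i<ncomp D. (\<lambda>t. curve D i (cis t)) C1_differentiable_on UNIV) \<and>
     (\<forall>p\<in>points D. velocity D p \<noteq> 0) \<and>
     finite (double_points D) \<and>
     single_valued (double_points D) \<and>
     (\<forall>(p, q)\<in>double_points D. cross2 (velocity D p) (velocity D q) \<noteq> 0) \<and>
     classical D \<subseteq> double_points D \<and>
     asym (classical D)"


section \<open>Virtual equivalence\<close>

text \<open>
  Two diagrams describe the same oriented curves with the same crossing information if they differ
  by a renumbering \<open>\<pi>\<close> of the components and by orientation preserving diffeomorphisms of the
  circles, given by their lifts \<open>r i\<close> to the angle coordinate.
\<close>

definition reparametrization :: "vdiagram \<Rightarrow> vdiagram \<Rightarrow> bool" where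
  "reparametrization D1 D2 \<longleftrightarrow> ncomp D1 = ncomp D2 \<and>
     (\<exists>(\<pi> :: nat \<Rightarrow> nat) (r :: nat \<Rightarrow> real \<Rightarrow> real).
        bij_betw \<pi> {..<ncomp D2} {..<ncomp D1} \<and>
        (\<forall>i<ncomp D2. r i C1_differentiable_on UNIV \<and> (\<forall>t. deriv (r i) t > 0) \<and>
           (\<forall>t. r i (t + 2 * pi) = r i t + 2 * pi)) \<and>
        (\<forall>i<ncomp D2. \<forall>t. curve D2 i (cis t) = curve D1 (\<pi> i) (cis (r i t))) \<and>
        (\<forall>i<ncomp D2. \<forall>j<ncomp D2. \<forall>s t.
           ((i, cis s), (j, cis t)) \<in> classical D2 \<longleftrightarrow>
           ((\<pi> i, cis (r i s)), (\<pi> j, cis (r j t))) \<in> classical D1))"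

definition ambient_isotopy :: "(real \<Rightarrow> complex \<Rightarrow> complex) \<Rightarrow> bool" where
  "ambient_isotopy H \<longleftrightarrow>
     (\<forall>z. H 0 z = z) \<and>
     continuous_on ({0..1} \<times> UNIV) (\<lambda>(t, z). H t z) \<and>
     (\<forall>t\<in>{0..1}. bij (H t)) \<and>
     (\<exists>H' :: real \<Rightarrow> complex \<Rightarrow> (complex \<Rightarrow>\<^sub>L complex).
        (\<forall>t\<in>{0..1}. \<forall>z. (H t has_derivative blinfun_apply (H' t z)) (at z) \<and>
                         bij (blinfun_apply (H' t z))) \<and>
        continuous_on ({0..1} \<times> UNIV) (\<lambda>(t, z). H' t z))"

definition planar_isotopy :: "vdiagram \<Rightarrow> vdiagram \<Rightarrow> bool" where
  "planar_isotopy D1 D2 \<longleftrightarrow> ncomp D1 = ncomp D2 \<and> classical D1 = classical D2 \<and>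
     (\<exists>H. ambient_isotopy H \<and> (\<forall>p\<in>points D1. pos D2 p = H 1 (pos D1 p)))"

text \<open>
  Because planar isotopies are available, it suffices to describe the Reidemeister moves in a
  standard position inside the following box. A local picture consists of \<open>m\<close> strands
  \<open>M j\<close>, \<open>j < m\<close>, parametrized by \<^term>\<open>{-1..1::real}\<close>, together with a relation \<open>ov\<close> between
  (strand, parameter) pairs: where \<open>M j x = M k y\<close>, the crossing is classical with \<open>(j, x)\<close> on
  top if \<open>ov (j, x) (k, y)\<close>, and it is virtual if \<open>ov\<close> holds in neither direction.

  Under \<open>local_move m M1 M2 ov\<close> the part of the diagram in the box changes from the picture \<open>M1\<close> to
  the picture \<open>M2\<close>, and the rest of the diagram lies outside of the box and is unchanged. The
  strand \<open>j\<close> is traversed by the circle points \<open>(c j, z j * cis (\<epsilon> j * x))\<close>; a negative \<open>\<epsilon> j\<close> means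
  that the orientation of the diagram is opposite to the parametrization of the strand, so all
  orientations of the strands are covered.
\<close>

definition move_box :: "complex set" where
  "move_box = {w. \<bar>Re w\<bar> \<le> 1 \<and> \<bar>Im w\<bar> \<le> 1}"

definition local_move ::
  "nat \<Rightarrow> (nat \<Rightarrow> real \<Rightarrow> complex) \<Rightarrow> (nat \<Rightarrow> real \<Rightarrow> complex) \<Rightarrow>
   (nat \<times> real \<Rightarrow> nat \<times> real \<Rightarrow> bool) \<Rightarrow> vdiagram \<Rightarrow> vdiagram \<Rightarrow> bool" where
  "local_move m M1 M2 ov D1 D2 \<longleftrightarrow> ncomp D1 = ncomp D2 \<and>
     (\<exists>(c :: nat \<Rightarrow> nat) (z :: nat \<Rightarrow> complex) (\<epsilon> :: nat \<Rightarrow> real).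
        let e = (\<lambda>(j, x). (c j, z j * cis (\<epsilon> j * x)));
            A = {..<m} \<times> {-1..1};
            T = e ` A;
            K = (\<lambda>M. {(e (j, x), e (k, y)) | j x k y.
                        (j, x) \<in> A \<and> (k, y) \<in> A \<and> M j x = M k y \<and> ov (j, x) (k, y)})
        in T \<subseteq> points D1 \<and> inj_on e A \<and>
           (\<forall>(j, x)\<in>A. pos D1 (e (j, x)) = M1 j x \<and> pos D2 (e (j, x)) = M2 j x) \<and>
           (\<forall>p\<in>points D1 - T. pos D1 p = pos D2 p \<and> pos D1 p \<notin> move_box) \<and>
           (\<exists>C \<subseteq> (- T) \<times> (- T). classical D1 = C \<union> K M1 \<and> classical D2 = C \<union> K M2))"

text \<open>
  The polynomials below are chosen such that the two pictures of each move have the same end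
  points on the boundary of the box and the same velocities there.
  In \<open>R1_after\<close> the curve crosses itself exactly once, at the parameters \<open>\<plusminus>1 / sqrt 2\<close>.
  In \<open>R2_after\<close> the strand 1 crosses the strand 0 (the real axis) exactly twice.
  For the third move the strands 0 and 1 are the diagonals of the box and the strand 2 passes
  above (before) or below (after) their crossing.
\<close>

definition R1_before :: "nat \<Rightarrow> real \<Rightarrow> complex" where
  "R1_before j x = Complex x (x\<^sup>2)"

definition R1_after :: "nat \<Rightarrow> real \<Rightarrow> complex" where
  "R1_after j x = Complex (x * (1 - 4 * (1 - x\<^sup>2)\<^sup>2)) (x\<^sup>2)"

definition R2_before :: "nat \<Rightarrow> real \<Rightarrow> complex" where
  "R2_before j x = (if j = 0 then Complex x 0 else Complex x (1/2))"

definition R2_after :: "nat \<Rightarrow> real \<Rightarrow> complex" where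
  "R2_after j x = (if j = 0 then Complex x 0 else Complex x (1/2 - (1 - x\<^sup>2)\<^sup>2))"

definition R3_before :: "nat \<Rightarrow> real \<Rightarrow> complex" where
  "R3_before j x =
     (if j = 0 then Complex x x else if j = 1 then Complex x (- x)
      else Complex x ((1 - x\<^sup>2)\<^sup>2 / 2))"

definition R3_after :: "nat \<Rightarrow> real \<Rightarrow> complex" where
  "R3_after j x =
     (if j = 0 then Complex x x else if j = 1 then Complex x (- x)
      else Complex x (- ((1 - x\<^sup>2)\<^sup>2 / 2)))"

text \<open>
  In \<open>classical_R1\<close> the first or the second passage through the crossing is on top; in
  \<open>classical_R2\<close> one of the strands is above the other one at both crossings; in \<open>classical_R3\<close>
  the strands lie at pairwise distinct heights \<open>h\<close>.
\<close>

inductive reidemeister_move :: "vdiagram \<Rightarrow> vdiagram \<Rightarrow> bool" where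
  classical_R1:
    "local_move 1 R1_before R1_after ov D1 D2 \<Longrightarrow>
     ov = (\<lambda>(j, x) (k, y). x < y) \<or> ov = (\<lambda>(j, x) (k, y). x > y) \<Longrightarrow>
     reidemeister_move D1 D2"
| classical_R2:
    "local_move 2 R2_before R2_after (\<lambda>(j, x) (k, y). j = a \<and> k = b) D1 D2 \<Longrightarrow>
     (a, b) \<in> {(0, 1), (1, 0)} \<Longrightarrow>
     reidemeister_move D1 D2"
| classical_R3:
    "local_move 3 R3_before R3_after (\<lambda>(j, x) (k, y). h j > h k) D1 D2 \<Longrightarrow>
     inj_on (h :: nat \<Rightarrow> nat) {..<3} \<Longrightarrow>
     reidemeister_move D1 D2"
| virtual_R1: "local_move 1 R1_before R1_after (\<lambda>_ _. False) D1 D2 \<Longrightarrow> reidemeister_move D1 D2"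
| virtual_R2: "local_move 2 R2_before R2_after (\<lambda>_ _. False) D1 D2 \<Longrightarrow> reidemeister_move D1 D2"
| virtual_R3: "local_move 3 R3_before R3_after (\<lambda>_ _. False) D1 D2 \<Longrightarrow> reidemeister_move D1 D2"
| mixed:
    "local_move 3 R3_before R3_after (\<lambda>(j, x) (k, y). j = a \<and> k = b) D1 D2 \<Longrightarrow>
     (a, b) \<in> {(0, 1), (1, 0)} \<Longrightarrow>
     reidemeister_move D1 D2"

definition elementary_step :: "vdiagram \<Rightarrow> vdiagram \<Rightarrow> bool" where
  "elementary_step D1 D2 \<longleftrightarrow> diagram D1 \<and> diagram D2 \<and>
     (reparametrization D1 D2 \<or> planar_isotopy D1 D2 \<or> reidemeister_move D1 D2)"

definition virtually_equivalent :: "vdiagram \<Rightarrow> vdiagram \<Rightarrow> bool" where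
  "virtually_equivalent = equivclp elementary_step"


section \<open>Biquandles and colorings\<close>

definition biquandle :: "'a set \<Rightarrow> ('a \<Rightarrow> 'a \<Rightarrow> 'a) \<Rightarrow> ('a \<Rightarrow> 'a \<Rightarrow> 'a) \<Rightarrow> bool" where
  "biquandle X ut ot \<longleftrightarrow>
     (\<forall>x\<in>X. \<forall>y\<in>X. ut x y \<in> X \<and> ot x y \<in> X) \<and>
     (\<forall>x\<in>X. ut x x = ot x x) \<and>
     (\<forall>y\<in>X. bij_betw (\<lambda>x. ot x y) X X) \<and>
     (\<forall>y\<in>X. bij_betw (\<lambda>x. ut x y) X X) \<and>
     bij_betw (\<lambda>(x, y). (ot y x, ut x y)) (X \<times> X) (X \<times> X) \<and>
     (\<forall>x\<in>X. \<forall>y\<in>X. \<forall>z\<in>X.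
        ut (ut x y) (ut z y) = ut (ut x z) (ot y z) \<and>
        ot (ut x y) (ut z y) = ut (ot x z) (ot y z) \<and>
        ot (ot x y) (ot z y) = ot (ot x z) (ut y z))"

text \<open>Maps \<open>X \<rightarrow> X\<close> are represented by extensional functions, so that distinct functions are
  distinct endomorphisms.\<close>

definition endomorphisms :: "'a set \<Rightarrow> ('a \<Rightarrow> 'a \<Rightarrow> 'a) \<Rightarrow> ('a \<Rightarrow> 'a \<Rightarrow> 'a) \<Rightarrow> ('a \<Rightarrow> 'a) set" where
  "endomorphisms X ut ot =
     {\<alpha> \<in> X \<rightarrow>\<^sub>E X. \<forall>x\<in>X. \<forall>y\<in>X. \<alpha> (ut x y) = ut (\<alpha> x) (\<alpha> y) \<and> \<alpha> (ot x y) = ot (\<alpha> x) (\<alpha> y)}"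

type_synonym semi_arc = "nat \<times> complex set"

text \<open>A semi-arc is represented by its (relatively open) preimage in the circles.\<close>

definition semi_arcs :: "vdiagram \<Rightarrow> semi_arc set" where
  "semi_arcs D =
     {(i, A). i < ncomp D \<and> A \<in> components (sphere 0 1 - {z. (i, z) \<in> Field (classical D)})}"

text \<open>The semi-arcs that end and start, respectively, at a classical crossing point \<open>p\<close>.\<close>

definition arc_in :: "vdiagram \<Rightarrow> pt \<Rightarrow> semi_arc" where
  "arc_in D p = (THE a. a \<in> semi_arcs D \<and> fst a = fst p \<and>
     (\<forall>\<^sub>F t in at_right 0. snd p * cis (- t) \<in> snd a))"

definition arc_out :: "vdiagram \<Rightarrow> pt \<Rightarrow> semi_arc" where
  "arc_out D p = (THE a. a \<in> semi_arcs D \<and> fst a = fst p \<and>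
     (\<forall>\<^sub>F t in at_right 0. snd p * cis t \<in> snd a))"

text \<open>At a crossing with preimages \<open>p\<close> and \<open>q\<close>: the semi-arc of the strand through \<open>q\<close> that lies to
  the right (left) of the oriented strand through \<open>p\<close>.\<close>

definition right_arc :: "vdiagram \<Rightarrow> pt \<Rightarrow> pt \<Rightarrow> semi_arc" where
  "right_arc D p q =
     (if cross2 (velocity D p) (velocity D q) > 0 then arc_in D q else arc_out D q)"

definition left_arc :: "vdiagram \<Rightarrow> pt \<Rightarrow> pt \<Rightarrow> semi_arc" where
  "left_arc D p q =
     (if cross2 (velocity D p) (velocity D q) > 0 then arc_out D q else arc_in D q)"

definition colorings ::
  "'a set \<Rightarrow> ('a \<Rightarrow> 'a \<Rightarrow> 'a) \<Rightarrow> ('a \<Rightarrow> 'a \<Rightarrow> 'a) \<Rightarrow> vdiagram \<Rightarrow> (semi_arc \<Rightarrow> 'a) set" where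
  "colorings X ut ot D =
     {f \<in> semi_arcs D \<rightarrow>\<^sub>E X. \<forall>(p, q)\<in>classical D.
        (let x = f (right_arc D p q); y = f (right_arc D q p)
         in f (left_arc D p q) = ut x y \<and> f (left_arc D q p) = ot y x)}"


section \<open>Coloring quivers and filtrations\<close>

definition edge_count :: "('v, 'e) pre_digraph \<Rightarrow> 'v \<Rightarrow> 'v \<Rightarrow> nat" where
  "edge_count Q u v = card {e \<in> arcs Q. tail Q e = u \<and> head Q e = v}"

definition quiver_iso ::
  "('v \<Rightarrow> 'w) \<Rightarrow> ('v, 'e) pre_digraph \<Rightarrow> ('w, 'f) pre_digraph \<Rightarrow> bool" where
  "quiver_iso \<psi> Q1 Q2 \<longleftrightarrow> bij_betw \<psi> (verts Q1) (verts Q2) \<and>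
     (\<forall>u\<in>verts Q1. \<forall>v\<in>verts Q1. edge_count Q1 u v = edge_count Q2 (\<psi> u) (\<psi> v))"

definition quiver_filtration :: "nat \<Rightarrow> (nat \<Rightarrow> ('v, 'e) pre_digraph) \<Rightarrow> bool" where
  "quiver_filtration m A \<longleftrightarrow> (\<forall>i\<le>m. wf_digraph (A i)) \<and> (\<forall>i<m. subgraph (A i) (A (Suc i)))"

definition isomorphic_filtrations ::
  "nat \<Rightarrow> (nat \<Rightarrow> ('v, 'e) pre_digraph) \<Rightarrow> (nat \<Rightarrow> ('w, 'f) pre_digraph) \<Rightarrow> bool" where
  "isomorphic_filtrations m A B \<longleftrightarrow> quiver_filtration m A \<and> quiver_filtration m B \<and>
     (\<exists>\<phi>. (\<forall>i\<le>m. quiver_iso (\<phi> i) (A i) (B i)) \<and>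
          (\<forall>i<m. \<forall>v\<in>verts (A i). \<phi> (Suc i) v = \<phi> i v))"

text \<open>The vertex \<open>v\<^sub>f\<close> is the coloring \<open>f\<close> itself; the edge belonging to \<open>f\<close> and \<open>\<alpha>\<close> is the
  pair \<open>(f, \<alpha>)\<close>.\<close>

definition coloring_quiver ::
  "'a set \<Rightarrow> ('a \<Rightarrow> 'a \<Rightarrow> 'a) \<Rightarrow> ('a \<Rightarrow> 'a \<Rightarrow> 'a) \<Rightarrow> ('a \<Rightarrow> 'a) set \<Rightarrow> vdiagram \<Rightarrow>
   (semi_arc \<Rightarrow> 'a, (semi_arc \<Rightarrow> 'a) \<times> ('a \<Rightarrow> 'a)) pre_digraph" where
  "coloring_quiver X ut ot S D =
     \<lparr> verts = colorings X ut ot D,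
       arcs = colorings X ut ot D \<times> S,
       tail = fst,
       head = (\<lambda>(f, \<alpha>). compose (semi_arcs D) \<alpha> f) \<rparr>"

definition endo_filtration ::
  "'a set \<Rightarrow> ('a \<Rightarrow> 'a \<Rightarrow> 'a) \<Rightarrow> ('a \<Rightarrow> 'a \<Rightarrow> 'a) \<Rightarrow> nat \<Rightarrow> (nat \<Rightarrow> ('a \<Rightarrow> 'a) set) \<Rightarrow> bool" where
  "endo_filtration X ut ot m S \<longleftrightarrow>
     (\<forall>i\<le>m. S i \<subseteq> endomorphisms X ut ot) \<and> (\<forall>i<m. S i \<subseteq> S (Suc i))"

definition coloring_quiver_filtration ::
  "'a set \<Rightarrow> ('a \<Rightarrow> 'a \<Rightarrow> 'a) \<Rightarrow> ('a \<Rightarrow> 'a \<Rightarrow> 'a) \<Rightarrow> (nat \<Rightarrow> ('a \<Rightarrow> 'a) set) \<Rightarrow> vdiagram \<Rightarrow>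
   nat \<Rightarrow> (semi_arc \<Rightarrow> 'a, (semi_arc \<Rightarrow> 'a) \<times> ('a \<Rightarrow> 'a)) pre_digraph" where
  "coloring_quiver_filtration X ut ot S D i = coloring_quiver X ut ot (S i) D"

end

(*
The quiver filtration is determined by the set of colorings together with the action of the
endomorphisms on it, so it suffices to find, for every elementary step, an equivariant bijection
between the sets of colorings.

A coloring is the same thing as a locally constant function on the complement of the classical
crossing points in the circles, subject to a condition on its one-sided values at these points.
In this form colorings can be cut and glued along the box of a Reidemeister move. Two colorings
correspond to each other if they agree outside of the box; this relation is clearly equivariant,
and it is a bijection if the colorings of the two pictures in the box restrict to the same
labelings of the ends of the strands and are determined by these restrictions.

For the third move with arbitrary orientations and heights, give every strand four labels, one for
each combination of sides of the other two strands. By the exchange laws of the biquandle, the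
three labels on the right of both other strands determine twelve labels that satisfy the
conditions at all six crossings of the two pictures. Since X is finite, injectivity shows that
every coloring of one of the pictures is obtained in this way, and hence extends to the other one.
*)
theory Submission
  imports Defs
begin

text \<open>Semi-arcs are global: a move in the box can split or join them, so there is no natural
  map between the semi-arcs of the two diagrams, and only a local description of colorings survives
  the move. The second obstacle is the number of orientations and height orders in the third move.
  It is met by indexing labels by sides instead of by order of passage: a region is a vertex of a
  cube (one side for each strand), a piece of a strand is an edge, and a crossing of two strands on
  a given side of the third is a face. Each picture shows three of the six faces. Three free labels
  at the vertex "right of all strands" fill the three faces there; the exchange laws close the other
  three, because the over-relation is not cyclic. The labels at the left ends determine those in
  both pictures, and every edge of the cube occurs in at least one of them; this is the injectivity
  that is used. Finiteness of \<open>X\<close> also enters the first move: there it makes the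
  diagonal map bijective, so that a kink can be filled in uniquely.\<close>

section \<open>Equivariant bijections\<close>

text \<open>\<open>compose U\<close> replaces ordinary composition because labelings are extensional
  on \<open>U\<close>: the composite has to be \<open>undefined\<close> outside of \<open>U\<close>
  again.\<close>

definition equivariant ::
  "('a \<Rightarrow> 'a) set \<Rightarrow> 'u set \<Rightarrow> ('u \<Rightarrow> 'a) set \<Rightarrow> 'v set \<Rightarrow> ('v \<Rightarrow> 'a) set \<Rightarrow> bool" where
  "equivariant E U A V B \<longleftrightarrow>
     (\<exists>\<psi>. bij_betw \<psi> A B \<and> (\<forall>\<alpha>\<in>E. \<forall>f\<in>A. \<psi> (compose U \<alpha> f) = compose V \<alpha> (\<psi> f)))"

lemma equivariant_refl: "equivariant E U A U A"
  unfolding equivariant_def by (rule exI[of _ id]) auto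

lemma equivariant_trans:
  assumes "equivariant E U A V B" "equivariant E V B W C"
  shows "equivariant E U A W C"
proof -
  obtain \<psi> where 1: "bij_betw \<psi> A B" "\<forall>\<alpha>\<in>E. \<forall>f\<in>A. \<psi> (compose U \<alpha> f) = compose V \<alpha> (\<psi> f)"
    using assms(1) unfolding equivariant_def by blast
  obtain \<phi> where 2: "bij_betw \<phi> B C" "\<forall>\<alpha>\<in>E. \<forall>f\<in>B. \<phi> (compose V \<alpha> f) = compose W \<alpha> (\<phi> f)"
    using assms(2) unfolding equivariant_def by blast
  show ?thesis unfolding equivariant_def
    by (rule exI[of _ "\<phi> \<circ> \<psi>"])
      (use 1 2 bij_betw_trans[OF 1(1) 2(1)] bij_betwE[OF 1(1)] in auto)
qed

text \<open>Virtual equivalence also uses elementary steps backwards. Closure of \<open>A\<close>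
  under the action is what lets \<open>the_inv_into\<close> cancel \<psi> at the composite.\<close>

lemma equivariant_sym:
  assumes "equivariant E U A V B" and closed: "\<And>\<alpha> f. \<alpha> \<in> E \<Longrightarrow> f \<in> A \<Longrightarrow> compose U \<alpha> f \<in> A"
  shows "equivariant E V B U A"
proof -
  obtain \<psi> where 1: "bij_betw \<psi> A B" "\<forall>\<alpha>\<in>E. \<forall>f\<in>A. \<psi> (compose U \<alpha> f) = compose V \<alpha> (\<psi> f)"
    using assms(1) unfolding equivariant_def by blast
  let ?\<phi> = "the_inv_into A \<psi>"
  have inj: "inj_on \<psi> A" using 1(1) by (simp add: bij_betw_def)
  have "?\<phi> (compose V \<alpha> g) = compose U \<alpha> (?\<phi> g)" if "\<alpha> \<in> E" "g \<in> B" for \<alpha> g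
  proof -
    have g: "g \<in> \<psi> ` A" using 1(1) that by (simp add: bij_betw_def)
    have m: "?\<phi> g \<in> A" using the_inv_into_into[OF inj g] by blast
    have "compose V \<alpha> g = \<psi> (compose U \<alpha> (?\<phi> g))"
      using 1(2) that(1) m f_the_inv_into_f[OF inj g] by simp
    then show ?thesis using the_inv_into_f_f[OF inj closed[OF that(1) m]] by simp
  qed
  then show ?thesis unfolding equivariant_def
    using bij_betw_the_inv_into[OF 1(1)] by blast
qed

text \<open>A correspondence such as "equal outside of the box" has no preferred direction, so it is
  given as a relation. A choice function for it is a bijection by the two uniqueness assumptions,
  and uniqueness also makes it commute with the action.\<close>

lemma equivariant_relI:
  assumes ex1: "\<And>f. f \<in> A \<Longrightarrow> \<exists>g\<in>B. R f g" and ex2: "\<And>g. g \<in> B \<Longrightarrow> \<exists>f\<in>A. R f g"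
    and un1: "\<And>f g g'. f \<in> A \<Longrightarrow> g \<in> B \<Longrightarrow> g' \<in> B \<Longrightarrow> R f g \<Longrightarrow> R f g' \<Longrightarrow> g = g'"
    and un2: "\<And>f f' g. f \<in> A \<Longrightarrow> f' \<in> A \<Longrightarrow> g \<in> B \<Longrightarrow> R f g \<Longrightarrow> R f' g \<Longrightarrow> f = f'"
    and compat: "\<And>\<alpha> f g. \<alpha> \<in> E \<Longrightarrow> f \<in> A \<Longrightarrow> g \<in> B \<Longrightarrow> R f g \<Longrightarrow> R (compose U \<alpha> f) (compose V \<alpha> g)"
    and clA: "\<And>\<alpha> f. \<alpha> \<in> E \<Longrightarrow> f \<in> A \<Longrightarrow> compose U \<alpha> f \<in> A"
    and clB: "\<And>\<alpha> f. \<alpha> \<in> E \<Longrightarrow> f \<in> B \<Longrightarrow> compose V \<alpha> f \<in> B"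
  shows "equivariant E U A V B"
proof -
  define \<psi> where "\<psi> f = (SOME g. g \<in> B \<and> R f g)" for f
  have \<psi>: "\<psi> f \<in> B" "R f (\<psi> f)" if "f \<in> A" for f
    using someI_ex[of "\<lambda>g. g \<in> B \<and> R f g"] ex1[OF that] unfolding \<psi>_def by blast+
  have "bij_betw \<psi> A B"
  proof (rule bij_betw_imageI)
    show "inj_on \<psi> A"
    proof (rule inj_onI)
      fix f f' assume f: "f \<in> A" "f' \<in> A" "\<psi> f = \<psi> f'"
      then show "f = f'" using un2[OF f(1,2) \<psi>(1)[OF f(2)]] \<psi>(2) by metis
    qed
    show "\<psi> ` A = B"
    proof
      show "\<psi> ` A \<subseteq> B" using \<psi>(1) by blast
      show "B \<subseteq> \<psi> ` A"
      proof
        fix g assume g: "g \<in> B"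
        then obtain f where f: "f \<in> A" "R f g" using ex2 by blast
        then have "\<psi> f = g" using un1[OF f(1) \<psi>(1)[OF f(1)] g \<psi>(2)[OF f(1)] f(2)] by simp
        then show "g \<in> \<psi> ` A" using f(1) by blast
      qed
    qed
  qed
  moreover have "\<psi> (compose U \<alpha> f) = compose V \<alpha> (\<psi> f)" if "\<alpha> \<in> E" "f \<in> A" for \<alpha> f
    using un1[OF clA[OF that] \<psi>(1)[OF clA[OF that]] clB[OF that(1) \<psi>(1)[OF that(2)]]
        \<psi>(2)[OF clA[OF that]] compat[OF that \<psi>[OF that(2)]]] .
  ultimately show ?thesis unfolding equivariant_def by blast
qed

section \<open>Colorings as locally constant functions\<close>

lemma Field_classical:
  assumes "diagram D"
  shows "finite (Field (classical D))" "Field (classical D) \<subseteq> points D"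
proof -
  have sub: "classical D \<subseteq> double_points D" and fin: "finite (double_points D)"
    using assms unfolding diagram_def by auto
  show "finite (Field (classical D))"
    using finite_subset[OF sub fin] by (rule finite_Field)
  show "Field (classical D) \<subseteq> points D"
    using sub unfolding double_points_def Field_def by auto
qed

text \<open>The arguments \<open>p1\<close>, \<open>p2\<close> are the labels of the incoming and outgoing over-strand, \<open>q1\<close>, \<open>q2\<close> those of
  the under-strand, and \<open>s\<close> says whether the under-strand passes from right to left.\<close>

definition crossing ::
  "('a \<Rightarrow> 'a \<Rightarrow> 'a) \<Rightarrow> ('a \<Rightarrow> 'a \<Rightarrow> 'a) \<Rightarrow> bool \<Rightarrow> 'a \<Rightarrow> 'a \<Rightarrow> 'a \<Rightarrow> 'a \<Rightarrow> bool" where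
  "crossing ut ot s p1 p2 q1 q2 \<longleftrightarrow>
     (if s then q2 = ut q1 p2 \<and> p1 = ot p2 q1 else q1 = ut q2 p1 \<and> p2 = ot p1 q2)"

lemma crossing_endo:
  assumes "\<alpha> \<in> endomorphisms X ut ot" "crossing ut ot s p1 p2 q1 q2"
    "p1 \<in> X" "p2 \<in> X" "q1 \<in> X" "q2 \<in> X"
  shows "crossing ut ot s (\<alpha> p1) (\<alpha> p2) (\<alpha> q1) (\<alpha> q2)"
  using assms unfolding crossing_def endomorphisms_def by (auto split: if_splits)

lemma endo_in: "\<alpha> \<in> endomorphisms X ut ot \<Longrightarrow> x \<in> X \<Longrightarrow> \<alpha> x \<in> X"
  unfolding endomorphisms_def by auto

definition rot :: "pt \<Rightarrow> real \<Rightarrow> pt" where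
  "rot p t = (fst p, snd p * cis t)"

lemma rot_0 [simp]: "rot p 0 = p" and fst_rot [simp]: "fst (rot p t) = fst p"
  and snd_rot [simp]: "snd (rot p t) = snd p * cis t"
  and rot_rot [simp]: "rot (rot p s) t = rot p (s + t)"
  by (auto simp: rot_def cis_mult mult.assoc)

lemma rot_in_points [simp]: "rot p t \<in> points D \<longleftrightarrow> p \<in> points D"
  by (auto simp: rot_def points_def norm_mult mem_Times_iff)

text \<open>Labels carry no topology, so a one-sided limit is expressed as an eventually constant
  value.\<close>

definition val_before :: "(pt \<Rightarrow> 'a) \<Rightarrow> pt \<Rightarrow> 'a \<Rightarrow> bool" where
  "val_before F p v \<longleftrightarrow> (\<forall>\<^sub>F t in at_right 0. F (rot p (- t)) = v)"

definition val_after :: "(pt \<Rightarrow> 'a) \<Rightarrow> pt \<Rightarrow> 'a \<Rightarrow> bool" where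
  "val_after F p v \<longleftrightarrow> (\<forall>\<^sub>F t in at_right 0. F (rot p t) = v)"

lemma eventually_eq_unique:
  assumes "\<forall>\<^sub>F t in F. f t = v" "\<forall>\<^sub>F t in F. f t = w" "F \<noteq> bot"
  shows "v = w"
proof -
  have "\<forall>\<^sub>F t in F. v = w" using assms(1,2) by eventually_elim auto
  then show ?thesis using assms(3) by (simp add: eventually_const)
qed

lemma val_before_unique: "val_before F p v \<Longrightarrow> val_before F p w \<Longrightarrow> v = w"
  unfolding val_before_def by (erule (1) eventually_eq_unique) simp

lemma val_after_unique: "val_after F p v \<Longrightarrow> val_after F p w \<Longrightarrow> v = w"
  unfolding val_after_def by (erule (1) eventually_eq_unique) simp

definition regular :: "vdiagram \<Rightarrow> pt set" where
  "regular D = points D - Field (classical D)"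

definition crossing_colored ::
  "('a \<Rightarrow> 'a \<Rightarrow> 'a) \<Rightarrow> ('a \<Rightarrow> 'a \<Rightarrow> 'a) \<Rightarrow> vdiagram \<Rightarrow> (pt \<Rightarrow> 'a) \<Rightarrow> pt \<Rightarrow> pt \<Rightarrow> bool" where
  "crossing_colored ut ot D F p q \<longleftrightarrow> (\<exists>p1 p2 q1 q2.
     val_before F p p1 \<and> val_after F p p2 \<and> val_before F q q1 \<and> val_after F q q2 \<and>
     crossing ut ot (cross2 (velocity D p) (velocity D q) > 0) p1 p2 q1 q2)"

text \<open>Every clause concerns arbitrarily small neighbourhoods of one point or of the two
  preimages of a crossing. Equality of the value with both one-sided values at a regular point is
  local constancy there.\<close>

definition point_colorings ::
  "'a set \<Rightarrow> ('a \<Rightarrow> 'a \<Rightarrow> 'a) \<Rightarrow> ('a \<Rightarrow> 'a \<Rightarrow> 'a) \<Rightarrow> vdiagram \<Rightarrow> (pt \<Rightarrow> 'a) set" where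
  "point_colorings X ut ot D =
     {F \<in> regular D \<rightarrow>\<^sub>E X. (\<forall>p\<in>regular D. val_before F p (F p) \<and> val_after F p (F p)) \<and>
        (\<forall>(p, q)\<in>classical D. crossing_colored ut ot D F p q)}"

lemma point_coloringsI:
  assumes "F \<in> regular D \<rightarrow>\<^sub>E X"
    and "\<And>p. p \<in> regular D \<Longrightarrow> val_before F p (F p)" "\<And>p. p \<in> regular D \<Longrightarrow> val_after F p (F p)"
    and "\<And>p q. (p, q) \<in> classical D \<Longrightarrow> crossing_colored ut ot D F p q"
  shows "F \<in> point_colorings X ut ot D"
  using assms unfolding point_colorings_def by auto

lemma point_coloringsD:
  assumes "F \<in> point_colorings X ut ot D"
  shows "F \<in> regular D \<rightarrow>\<^sub>E X"
    and "p \<in> regular D \<Longrightarrow> val_before F p (F p)" "p \<in> regular D \<Longrightarrow> val_after F p (F p)"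
  using assms unfolding point_colorings_def mem_Collect_eq by simp_all

lemma point_colorings_crossing:
  assumes "F \<in> point_colorings X ut ot D" "(p, q) \<in> classical D"
  obtains p1 p2 q1 q2 where "val_before F p p1" "val_after F p p2" "val_before F q q1" "val_after F q q2"
    "crossing ut ot (cross2 (velocity D p) (velocity D q) > 0) p1 p2 q1 q2"
  using assms unfolding point_colorings_def crossing_colored_def by blast

lemma rot_eq_self:
  assumes "p \<in> points D" "\<bar>t\<bar> < 2 * pi" "rot p t = p"
  shows "t = 0"
proof -
  have "snd p \<noteq> 0" using assms(1) by (auto simp: points_def mem_Times_iff)
  moreover have "snd p * cis t = snd p" using assms(3) by (metis snd_rot)
  ultimately have "cis t = 1" by simp
  then have "cos t = 1" by (metis cis.sel(1) one_complex.sel(1))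
  then obtain n :: int where n: "t = n * (2 * pi)" unfolding cos_one_2pi_int by auto
  then have "\<bar>real_of_int n\<bar> < 1" using assms(2) by (auto simp: abs_mult)
  then have "n = 0" by linarith
  then show ?thesis using n by simp
qed

lemma rot_ne_nearby:
  assumes "p \<in> points D" "q \<in> points D"
  shows "\<exists>\<delta>>0. \<forall>t. 0 < \<bar>t\<bar> \<and> \<bar>t\<bar> < \<delta> \<longrightarrow> rot p t \<noteq> q"
proof (cases "\<exists>s. 0 < \<bar>s\<bar> \<and> \<bar>s\<bar> < pi \<and> rot p s = q")
  case True
  then obtain s where s: "0 < \<bar>s\<bar>" "\<bar>s\<bar> < pi" "rot p s = q" by blast
  show ?thesis
  proof (intro exI[of _ "\<bar>s\<bar>"] conjI allI impI notI)
    fix t assume t: "0 < \<bar>t\<bar> \<and> \<bar>t\<bar> < \<bar>s\<bar>" "rot p t = q"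
    have "rot q (t - s) = rot (rot p s) (t - s)" using s(3) by simp
    also have "\<dots> = q" using t(2) by simp
    finally have "rot q (t - s) = q" .
    moreover have "\<bar>t - s\<bar> < 2 * pi" using t s by linarith
    ultimately have "t - s = 0" using rot_eq_self[OF assms(2)] by blast
    then show False using t by simp
  qed (use s in auto)
next
  \<comment> \<open>This covers \<open>q = p\<close>, the antipode of \<open>p\<close>, and points
    on other components.\<close>
  case False
  then show ?thesis by (intro exI[of _ pi]) auto
qed

lemma regular_nearby:
  assumes "diagram D" "p \<in> points D"
  shows "\<exists>\<delta>>0. \<forall>t. 0 < \<bar>t\<bar> \<and> \<bar>t\<bar> < \<delta> \<longrightarrow> rot p t \<in> regular D"
proof -
  have "\<exists>\<delta>>0. \<forall>t. 0 < \<bar>t\<bar> \<and> \<bar>t\<bar> < \<delta> \<longrightarrow> rot p t \<notin> Q"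
    if "finite Q" "Q \<subseteq> points D" for Q
    using that
  proof (induction Q rule: finite_induct)
    case empty then show ?case by (auto intro: exI[of _ 1])
  next
    case (insert q Q)
    obtain d where "d > 0" "\<forall>t. 0 < \<bar>t\<bar> \<and> \<bar>t\<bar> < d \<longrightarrow> rot p t \<notin> Q" using insert by auto
    moreover obtain d' where "d' > 0" "\<forall>t. 0 < \<bar>t\<bar> \<and> \<bar>t\<bar> < d' \<longrightarrow> rot p t \<noteq> q"
      using rot_ne_nearby[OF assms(2)] insert by blast
    ultimately show ?case by (intro exI[of _ "min d d'"]) auto
  qed
  then show ?thesis
    using Field_classical[OF assms(1)] assms(2) unfolding regular_def by simp
qed

lemma val_in_range:
  assumes "diagram D" "p \<in> points D" "F \<in> regular D \<rightarrow> X"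
  shows "val_before F p v \<Longrightarrow> v \<in> X" "val_after F p v \<Longrightarrow> v \<in> X"
proof -
  obtain d where d: "d > 0" "\<forall>t. 0 < \<bar>t\<bar> \<and> \<bar>t\<bar> < d \<longrightarrow> rot p t \<in> regular D"
    using regular_nearby[OF assms(1,2)] by blast
  have ev: "\<forall>\<^sub>F t in at_right 0. 0 < t \<and> t < d"
    using d(1) by (auto simp: eventually_at_right_field intro!: exI[of _ d])
  have X: "F (rot p t) \<in> X" if "0 < \<bar>t\<bar>" "\<bar>t\<bar> < d" for t using d that assms(3) by blast
  show "v \<in> X" if "val_before F p v"
  proof -
    have "\<forall>\<^sub>F t in at_right (0::real). v \<in> X"
      using that[unfolded val_before_def] ev
    proof eventually_elim
      case (elim t) then show ?case using X[of "- t"] by simp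
    qed
    then show ?thesis by (simp add: eventually_const)
  qed
  show "v \<in> X" if "val_after F p v"
  proof -
    have "\<forall>\<^sub>F t in at_right (0::real). v \<in> X"
      using that[unfolded val_after_def] ev
    proof eventually_elim
      case (elim t) then show ?case using X[of t] by simp
    qed
    then show ?thesis by (simp add: eventually_const)
  qed
qed

lemma val_compose:
  assumes "diagram D" "p \<in> points D"
  shows "val_before F p v \<Longrightarrow> val_before (compose (regular D) \<alpha> F) p (\<alpha> v)"
    "val_after F p v \<Longrightarrow> val_after (compose (regular D) \<alpha> F) p (\<alpha> v)"
proof -
  obtain d where d: "d > 0" "\<forall>t. 0 < \<bar>t\<bar> \<and> \<bar>t\<bar> < d \<longrightarrow> rot p t \<in> regular D"
    using regular_nearby[OF assms] by blast
  have ev: "\<forall>\<^sub>F t in at_right 0. 0 < t \<and> t < d"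
    using d(1) by (auto simp: eventually_at_right_field intro!: exI[of _ d])
  show "val_before (compose (regular D) \<alpha> F) p (\<alpha> v)" if "val_before F p v"
    using that[unfolded val_before_def] ev unfolding val_before_def
  proof eventually_elim
    case (elim t) then show ?case using d(2) by (simp add: compose_def)
  qed
  show "val_after (compose (regular D) \<alpha> F) p (\<alpha> v)" if "val_after F p v"
    using that[unfolded val_after_def] ev unfolding val_after_def
  proof eventually_elim
    case (elim t) then show ?case using d(2) by (simp add: compose_def)
  qed
qed

lemma point_colorings_compose:
  assumes "diagram D" and \<alpha>: "\<alpha> \<in> endomorphisms X ut ot" and F: "F \<in> point_colorings X ut ot D"
  shows "compose (regular D) \<alpha> F \<in> point_colorings X ut ot D"
proof -
  let ?G = "compose (regular D) \<alpha> F"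
  have FX: "F \<in> regular D \<rightarrow> X" using point_coloringsD(1)[OF F] by auto
  show ?thesis
  proof (rule point_coloringsI)
    show "?G \<in> regular D \<rightarrow>\<^sub>E X" using FX endo_in[OF \<alpha>] by (auto simp: compose_def)
    fix p assume p: "p \<in> regular D"
    then have "p \<in> points D" by (simp add: regular_def)
    show "val_before ?G p (?G p)" "val_after ?G p (?G p)"
      unfolding compose_eq[OF p]
      by (rule val_compose[OF assms(1) \<open>p \<in> points D\<close>], rule point_coloringsD(2,3)[OF F p])+
  next
    fix p q assume pq: "(p, q) \<in> classical D"
    have P: "p \<in> points D" "q \<in> points D"
      using Field_classical(2)[OF assms(1)] pq by (auto simp: Field_def)
    obtain p1 p2 q1 q2 where *: "val_before F p p1" "val_after F p p2" "val_before F q q1" "val_after F q q2"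
      "crossing ut ot (cross2 (velocity D p) (velocity D q) > 0) p1 p2 q1 q2"
      using point_colorings_crossing[OF F pq] .
    have "crossing ut ot (cross2 (velocity D p) (velocity D q) > 0) (\<alpha> p1) (\<alpha> p2) (\<alpha> q1) (\<alpha> q2)"
      using crossing_endo[OF \<alpha> *(5)] * val_in_range[OF assms(1) P(1) FX] val_in_range[OF assms(1) P(2) FX]
      by simp
    then show "crossing_colored ut ot D ?G p q"
      unfolding crossing_colored_def
      using val_compose(1)[OF assms(1) P(1) *(1)] val_compose(2)[OF assms(1) P(1) *(2)]
        val_compose(1)[OF assms(1) P(2) *(3)] val_compose(2)[OF assms(1) P(2) *(4)] by metis
  qed
qed

section \<open>Semi-arcs as connected components\<close>

definition arc_of :: "vdiagram \<Rightarrow> pt \<Rightarrow> semi_arc" where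
  "arc_of D p = (fst p, connected_component_set (sphere 0 1 - {z. (fst p, z) \<in> Field (classical D)}) (snd p))"

lemma regular_iff:
  "p \<in> regular D \<longleftrightarrow> fst p < ncomp D \<and> snd p \<in> sphere 0 1 - {z. (fst p, z) \<in> Field (classical D)}"
  by (cases p) (auto simp: regular_def points_def)

lemma arc_of_in_semi_arcs: "p \<in> regular D \<Longrightarrow> arc_of D p \<in> semi_arcs D"
  unfolding arc_of_def semi_arcs_def regular_iff by (auto intro: componentsI)

lemma self_in_arc_of: "p \<in> regular D \<Longrightarrow> snd p \<in> snd (arc_of D p)"
  unfolding arc_of_def regular_iff by simp

lemma semi_arc_nonempty: "a \<in> semi_arcs D \<Longrightarrow> snd a \<noteq> {}"
  unfolding semi_arcs_def by (auto dest: in_components_nonempty)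

lemma semi_arc_eq_arc_of:
  assumes "a \<in> semi_arcs D" "fst p = fst a" "snd p \<in> snd a"
  shows "p \<in> regular D" "arc_of D p = a"
proof -
  let ?S = "sphere 0 1 - {z. (fst a, z) \<in> Field (classical D)}"
  have a: "fst a < ncomp D" "snd a \<in> components ?S"
    using assms(1) unfolding semi_arcs_def by auto
  show "p \<in> regular D"
    unfolding regular_iff using a assms in_components_subset[OF a(2)] by auto
  obtain x where "snd a = connected_component_set ?S x" using a(2) by (auto simp: components_iff)
  then have "connected_component_set ?S (snd p) = snd a"
    using assms(3) connected_component_eq by metis
  then show "arc_of D p = a" unfolding arc_of_def assms(2) by (simp add: prod_eq_iff)
qed

lemma arc_of_rot_eq:
  assumes "topological_space_class.connected I" "\<And>t. t \<in> I \<Longrightarrow> rot p t \<in> regular D" "s \<in> I" "t \<in> I"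
  shows "arc_of D (rot p s) = arc_of D (rot p t)"
proof -
  let ?S = "sphere 0 1 - {z. (fst p, z) \<in> Field (classical D)}"
  let ?J = "(\<lambda>t. snd p * cis t) ` I"
  have "topological_space_class.connected ?J"
    by (intro connected_continuous_image continuous_intros assms(1))
  moreover have "?J \<subseteq> ?S" using assms(2) unfolding regular_iff by auto
  ultimately have "connected_component ?S (snd p * cis s) (snd p * cis t)"
    unfolding connected_component_def using assms(3,4) by blast
  then show ?thesis unfolding arc_of_def by (simp add: connected_component_eq)
qed

lemma arc_unique:
  assumes ev: "\<forall>\<^sub>F t in at_right 0. snd p * cis (g t) \<in> snd a"
    and ev': "\<forall>\<^sub>F t in at_right (0::real). snd p * cis (g t) \<in> snd b"
    and "a \<in> semi_arcs D" "b \<in> semi_arcs D" "fst a = fst p" "fst b = fst p"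
  shows "a = b"
proof -
  have "\<forall>\<^sub>F t in at_right (0::real). a = b"
    using ev ev'
  proof eventually_elim
    case (elim t)
    then show ?case
      using semi_arc_eq_arc_of(2)[OF assms(3), of "rot p (g t)"]
        semi_arc_eq_arc_of(2)[OF assms(4), of "rot p (g t)"] assms(5,6) by simp
  qed
  then show ?thesis by (simp add: eventually_const)
qed

text \<open>With \<sigma> equal to -1 or 1 this evaluates the definite descriptions in
  \<open>arc_in\<close> and \<open>arc_out\<close>: a one-sided punctured neighbourhood is
  connected, so it lies in a single component, and distinct components cannot both contain its
  points.\<close>

lemma the_adjacent_arc:
  assumes reg: "\<And>t. 0 < t \<Longrightarrow> t < d \<Longrightarrow> rot p (\<sigma> * t) \<in> regular D" and s: "0 < s" "s < d"
  shows "(THE a. a \<in> semi_arcs D \<and> fst a = fst p \<and> (\<forall>\<^sub>F t in at_right 0. snd p * cis (\<sigma> * t) \<in> snd a)) =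
    arc_of D (rot p (\<sigma> * s))"
proof -
  let ?a = "arc_of D (rot p (\<sigma> * s))"
  have conn: "topological_space_class.connected ((*) \<sigma> ` {0<..<d})"
    by (intro connected_continuous_image continuous_intros connected_Ioo)
  have eq: "arc_of D (rot p (\<sigma> * t)) = ?a" if "0 < t" "t < d" for t
    by (rule arc_of_rot_eq[OF conn]) (use reg s that in auto)
  have ev: "\<forall>\<^sub>F t in at_right 0. 0 < t \<and> t < d"
    using s by (auto simp: eventually_at_right_field intro!: exI[of _ d])
  have P: "\<forall>\<^sub>F t in at_right 0. snd p * cis (\<sigma> * t) \<in> snd ?a"
    using ev
  proof eventually_elim
    case (elim t)
    then show ?case using self_in_arc_of[OF reg[of t]] eq[of t] by simp
  qed
  show ?thesis
  proof (rule the_equality)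
    show "?a \<in> semi_arcs D \<and> fst ?a = fst p \<and> (\<forall>\<^sub>F t in at_right 0. snd p * cis (\<sigma> * t) \<in> snd ?a)"
      using P arc_of_in_semi_arcs[OF reg[OF s]] by (simp add: arc_of_def)
    then show "a = ?a" if "a \<in> semi_arcs D \<and> fst a = fst p \<and>
        (\<forall>\<^sub>F t in at_right 0. snd p * cis (\<sigma> * t) \<in> snd a)" for a
      using arc_unique[of p "(*) \<sigma>"] that by blast
  qed
qed

definition point_coloring_of :: "vdiagram \<Rightarrow> (semi_arc \<Rightarrow> 'a) \<Rightarrow> pt \<Rightarrow> 'a" where
  "point_coloring_of D f = (\<lambda>p\<in>regular D. f (arc_of D p))"

lemma arc_in_out:
  assumes "diagram D" "p \<in> points D"
  shows "arc_in D p \<in> semi_arcs D" "arc_out D p \<in> semi_arcs D"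
    "val_before (point_coloring_of D f) p (f (arc_in D p))"
    "val_after (point_coloring_of D f) p (f (arc_out D p))"
    "p \<in> regular D \<Longrightarrow> arc_in D p = arc_of D p" "p \<in> regular D \<Longrightarrow> arc_out D p = arc_of D p"
proof -
  obtain d where d: "d > 0" "\<And>t. 0 < \<bar>t\<bar> \<Longrightarrow> \<bar>t\<bar> < d \<Longrightarrow> rot p t \<in> regular D"
    using regular_nearby[OF assms] by blast
  have 1: "rot p t \<in> regular D" "rot p (- t) \<in> regular D" if "0 < t" "t < d" for t
    using d(2)[of t] d(2)[of "- t"] that by auto
  have i: "arc_in D p = arc_of D (rot p (- t))" if "0 < t" "t < d" for t
    using the_adjacent_arc[of d p "-1" D t] 1 that by (simp add: arc_in_def)
  have o: "arc_out D p = arc_of D (rot p t)" if "0 < t" "t < d" for t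
    using the_adjacent_arc[of d p 1 D t] 1 that by (simp add: arc_out_def)
  show "arc_in D p \<in> semi_arcs D" "arc_out D p \<in> semi_arcs D"
    using i[of "d/2"] o[of "d/2"] 1[of "d/2"] d(1) arc_of_in_semi_arcs by simp_all
  have ev: "\<forall>\<^sub>F t in at_right 0. 0 < t \<and> t < d"
    using d(1) by (auto simp: eventually_at_right_field intro!: exI[of _ d])
  show "val_before (point_coloring_of D f) p (f (arc_in D p))"
    unfolding val_before_def using ev
    by eventually_elim (simp add: point_coloring_of_def i[symmetric] 1)
  show "val_after (point_coloring_of D f) p (f (arc_out D p))"
    unfolding val_after_def using ev
    by eventually_elim (simp add: point_coloring_of_def o[symmetric] 1)
  assume p: "p \<in> regular D"
  \<comment> \<open>At a regular point the neighbourhood need not be punctured, so the arcs on the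
    two sides coincide with the arc through \<open>p\<close>.\<close>
  have *: "rot p t \<in> regular D" if "t \<in> {-d<..<d}" for t
    using d(2)[of t] p that by (cases "t = 0") auto
  have "arc_of D (rot p t) = arc_of D (rot p 0)" if "t \<in> {-d<..<d}" for t
    by (rule arc_of_rot_eq[of "{-d<..<d}"]) (use * that d(1) in \<open>auto simp: connected_Ioo\<close>)
  then show "arc_in D p = arc_of D p" "arc_out D p = arc_of D p"
    using i[of "d/2"] o[of "d/2"] d(1) by simp_all
qed

text \<open>Transversality enters here. The determinants for \<open>(p, q)\<close> and
  \<open>(q, p)\<close> are opposite and nonzero, so one sign decides all four arcs, although
  \<open>right_arc\<close> and \<open>left_arc\<close> test each order separately.\<close>

lemma coloring_crossing_iff:
  assumes "diagram D" "(p, q) \<in> classical D"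
  shows "(let x = f (right_arc D p q); y = f (right_arc D q p)
         in f (left_arc D p q) = ut x y \<and> f (left_arc D q p) = ot y x) \<longleftrightarrow>
    crossing ut ot (cross2 (velocity D p) (velocity D q) > 0)
      (f (arc_in D p)) (f (arc_out D p)) (f (arc_in D q)) (f (arc_out D q))"
proof -
  have "cross2 (velocity D p) (velocity D q) \<noteq> 0"
    using assms unfolding diagram_def by blast
  moreover have "cross2 (velocity D q) (velocity D p) = - cross2 (velocity D p) (velocity D q)"
    by (simp add: cross2_def)
  ultimately show ?thesis
    by (auto simp: right_arc_def left_arc_def crossing_def Let_def)
qed

text \<open>Passage from neighbourhoods in the circle to neighbourhoods of angles:
  \<open>Arg\<close> is continuous at 1, so \<open>Arg (w / z)\<close> is a small angle when
  \<open>w\<close> is close to \<open>z\<close>.\<close>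

lemma eventually_within_sphere:
  assumes "z \<in> sphere (0::complex) 1" "S \<subseteq> sphere 0 1" "d > 0" "\<And>t. \<bar>t\<bar> < d \<Longrightarrow> P (z * cis t)"
  shows "\<forall>\<^sub>F w in at z within S. P w"
proof -
  have z: "z \<noteq> 0" "norm z = 1" using assms(1) by auto
  have "((\<lambda>w. Arg (w / z)) \<longlongrightarrow> Arg (z / z)) (at z within S)"
    by (rule isCont_tendsto_compose[where g = Arg])
      (use z in \<open>auto intro!: continuous_at_Arg tendsto_eq_intros\<close>)
  then have "\<forall>\<^sub>F w in at z within S. dist (Arg (w / z)) 0 < d"
    using assms(3) z by (auto dest!: tendstoD)
  moreover have "\<forall>\<^sub>F w in at z within S. w \<in> S"
    by (simp add: eventually_at_filter)
  ultimately show ?thesis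
  proof eventually_elim
    case (elim w)
    then have "norm w = 1" using assms(2) by auto
    then have "cis (Arg (w / z)) = w / z"
      using z by (subst cis_Arg) (auto simp: sgn_eq norm_divide)
    then have "w = z * cis (Arg (w / z))" using z by simp
    then show ?case using assms(4)[of "Arg (w / z)"] elim(1) by simp
  qed
qed

lemma point_coloring_const_on_arc:
  assumes F: "F \<in> point_colorings X ut ot D" and p: "p \<in> regular D" "q \<in> regular D" "arc_of D p = arc_of D q"
  shows "F p = F q"
proof -
  let ?S = "sphere 0 1 - {z. (fst p, z) \<in> Field (classical D)}"
  let ?C = "connected_component_set ?S (snd p)"
  have fst: "fst p = fst q" using p(3) by (simp add: arc_of_def)
  have sub: "?C \<subseteq> ?S" by (rule connected_component_subset)
  have "F (fst p, snd p) = F (fst p, snd q)"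
  proof (rule connected_local_const[where A = ?C and f = "\<lambda>z. F (fst p, z)"])
    show "topological_space_class.connected ?C" by simp
    show "snd p \<in> ?C" "snd q \<in> ?C"
      using self_in_arc_of[OF p(1)] self_in_arc_of[OF p(2), folded p(3)] by (simp_all add: arc_of_def)
    show "\<forall>z\<in>?C. \<forall>\<^sub>F w in at z within ?C. F (fst p, z) = F (fst p, w)"
    proof
      fix z assume "z \<in> ?C"
      then have z: "z \<in> ?S" using sub by blast
      let ?r = "(fst p, z)"
      have r: "?r \<in> regular D" using z p(1) unfolding regular_iff by simp
      obtain d1 where d1: "d1 > 0" "\<And>t. 0 < t \<Longrightarrow> t < d1 \<Longrightarrow> F (rot ?r (- t)) = F ?r"
        using point_coloringsD(2)[OF F r] unfolding val_before_def eventually_at_right_field by auto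
      obtain d2 where d2: "d2 > 0" "\<And>t. 0 < t \<Longrightarrow> t < d2 \<Longrightarrow> F (rot ?r t) = F ?r"
        using point_coloringsD(3)[OF F r] unfolding val_after_def eventually_at_right_field by auto
      have "F ?r = F (rot ?r t)" if "\<bar>t\<bar> < min d1 d2" for t
        using d1(2)[of "- t"] d2(2)[of t] that by (cases "t = 0"; cases "t > 0") auto
      then show "\<forall>\<^sub>F w in at z within ?C. F (fst p, z) = F (fst p, w)"
        using z sub d1(1) d2(1)
        by (intro eventually_within_sphere[of z _ "min d1 d2"]) (auto simp: rot_def)
    qed
  qed
  then show ?thesis using fst by (metis prod.collapse)
qed

lemma equivariant_point_colorings:
  assumes D: "diagram D"
  shows "equivariant (endomorphisms X ut ot) (semi_arcs D) (colorings X ut ot D)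
    (regular D) (point_colorings X ut ot D)"
  unfolding equivariant_def
proof (intro exI[of _ "point_coloring_of D"] conjI ballI)
  let ?E = "endomorphisms X ut ot"
  have field: "p \<in> points D" "q \<in> points D" if "(p, q) \<in> classical D" for p q
    using Field_classical(2)[OF D] that by (auto simp: Field_def)
  have color: "f \<in> semi_arcs D \<rightarrow>\<^sub>E X"
    "\<And>p q. (p, q) \<in> classical D \<Longrightarrow> crossing ut ot (cross2 (velocity D p) (velocity D q) > 0)
      (f (arc_in D p)) (f (arc_out D p)) (f (arc_in D q)) (f (arc_out D q))"
    if "f \<in> colorings X ut ot D" for f
    using that coloring_crossing_iff[OF D, of _ _ f ut ot] unfolding colorings_def by blast+
  show "bij_betw (point_coloring_of D) (colorings X ut ot D) (point_colorings X ut ot D)"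
  proof (rule bij_betw_imageI)
    show "inj_on (point_coloring_of D) (colorings X ut ot D)"
    proof (rule inj_onI)
      fix f g assume f: "f \<in> colorings X ut ot D" and g: "g \<in> colorings X ut ot D"
        and eq: "point_coloring_of D f = point_coloring_of D g"
      show "f = g"
      proof (rule PiE_ext[OF color(1)[OF f] color(1)[OF g]])
        fix a assume a: "a \<in> semi_arcs D"
        then have "snd a \<noteq> {}" by (rule semi_arc_nonempty)
        then obtain z where "z \<in> snd a" by blast
        then have z: "(fst a, z) \<in> regular D" "arc_of D (fst a, z) = a"
          using semi_arc_eq_arc_of[OF a, of "(fst a, z)"] by simp_all
        show "f a = g a" using fun_cong[OF eq, of "(fst a, z)"] z by (simp add: point_coloring_of_def)
      qed
    qed
    show "point_coloring_of D ` colorings X ut ot D = point_colorings X ut ot D"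
    proof (intro equalityI subsetI)
      fix F assume "F \<in> point_coloring_of D ` colorings X ut ot D"
      then obtain f where f: "f \<in> colorings X ut ot D" and F: "F = point_coloring_of D f" by blast
      show "F \<in> point_colorings X ut ot D"
      proof (rule point_coloringsI)
        show "F \<in> regular D \<rightarrow>\<^sub>E X"
          using color(1)[OF f] arc_of_in_semi_arcs unfolding F point_coloring_of_def by auto
        fix p assume p: "p \<in> regular D"
        then have P: "p \<in> points D" by (simp add: regular_def)
        show "val_before F p (F p)" "val_after F p (F p)"
          using arc_in_out(3,4)[OF D P, of f] arc_in_out(5,6)[OF D P p] p unfolding F
          by (simp_all add: point_coloring_of_def[of D f, THEN fun_cong, of p])
      next
        fix p q assume pq: "(p, q) \<in> classical D"
        show "crossing_colored ut ot D F p q"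
      unfolding crossing_colored_def
          using color(2)[OF f pq] arc_in_out(3,4)[OF D field(1)[OF pq], of f]
            arc_in_out(3,4)[OF D field(2)[OF pq], of f] unfolding F by blast
      qed
    next
      fix F assume F: "F \<in> point_colorings X ut ot D"
      \<comment> \<open>The representative of the semi-arc may be chosen arbitrarily because a point
        coloring is constant along it.\<close>
      define f where "f = (\<lambda>a\<in>semi_arcs D. F (fst a, SOME z. z \<in> snd a))"
      have f: "f a \<in> X" "\<And>p. p \<in> regular D \<Longrightarrow> arc_of D p = a \<Longrightarrow> F p = f a" if a: "a \<in> semi_arcs D" for a
      proof -
        have "(SOME z. z \<in> snd a) \<in> snd a" using semi_arc_nonempty[OF a] by (simp add: some_in_eq)
        then have z: "(fst a, SOME z. z \<in> snd a) \<in> regular D" "arc_of D (fst a, SOME z. z \<in> snd a) = a"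
          using semi_arc_eq_arc_of[OF a, of "(fst a, SOME z. z \<in> snd a)"] by simp_all
        show "f a \<in> X" unfolding f_def using a z point_coloringsD(1)[OF F] by auto
        show "F p = f a" if "p \<in> regular D" "arc_of D p = a" for p
          using point_coloring_const_on_arc[OF F that(1) z(1)] z(2) that(2) a by (simp add: f_def)
      qed
      have eq: "point_coloring_of D f = F"
      proof
        fix p show "point_coloring_of D f p = F p"
          using f(2)[OF arc_of_in_semi_arcs, of p p] point_coloringsD(1)[OF F]
          by (cases "p \<in> regular D") (auto simp: point_coloring_of_def)
      qed
      have "f \<in> colorings X ut ot D"
        unfolding colorings_def
      proof (intro CollectI conjI)
        show "f \<in> semi_arcs D \<rightarrow>\<^sub>E X" using f(1) by (auto simp: f_def)
        have "let x = f (right_arc D p q); y = f (right_arc D q p)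
           in f (left_arc D p q) = ut x y \<and> f (left_arc D q p) = ot y x"
          if pq: "(p, q) \<in> classical D" for p q
        proof -
          obtain p1 p2 q1 q2 where *: "val_before F p p1" "val_after F p p2" "val_before F q q1" "val_after F q q2"
            "crossing ut ot (cross2 (velocity D p) (velocity D q) > 0) p1 p2 q1 q2"
            using point_colorings_crossing[OF F pq] .
          have "p1 = f (arc_in D p)" "p2 = f (arc_out D p)" "q1 = f (arc_in D q)" "q2 = f (arc_out D q)"
            using *(1-4) arc_in_out(3,4)[OF D field(1)[OF pq], of f]
              arc_in_out(3,4)[OF D field(2)[OF pq], of f] unfolding eq
            by (auto intro: val_before_unique val_after_unique)
          then show ?thesis using *(5) coloring_crossing_iff[OF D pq, of f ut ot] by simp
        qed
        then show "\<forall>(p, q)\<in>classical D. let x = f (right_arc D p q); y = f (right_arc D q p)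
           in f (left_arc D p q) = ut x y \<and> f (left_arc D q p) = ot y x" by blast
      qed
      then show "F \<in> point_coloring_of D ` colorings X ut ot D" using eq by blast
    qed
  qed
  fix \<alpha> f assume "\<alpha> \<in> ?E" "f \<in> colorings X ut ot D"
  show "point_coloring_of D (compose (semi_arcs D) \<alpha> f) = compose (regular D) \<alpha> (point_coloring_of D f)"
    by (rule ext) (auto simp: point_coloring_of_def compose_def arc_of_in_semi_arcs)
qed

lemma colorings_compose:
  assumes "diagram D" and \<alpha>: "\<alpha> \<in> endomorphisms X ut ot" and f: "f \<in> colorings X ut ot D"
  shows "compose (semi_arcs D) \<alpha> f \<in> colorings X ut ot D"
proof -
  have fX: "f \<in> semi_arcs D \<rightarrow> X" using f by (auto simp: colorings_def)
  have cross: "let x = f (right_arc D p q); y = f (right_arc D q p)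
           in f (left_arc D p q) = ut x y \<and> f (left_arc D q p) = ot y x"
    if "(p, q) \<in> classical D" for p q using f that unfolding colorings_def by blast
  let ?g = "compose (semi_arcs D) \<alpha> f"
  have "let x = ?g (right_arc D p q); y = ?g (right_arc D q p)
           in ?g (left_arc D p q) = ut x y \<and> ?g (left_arc D q p) = ot y x"
    if pq: "(p, q) \<in> classical D" for p q
  proof -
    have P: "p \<in> points D" "q \<in> points D"
      using Field_classical(2)[OF assms(1)] pq by (auto simp: Field_def)
    have a: "arc_in D p \<in> semi_arcs D" "arc_out D p \<in> semi_arcs D" 
      "arc_in D q \<in> semi_arcs D" "arc_out D q \<in> semi_arcs D"
      using arc_in_out[OF assms(1) P(1)] arc_in_out[OF assms(1) P(2)] by blast+
    have X: "f (arc_in D p) \<in> X" "f (arc_out D p) \<in> X" "f (arc_in D q) \<in> X" "f (arc_out D q) \<in> X"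
      using a fX by blast+
    show ?thesis
      using crossing_endo[OF \<alpha> _ X] cross[OF pq] a
      unfolding coloring_crossing_iff[OF assms(1) pq] by (simp add: compose_def)
  qed
  moreover have "?g \<in> semi_arcs D \<rightarrow>\<^sub>E X" using fX endo_in[OF \<alpha>] by (auto simp: compose_def)
  ultimately show ?thesis unfolding colorings_def by blast
qed

text \<open>The plane enters a coloring only through the signs of the crossings. Planar isotopies
  and the virtual and mixed moves keep the classical crossings as pairs of circle points, so for
  them the colorings are literally the same functions.\<close>

lemma colorings_eqI:
  assumes "ncomp D1 = ncomp D2" "classical D1 = classical D2"
    and "\<And>p q. (p, q) \<in> classical D1 \<Longrightarrow>
      sgn (cross2 (velocity D1 p) (velocity D1 q)) = sgn (cross2 (velocity D2 p) (velocity D2 q))"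
  shows "semi_arcs D1 = semi_arcs D2" "colorings X ut ot D1 = colorings X ut ot D2"
proof -
  show sa: "semi_arcs D1 = semi_arcs D2" using assms(1,2) unfolding semi_arcs_def by simp
  have io: "arc_in D1 = arc_in D2" "arc_out D1 = arc_out D2"
    unfolding arc_in_def arc_out_def fun_eq_iff sa by simp_all
  have anti: "cross2 v w = - cross2 w v" for v w by (simp add: cross2_def)
  have s: "cross2 (velocity D1 p) (velocity D1 q) > 0 \<longleftrightarrow> cross2 (velocity D2 p) (velocity D2 q) > 0"
     "cross2 (velocity D1 q) (velocity D1 p) > 0 \<longleftrightarrow> cross2 (velocity D2 q) (velocity D2 p) > 0"
    if "(p, q) \<in> classical D1" for p q
    using assms(3)[OF that] anti[of "velocity D1 q"] anti[of "velocity D2 q"]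
    by (auto simp: sgn_real_def split: if_splits)
  have "right_arc D1 p q = right_arc D2 p q" "right_arc D1 q p = right_arc D2 q p"
    "left_arc D1 p q = left_arc D2 p q" "left_arc D1 q p = left_arc D2 q p"
    if "(p, q) \<in> classical D1" for p q
    unfolding right_arc_def left_arc_def io s[OF that] by simp_all
  then show "colorings X ut ot D1 = colorings X ut ot D2"
    unfolding colorings_def sa assms(2)[symmetric]
    by (intro Collect_cong conj_cong refl ball_cong) auto
qed

section \<open>Reduction to a single elementary step\<close>

abbreviation equivalent_colorings ::
  "'a set \<Rightarrow> ('a \<Rightarrow> 'a \<Rightarrow> 'a) \<Rightarrow> ('a \<Rightarrow> 'a \<Rightarrow> 'a) \<Rightarrow> vdiagram \<Rightarrow> vdiagram \<Rightarrow> bool" where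
  "equivalent_colorings X ut ot D1 D2 \<equiv>
     equivariant (endomorphisms X ut ot) (semi_arcs D1) (colorings X ut ot D1) (semi_arcs D2) (colorings X ut ot D2)"

abbreviation equivalent_point_colorings ::
  "'a set \<Rightarrow> ('a \<Rightarrow> 'a \<Rightarrow> 'a) \<Rightarrow> ('a \<Rightarrow> 'a \<Rightarrow> 'a) \<Rightarrow> vdiagram \<Rightarrow> vdiagram \<Rightarrow> bool" where
  "equivalent_point_colorings X ut ot D1 D2 \<equiv>
     equivariant (endomorphisms X ut ot) (regular D1) (point_colorings X ut ot D1) (regular D2) (point_colorings X ut ot D2)"

text \<open>All stages have the same vertices, so one bijection serves at every stage and
  compatibility with the inclusions is automatic. Edges from \<open>u\<close> to \<open>v\<close>
  correspond to the \<alpha> that carry \<open>u\<close> to \<open>v\<close>, a condition that an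
  equivariant injection preserves and reflects.\<close>

lemma isomorphic_filtrations_of_equivalent_colorings:
  assumes S: "endo_filtration X ut ot m S" and D: "diagram D1" "diagram D2"
    and eqv: "equivalent_colorings X ut ot D1 D2"
  shows "isomorphic_filtrations m (coloring_quiver_filtration X ut ot S D1)
           (coloring_quiver_filtration X ut ot S D2)"
proof -
  have Si: "S i \<subseteq> endomorphisms X ut ot" if "i \<le> m" for i
    using S that unfolding endo_filtration_def by blast
  have wf: "wf_digraph (coloring_quiver_filtration X ut ot S D i)" if "i \<le> m" "diagram D" for i D
    by (rule wf_digraph.intro)
      (use colorings_compose[OF that(2) subsetD[OF Si[OF that(1)]]] in
        \<open>auto simp: coloring_quiver_filtration_def coloring_quiver_def\<close>)
  have filt: "quiver_filtration m (coloring_quiver_filtration X ut ot S D)" if "diagram D" for D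
    unfolding quiver_filtration_def
  proof (intro conjI allI impI)
    fix i assume i: "i < m"
    then have sub: "S i \<subseteq> S (Suc i)" using S unfolding endo_filtration_def by blast
    show "subgraph (coloring_quiver_filtration X ut ot S D i) (coloring_quiver_filtration X ut ot S D (Suc i))"
      using wf[of i D] wf[of "Suc i" D] that i sub
      unfolding subgraph_def compatible_def
      by (auto simp: coloring_quiver_filtration_def coloring_quiver_def)
  qed (use wf that in blast)
  obtain \<psi> where \<psi>: "bij_betw \<psi> (colorings X ut ot D1) (colorings X ut ot D2)"
    "\<And>\<alpha> f. \<alpha> \<in> endomorphisms X ut ot \<Longrightarrow> f \<in> colorings X ut ot D1 \<Longrightarrow>
      \<psi> (compose (semi_arcs D1) \<alpha> f) = compose (semi_arcs D2) \<alpha> (\<psi> f)"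
    using eqv unfolding equivariant_def by blast
  have count: "edge_count (coloring_quiver_filtration X ut ot S D i) u v =
      card {\<alpha> \<in> S i. compose (semi_arcs D) \<alpha> u = v}"
    if "u \<in> colorings X ut ot D" for D i u v
  proof -
    have "{e \<in> arcs (coloring_quiver_filtration X ut ot S D i).
        tail (coloring_quiver_filtration X ut ot S D i) e = u \<and>
        head (coloring_quiver_filtration X ut ot S D i) e = v} =
      Pair u ` {\<alpha> \<in> S i. compose (semi_arcs D) \<alpha> u = v}"
      using that by (auto simp: coloring_quiver_filtration_def coloring_quiver_def)
    then show ?thesis unfolding edge_count_def by (simp add: card_image inj_on_def)
  qed
  have "quiver_iso \<psi> (coloring_quiver_filtration X ut ot S D1 i) (coloring_quiver_filtration X ut ot S D2 i)"
    if i: "i \<le> m" for i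
    unfolding quiver_iso_def
  proof (intro conjI ballI)
    show "bij_betw \<psi> (verts (coloring_quiver_filtration X ut ot S D1 i))
       (verts (coloring_quiver_filtration X ut ot S D2 i))"
      using \<psi>(1) by (simp add: coloring_quiver_filtration_def coloring_quiver_def)
    fix u v
    assume "u \<in> verts (coloring_quiver_filtration X ut ot S D1 i)"
      "v \<in> verts (coloring_quiver_filtration X ut ot S D1 i)"
    then have u: "u \<in> colorings X ut ot D1" and v: "v \<in> colorings X ut ot D1"
      by (simp_all add: coloring_quiver_filtration_def coloring_quiver_def)
    have "compose (semi_arcs D1) \<alpha> u = v \<longleftrightarrow> compose (semi_arcs D2) \<alpha> (\<psi> u) = \<psi> v"
      if "\<alpha> \<in> S i" for \<alpha>
    proof -
      have \<alpha>: "\<alpha> \<in> endomorphisms X ut ot" using that Si[OF i] by blast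
      show ?thesis
        unfolding \<psi>(2)[OF \<alpha> u, symmetric]
        using inj_on_eq_iff[OF bij_betw_imp_inj_on[OF \<psi>(1)] colorings_compose[OF D(1) \<alpha> u] v] by simp
    qed
    then have "{\<alpha> \<in> S i. compose (semi_arcs D1) \<alpha> u = v} = {\<alpha> \<in> S i. compose (semi_arcs D2) \<alpha> (\<psi> u) = \<psi> v}"
      by blast
    then show "edge_count (coloring_quiver_filtration X ut ot S D1 i) u v =
        edge_count (coloring_quiver_filtration X ut ot S D2 i) (\<psi> u) (\<psi> v)"
      using count[OF u] count[OF bij_betwE[OF \<psi>(1), rule_format, OF u]] by simp
  qed
  then show ?thesis
    unfolding isomorphic_filtrations_def using filt D by (auto intro!: exI[of _ "\<lambda>_. \<psi>"])
qed

lemma equivalent_colorings_of_virtually_equivalent: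
  assumes step: "\<And>D D'. diagram D \<Longrightarrow> diagram D' \<Longrightarrow>
      reparametrization D D' \<or> planar_isotopy D D' \<or> reidemeister_move D D' \<Longrightarrow>
      equivalent_colorings X ut ot D D'"
    and "virtually_equivalent D1 D2"
  shows "equivalent_colorings X ut ot D1 D2"
  using assms(2) unfolding virtually_equivalent_def
proof (induction rule: equivclp_induct)
  case base
  show ?case by (rule equivariant_refl)
next
  case (step y z)
  have "equivalent_colorings X ut ot y z" if "elementary_step y z" for y z
    using that assms(1) unfolding elementary_step_def by blast
  \<comment> \<open>\<open>equivclp\<close> allows steps in either direction; both ends of an
    elementary step are diagrams, so the closure needed for symmetry is available.\<close>
  moreover have "equivalent_colorings X ut ot y z" if "elementary_step z y"
    using equivariant_sym[OF calculation[OF that]] colorings_compose that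
    unfolding elementary_step_def by blast
  ultimately have "equivalent_colorings X ut ot y z" using step(2) by blast
  with step(3) show ?case by (rule equivariant_trans)
qed

lemma equivalent_colorings_of_points:
  assumes "diagram D1" "diagram D2"
    and "equivalent_point_colorings X ut ot D1 D2"
  shows "equivalent_colorings X ut ot D1 D2"
proof -
  have "equivariant (endomorphisms X ut ot) (regular D2) (point_colorings X ut ot D2) (semi_arcs D2) (colorings X ut ot D2)"
    by (rule equivariant_sym[OF equivariant_point_colorings[OF assms(2)]])
      (rule colorings_compose[OF assms(2)])
  then show ?thesis
    using equivariant_trans[OF equivariant_trans[OF equivariant_point_colorings[OF assms(1)] assms(3)]] by blast
qed

lemma has_vector_derivative_shift: "((\<lambda>t. s + t) has_vector_derivative 1) (at (0::real))"
  unfolding has_vector_derivative_def by (auto intro!: derivative_eq_intros)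

section \<open>Planar isotopies and reparametrizations\<close>

lemma curve_has_velocity:
  assumes "diagram D" "i < ncomp D"
  shows "((\<lambda>t. curve D i (cis t)) has_vector_derivative velocity D (i, cis s)) (at s)"
proof -
  let ?f = "\<lambda>t. curve D i (cis t)"
  have "?f C1_differentiable_on UNIV" using assms unfolding diagram_def by blast
  then obtain d where d: "(?f has_vector_derivative d) (at s)"
    unfolding C1_differentiable_on_def by blast
  have "((\<lambda>t. ?f (s + t)) has_vector_derivative d) (at 0)"
    using vector_diff_chain_at[OF has_vector_derivative_shift, of ?f d s] d by (simp add: o_def)
  then have "velocity D (i, cis s) = d"
    unfolding velocity_def by (simp add: cis_mult vector_derivative_at)
  then show ?thesis using d by simp
qed

lemma point_has_velocity:
  assumes "diagram D" "p \<in> points D"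
  shows "((\<lambda>t. pos D (rot p t)) has_vector_derivative velocity D p) (at 0)"
proof -
  obtain i z where p: "p = (i, z)" by (cases p)
  have z: "i < ncomp D" "norm z = 1" using assms(2) by (auto simp: p points_def)
  then have "z = cis (Arg z)" by (metis cis_Arg div_by_1 norm_zero of_real_1 sgn_eq zero_neq_one)
  then obtain s where s: "z = cis s" by blast
  have "((\<lambda>t. curve D i (cis (s + t))) has_vector_derivative velocity D (i, cis s)) (at 0)"
    using vector_diff_chain_at[OF has_vector_derivative_shift, of "\<lambda>t. curve D i (cis t)" _ s]
      curve_has_velocity[OF assms(1) z(1), of s] by (simp add: o_def)
  then show ?thesis by (simp add: p s pos_def cis_mult)
qed

lemma velocity_eqI:
  assumes "diagram D" "p \<in> points D" "((\<lambda>t. pos D (rot p t)) has_vector_derivative v) (at 0)"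
  shows "velocity D p = v"
  using vector_derivative_unique_at[OF point_has_velocity[OF assms(1,2)] assms(3)] .

text \<open>The factor is the determinant of \<open>f\<close> in the real basis 1,
  \<open>\<i>\<close>.\<close>

lemma linear_cross2:
  assumes "linear f"
  shows "cross2 (f v) (f w) = cross2 (f 1) (f \<i>) * cross2 v w"
proof -
  have f: "f z = Re z *\<^sub>R f 1 + Im z *\<^sub>R f \<i>" for z
  proof -
    have "z = Re z *\<^sub>R 1 + Im z *\<^sub>R \<i>" by (simp add: complex_eq_iff)
    then show ?thesis by (metis assms linear_add linear_scale)
  qed
  show ?thesis
    unfolding f[of v] f[of w] by (simp add: cross2_def algebra_simps)
qed

lemma cross2_eq_0_imp_dependent:
  assumes "cross2 v w = 0"
  shows "\<exists>a b. (a \<noteq> 0 \<or> b \<noteq> 0) \<and> a *\<^sub>R v + b *\<^sub>R w = 0"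
proof (cases "v = 0")
  case True then show ?thesis by (intro exI[of _ 1] exI[of _ 0]) auto
next
  case False
  then have "Re v \<noteq> 0 \<or> Im v \<noteq> 0" by (simp add: complex_eq_iff)
  then show ?thesis
  proof
    assume "Re v \<noteq> 0"
    then show ?thesis using assms
      by (intro exI[of _ "- Re w"] exI[of _ "Re v"]) (auto simp: cross2_def complex_eq_iff algebra_simps)
  next
    assume "Im v \<noteq> 0"
    then show ?thesis using assms
      by (intro exI[of _ "- Im w"] exI[of _ "Im v"]) (auto simp: cross2_def complex_eq_iff algebra_simps)
  qed
qed

text \<open>The Jacobian determinant at a fixed point \<open>z\<close> is continuous in time, equals
  1 at time 0 and never vanishes because the derivatives are bijective. By the intermediate value
  theorem it is still positive at time 1.\<close>

lemma ambient_isotopy_orientation: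
  assumes "ambient_isotopy H"
  obtains L where "(H 1 has_derivative L) (at z)" "cross2 (L 1) (L \<i>) > 0"
proof -
  obtain H' :: "real \<Rightarrow> complex \<Rightarrow> (complex \<Rightarrow>\<^sub>L complex)" where
    H0: "\<And>z. H 0 z = z" and
    H': "\<And>t z. t \<in> {0..1} \<Longrightarrow> (H t has_derivative blinfun_apply (H' t z)) (at z)"
      "\<And>t z. t \<in> {0..1} \<Longrightarrow> bij (blinfun_apply (H' t z))"
      "continuous_on ({0..1} \<times> UNIV) (\<lambda>(t, z). H' t z)"
    using assms unfolding ambient_isotopy_def by blast
  let ?d = "\<lambda>t. cross2 (blinfun_apply (H' t z) 1) (blinfun_apply (H' t z) \<i>)"
  have "continuous_on {0..1} (\<lambda>t. (\<lambda>(t, z). H' t z) (t, z))"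
    by (rule continuous_on_compose2[OF H'(3)]) (auto intro!: continuous_intros)
  then have c: "continuous_on {0..1} (\<lambda>t. H' t z)" by simp
  have cont: "continuous_on {0..1} ?d"
    unfolding cross2_def by (intro continuous_intros c)
  have "H 0 = (\<lambda>z. z)" using H0 by blast
  then have "blinfun_apply (H' 0 z) = (\<lambda>z. z)"
    using has_derivative_unique[OF H'(1)[of 0 z]] by (simp add: has_derivative_ident)
  then have d0: "?d 0 = 1" by (simp add: cross2_def)
  have nz: "?d t \<noteq> 0" if t: "t \<in> {0..1}" for t
  proof
    assume "?d t = 0"
    then obtain a b where ab: "a \<noteq> 0 \<or> b \<noteq> 0" "a *\<^sub>R blinfun_apply (H' t z) 1 + b *\<^sub>R blinfun_apply (H' t z) \<i> = 0"
      using cross2_eq_0_imp_dependent by blast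
    then have "blinfun_apply (H' t z) (a *\<^sub>R 1 + b *\<^sub>R \<i>) = blinfun_apply (H' t z) 0"
      by (simp add: blinfun.add_right blinfun.scaleR_right)
    then have "a *\<^sub>R 1 + b *\<^sub>R \<i> = 0" using injD[OF bij_is_inj[OF H'(2)[OF t]]] by blast
    then show False using ab(1) by (simp add: complex_eq_iff)
  qed
  have "?d 1 > 0"
  proof (rule ccontr)
    assume "\<not> ?d 1 > 0"
    then obtain t where "0 \<le> t" "t \<le> 1" "?d t = 0"
      using IVT2'[of ?d 1 0 0, OF _ _ _ cont] d0 by auto
    then show False using nz by auto
  qed
  then show thesis using that[OF H'(1)[of 1 z]] by simp
qed

lemma planar_isotopy_equivariant:
  assumes D: "diagram D1" "diagram D2" and iso: "planar_isotopy D1 D2"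
  shows "equivalent_colorings X ut ot D1 D2"
proof -
  obtain H where n: "ncomp D1 = ncomp D2" "classical D1 = classical D2"
    and H: "ambient_isotopy H" "\<And>p. p \<in> points D1 \<Longrightarrow> pos D2 p = H 1 (pos D1 p)"
    using iso unfolding planar_isotopy_def by blast
  have pts: "points D1 = points D2" using n by (simp add: points_def)
  have vel: "velocity D2 p = L (velocity D1 p)"
    if p: "p \<in> points D1" and L: "(H 1 has_derivative L) (at (pos D1 p))" for p L
  proof (rule velocity_eqI[OF D(2)])
    have "((\<lambda>t. H 1 (pos D1 (rot p t))) has_vector_derivative L (velocity D1 p)) (at 0)"
      using vector_derivative_diff_chain_within[of "\<lambda>t. pos D1 (rot p t)" "velocity D1 p" 0 UNIV "H 1" L]
        point_has_velocity[OF D(1) p] L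
      by (simp add: o_def has_derivative_at_withinI)
    then show "((\<lambda>t. pos D2 (rot p t)) has_vector_derivative L (velocity D1 p)) (at 0)"
      using H(2) p by simp
  qed (use p pts in simp)
  have "sgn (cross2 (velocity D1 p) (velocity D1 q)) = sgn (cross2 (velocity D2 p) (velocity D2 q))"
    if "(p, q) \<in> classical D1" for p q
  proof -
    have pq: "p \<in> points D1" "q \<in> points D1" "pos D1 p = pos D1 q"
      using that D(1) unfolding diagram_def double_points_def by auto
    \<comment> \<open>Both preimages of the crossing have the same position, so the same derivative
      \<open>L\<close> transforms both velocities and multiplies \<open>cross2\<close> by its
      positive determinant.\<close>
    obtain L where L: "(H 1 has_derivative L) (at (pos D1 p))" "cross2 (L 1) (L \<i>) > 0"
      using ambient_isotopy_orientation[OF H(1)] by blast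
    have "linear L" using L(1) has_derivative_linear by blast
    then show ?thesis
      using vel[OF pq(1) L(1)] vel[OF pq(2) L(1)[unfolded pq(3)]] L(2)
      by (simp add: linear_cross2[of L "velocity D1 p"] sgn_mult)
  qed
  from colorings_eqI[OF n this] show ?thesis using equivariant_refl by metis
qed

text \<open>An increasing continuous map carries small right neighbourhoods of \<open>s\<close> onto
  right neighbourhoods of \<open>r s\<close>: the intermediate value theorem gives one direction,
  continuity at \<open>s\<close> the other.\<close>

lemma eventually_right_reparametrize:
  fixes r :: "real \<Rightarrow> real"
  assumes "strict_mono r" "continuous_on UNIV r"
  shows "(\<forall>\<^sub>F t in at_right 0. P (r (s + t))) \<longleftrightarrow> (\<forall>\<^sub>F u in at_right 0. P (r s + u))"
proof
  assume "\<forall>\<^sub>F t in at_right 0. P (r (s + t))"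
  then obtain b where b: "b > 0" "\<And>t. 0 < t \<Longrightarrow> t < b \<Longrightarrow> P (r (s + t))"
    unfolding eventually_at_right_field by blast
  have "P (r s + u)" if u: "0 < u" "u < r (s + b) - r s" for u
  proof -
    have "\<exists>x\<ge>s. x \<le> s + b \<and> r x = r s + u"
      by (rule IVT') (use u b(1) continuous_on_subset[OF assms(2) subset_UNIV] in \<open>simp_all\<close>)
    then obtain x where x: "s \<le> x" "x \<le> s + b" "r x = r s + u" by blast
    have "x \<noteq> s" "x \<noteq> s + b" using x(3) u by auto
    then show ?thesis using b(2)[of "x - s"] x by simp
  qed
  moreover have "r (s + b) - r s > 0" using strict_monoD[OF assms(1), of s "s + b"] b(1) by simp
  ultimately show "\<forall>\<^sub>F u in at_right 0. P (r s + u)"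
    unfolding eventually_at_right_field by blast
next
  assume "\<forall>\<^sub>F u in at_right 0. P (r s + u)"
  then obtain b where b: "b > 0" "\<And>u. 0 < u \<Longrightarrow> u < b \<Longrightarrow> P (r s + u)"
    unfolding eventually_at_right_field by blast
  have "isCont r s" using assms(2) by (simp add: continuous_on_eq_continuous_at)
  then have "\<exists>d>0. \<forall>x. \<bar>x - s\<bar> < d \<longrightarrow> \<bar>r x - r s\<bar> < b"
    using b(1) by (simp add: continuous_at_real_range)
  then obtain d where d: "d > 0" "\<And>x. \<bar>x - s\<bar> < d \<Longrightarrow> \<bar>r x - r s\<bar> < b" by blast
  have "P (r (s + t))" if t: "0 < t" "t < d" for t
  proof -
    have "r s < r (s + t)" using strict_monoD[OF assms(1), of s "s + t"] t by simp
    moreover have "\<bar>r (s + t) - r s\<bar> < b" using d(2)[of "s + t"] t by simp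
    ultimately show ?thesis using b(2)[of "r (s + t) - r s"] by simp
  qed
  then show "\<forall>\<^sub>F t in at_right 0. P (r (s + t))"
    using d(1) unfolding eventually_at_right_field by blast
qed

lemma eventually_left_reparametrize:
  fixes r :: "real \<Rightarrow> real"
  assumes "strict_mono r" "continuous_on UNIV r"
  shows "(\<forall>\<^sub>F t in at_right 0. P (r (s - t))) \<longleftrightarrow> (\<forall>\<^sub>F u in at_right 0. P (r s - u))"
proof -
  \<comment> \<open>Conjugation with negation exchanges left and right neighbourhoods.\<close>
  have "strict_mono (\<lambda>x. - r (- x))" using assms(1) by (simp add: strict_mono_def)
  moreover have "continuous_on UNIV (\<lambda>x. - r (- x))"
    by (intro continuous_intros continuous_on_compose2[OF assms(2)]) auto
  ultimately show ?thesis
    using eventually_right_reparametrize[of "\<lambda>x. - r (- x)" "\<lambda>x. P (- x)" "- s"] by simp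
qed

section \<open>Diagrams that differ by a reparametrization\<close>

locale reparametrized =
  fixes D1 D2 :: vdiagram and \<pi> :: "nat \<Rightarrow> nat" and r :: "nat \<Rightarrow> real \<Rightarrow> real"
  assumes D: "diagram D1" "diagram D2" and n: "ncomp D1 = ncomp D2"
    and bij: "bij_betw \<pi> {..<ncomp D2} {..<ncomp D1}"
    and r: "\<And>i. i < ncomp D2 \<Longrightarrow> r i C1_differentiable_on UNIV"
      "\<And>i t. i < ncomp D2 \<Longrightarrow> deriv (r i) t > 0"
      "\<And>i t. i < ncomp D2 \<Longrightarrow> r i (t + 2 * pi) = r i t + 2 * pi"
    and curve: "\<And>i t. i < ncomp D2 \<Longrightarrow> curve D2 i (cis t) = curve D1 (\<pi> i) (cis (r i t))"
    and cl: "\<And>i j s t. i < ncomp D2 \<Longrightarrow> j < ncomp D2 \<Longrightarrow>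
           ((i, cis s), (j, cis t)) \<in> classical D2 \<longleftrightarrow>
           ((\<pi> i, cis (r i s)), (\<pi> j, cis (r j t))) \<in> classical D1"
begin

lemma r_deriv: "i < ncomp D2 \<Longrightarrow> (r i has_real_derivative deriv (r i) t) (at t)"
  using r(1)[of i] unfolding C1_differentiable_on_eq
  by (simp add: DERIV_deriv_iff_real_differentiable)

lemma r_mono: "i < ncomp D2 \<Longrightarrow> strict_mono (r i)"
  using DERIV_pos_imp_increasing[of _ _ "r i"] r_deriv r(2) by (meson strict_monoI)

lemma r_cont: "i < ncomp D2 \<Longrightarrow> continuous_on UNIV (r i)"
  using r(1) C1_differentiable_imp_continuous_on by blast

lemma r_shift:
  assumes "i < ncomp D2"
  shows "r i (t + of_int k * (2 * pi)) = r i t + of_int k * (2 * pi)"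
proof (induction k rule: int_induct[where k = 0])
  case (step1 k)
  then show ?case using r(3)[OF assms, of "t + of_int k * (2 * pi)"] by (simp add: algebra_simps)
next
  case (step2 k)
  then show ?case using r(3)[OF assms, of "t + of_int (k - 1) * (2 * pi)"] by (simp add: algebra_simps)
qed simp

lemma cis_eq_iff: "cis s = cis t \<longleftrightarrow> (\<exists>k::int. s = t + of_int k * (2 * pi))"
proof
  assume "cis s = cis t"
  then have "cis (s - t) = 1" by (simp add: cis_divide[symmetric])
  then have "cos (s - t) = 1" by (metis cis.sel(1) one_complex.sel(1))
  then obtain k :: int where "s - t = k * (2 * pi)" unfolding cos_one_2pi_int by auto
  then show "\<exists>k::int. s = t + of_int k * (2 * pi)" by (intro exI[of _ k]) simp
next
  assume "\<exists>k::int. s = t + of_int k * (2 * pi)"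
  then obtain k :: int where "s = t + of_int k * (2 * pi)" by blast
  then show "cis s = cis t" by (simp add: cis_mult[symmetric] mult.commute[of _ "2 * pi"] cis_multiple_2pi)
qed

text \<open>Equivariance under full turns makes \<open>r i\<close> descend to the circle; strict
  monotonicity makes the induced circle map injective.\<close>

lemma cis_r_eq_iff:
  assumes "i < ncomp D2"
  shows "cis (r i s) = cis (r i t) \<longleftrightarrow> cis s = cis t"
  unfolding cis_eq_iff r_shift[OF assms, symmetric]
  using strict_mono_eq[OF r_mono[OF assms]] by simp

text \<open>The induced map from the circles of \<open>D2\<close> to those of \<open>D1\<close>.
  \<open>Arg\<close> merely selects an angle; by \<open>\<rho>_cis\<close> every angle gives the
  same result.\<close>

definition \<rho> :: "pt \<Rightarrow> pt" where
  "\<rho> p = (\<pi> (fst p), cis (r (fst p) (Arg (snd p))))"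

lemma \<rho>_cis: "i < ncomp D2 \<Longrightarrow> \<rho> (i, cis t) = (\<pi> i, cis (r i t))"
  by (simp add: \<rho>_def cis_r_eq_iff cis_Arg sgn_eq)

lemma point_cases:
  assumes "p \<in> points D2"
  obtains i t where "p = (i, cis t)" "i < ncomp D2"
proof -
  obtain i z where p: "p = (i, z)" by (cases p)
  have "i < ncomp D2" "norm z = 1" using assms by (auto simp: p points_def)
  moreover from this have "cis (Arg z) = z" by (subst cis_Arg) (auto simp: sgn_eq)
  ultimately show thesis using that[of i "Arg z"] p by simp
qed

lemma \<rho>_inj:
  assumes "p \<in> points D2" "q \<in> points D2" "\<rho> p = \<rho> q"
  shows "p = q"
proof -
  obtain i t where p: "p = (i, cis t)" "i < ncomp D2" using point_cases[OF assms(1)] .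
  obtain j u where q: "q = (j, cis u)" "j < ncomp D2" using point_cases[OF assms(2)] .
  have eq: "\<pi> i = \<pi> j" "cis (r i t) = cis (r j u)"
    using assms(3) p q by (simp_all add: \<rho>_cis)
  have "i = j" using inj_onD[OF bij_betw_imp_inj_on[OF bij] eq(1)] p q by simp
  then show ?thesis using eq(2) p q by (simp add: cis_r_eq_iff)
qed

lemma \<rho>_points: "p \<in> points D2 \<Longrightarrow> \<rho> p \<in> points D1"
  using bij by (auto simp: \<rho>_def points_def bij_betw_def)

lemma r_surj:
  assumes i: "i < ncomp D2"
  shows "\<exists>s. r i s = u"
proof -
  \<comment> \<open>Going \<open>k\<close> turns forwards or backwards shifts \<open>r i 0\<close>
    by \<open>k\<close> full turns, so these values enclose \<open>u\<close> for large
    \<open>k\<close>.\<close>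
  obtain k :: nat where k: "of_nat k * (2 * pi) \<ge> \<bar>u - r i 0\<bar>"
    using reals_Archimedean3[of "2 * pi"] by (meson less_imp_le pi_gt_zero mult_pos_pos zero_less_numeral)
  have "r i (0 + of_int (- int k) * (2 * pi)) \<le> u" "u \<le> r i (0 + of_int (int k) * (2 * pi))"
    unfolding r_shift[OF i] using k by auto
  then show ?thesis
    using IVT'[of "r i" "0 + of_int (- int k) * (2 * pi)" u "0 + of_int (int k) * (2 * pi)"]
      continuous_on_subset[OF r_cont[OF i]] by auto
qed

lemma \<rho>_surj:
  assumes "q \<in> points D1"
  shows "\<exists>p\<in>points D2. \<rho> p = q"
proof -
  obtain j z where q: "q = (j, z)" by (cases q)
  have j: "j < ncomp D1" and z: "norm z = 1" using assms by (auto simp: q points_def)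
  have "j \<in> \<pi> ` {..<ncomp D2}" using bij_betw_imp_surj_on[OF bij] j by simp
  then obtain i where i: "i < ncomp D2" "\<pi> i = j" by blast
  obtain s where s: "r i s = Arg z" using r_surj[OF i(1)] by blast
  have "cis (Arg z) = z" using z by (subst cis_Arg) (auto simp: sgn_eq)
  then show ?thesis using i s by (intro bexI[of _ "(i, cis s)"]) (auto simp: \<rho>_cis q points_def)
qed

lemma \<rho>_classical:
  "p \<in> points D2 \<Longrightarrow> q \<in> points D2 \<Longrightarrow> (p, q) \<in> classical D2 \<longleftrightarrow> (\<rho> p, \<rho> q) \<in> classical D1"
  by (elim point_cases) (simp add: \<rho>_cis cl)

lemma \<rho>_Field: "p \<in> points D2 \<Longrightarrow> p \<in> Field (classical D2) \<longleftrightarrow> \<rho> p \<in> Field (classical D1)"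
  using Field_classical(2)[OF D(1)] Field_classical(2)[OF D(2)] \<rho>_surj \<rho>_classical
  unfolding Field_def Domain.simps Range.simps subset_iff Un_iff by metis

lemma \<rho>_regular: "p \<in> points D2 \<Longrightarrow> p \<in> regular D2 \<longleftrightarrow> \<rho> p \<in> regular D1"
  using \<rho>_Field \<rho>_points by (auto simp: regular_def)

text \<open>The factor is the derivative of \<open>r i\<close>; being positive, it leaves the signs
  of crossings unchanged.\<close>

lemma velocity_\<rho>:
  assumes "p \<in> points D2"
  shows "\<exists>c>0. velocity D2 p = c *\<^sub>R velocity D1 (\<rho> p)"
proof -
  obtain i t where p: "p = (i, cis t)" and i: "i < ncomp D2" using point_cases[OF assms] .
  have pi: "\<pi> i < ncomp D1" using bij i by (auto simp: bij_betw_def)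
  have "((\<lambda>t. curve D1 (\<pi> i) (cis (r i t))) has_vector_derivative
      deriv (r i) t *\<^sub>R velocity D1 (\<pi> i, cis (r i t))) (at t)"
    using vector_diff_chain_at[of "r i" "deriv (r i) t" t] r_deriv[OF i] curve_has_velocity[OF D(1) pi, of "r i t"]
    by (auto simp: o_def has_real_derivative_iff_has_vector_derivative)
  then have "velocity D2 (i, cis t) = deriv (r i) t *\<^sub>R velocity D1 (\<pi> i, cis (r i t))"
    using vector_derivative_unique_at[OF curve_has_velocity[OF D(2) i, of t]] curve[OF i] by simp
  then show ?thesis using r(2)[OF i, of t] by (auto simp: p \<rho>_cis[OF i])
qed

lemma val_\<rho>:
  assumes p: "p \<in> points D2" and FG: "\<And>p. p \<in> regular D2 \<Longrightarrow> G p = F (\<rho> p)"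
  shows "val_before G p v \<longleftrightarrow> val_before F (\<rho> p) v" "val_after G p v \<longleftrightarrow> val_after F (\<rho> p) v"
proof -
  obtain i t where pt: "p = (i, cis t)" and i: "i < ncomp D2" using point_cases[OF p] .
  obtain d where d: "d > 0" "\<And>t. 0 < \<bar>t\<bar> \<Longrightarrow> \<bar>t\<bar> < d \<Longrightarrow> rot p t \<in> regular D2"
    using regular_nearby[OF D(2) p] by blast
  have ev: "\<forall>\<^sub>F u in at_right 0. rot p u \<in> regular D2 \<and> rot p (- u) \<in> regular D2"
    unfolding eventually_at_right_field
    by (rule exI[of _ d]) (use d in auto)
  have *: "\<rho> (rot p u) = (\<pi> i, cis (r i (t + u)))" for u
    using \<rho>_cis[OF i, of "t + u"] by (simp add: rot_def pt cis_mult)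
  have "val_before G p v \<longleftrightarrow> (\<forall>\<^sub>F u in at_right 0. F (\<rho> (rot p (- u))) = v)"
    unfolding val_before_def by (rule eventually_cong[OF ev]) (simp add: FG)
  also have "\<dots> \<longleftrightarrow> val_before F (\<rho> p) v"
    using eventually_left_reparametrize[OF r_mono[OF i] r_cont[OF i], of "\<lambda>x. F (\<pi> i, cis x) = v" t]
    by (simp add: * val_before_def pt \<rho>_cis[OF i] rot_def cis_mult)
  finally show "val_before G p v \<longleftrightarrow> val_before F (\<rho> p) v" .
  have "val_after G p v \<longleftrightarrow> (\<forall>\<^sub>F u in at_right 0. F (\<rho> (rot p u)) = v)"
    unfolding val_after_def by (rule eventually_cong[OF ev]) (simp add: FG)
  also have "\<dots> \<longleftrightarrow> val_after F (\<rho> p) v"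
    using eventually_right_reparametrize[OF r_mono[OF i] r_cont[OF i], of "\<lambda>x. F (\<pi> i, cis x) = v" t]
    by (simp add: * val_after_def pt \<rho>_cis[OF i] rot_def cis_mult)
  finally show "val_after G p v \<longleftrightarrow> val_after F (\<rho> p) v" .
qed

lemma cross2_\<rho>:
  assumes "p \<in> points D2" "q \<in> points D2"
  shows "cross2 (velocity D2 p) (velocity D2 q) > 0 \<longleftrightarrow> cross2 (velocity D1 (\<rho> p)) (velocity D1 (\<rho> q)) > 0"
proof -
  obtain a b where ab: "a > 0" "velocity D2 p = a *\<^sub>R velocity D1 (\<rho> p)"
      "b > 0" "velocity D2 q = b *\<^sub>R velocity D1 (\<rho> q)"
    using velocity_\<rho>[OF assms(1)] velocity_\<rho>[OF assms(2)] by blast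
  have "cross2 (velocity D2 p) (velocity D2 q) = (a * b) * cross2 (velocity D1 (\<rho> p)) (velocity D1 (\<rho> q))"
    unfolding ab by (simp add: cross2_def algebra_simps)
  then show ?thesis using ab by (auto simp: zero_less_mult_iff mult_less_0_iff)
qed

lemma point_colorings_\<rho>:
  assumes F: "F \<in> regular D1 \<rightarrow>\<^sub>E X" and G: "G \<in> regular D2 \<rightarrow>\<^sub>E X"
    and FG: "\<And>p. p \<in> regular D2 \<Longrightarrow> G p = F (\<rho> p)"
  shows "F \<in> point_colorings X ut ot D1 \<longleftrightarrow> G \<in> point_colorings X ut ot D2"
proof -
  have reg: "p \<in> points D2" if "p \<in> regular D2" for p using that by (simp add: regular_def)
  have reg1: "\<exists>p\<in>regular D2. \<rho> p = q" if "q \<in> regular D1" for q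
    using \<rho>_surj[of q] that \<rho>_regular by (auto simp: regular_def)
  have fld: "p \<in> points D" "q \<in> points D" if "(p, q) \<in> classical D" "diagram D" for p q D
    using Field_classical(2)[OF that(2)] that(1) by (auto simp: Field_def)
  have V: "val_before G p v \<longleftrightarrow> val_before F (\<rho> p) v" "val_after G p v \<longleftrightarrow> val_after F (\<rho> p) v"
    if "p \<in> points D2" for p v
    by (rule val_\<rho>[where F = F], fact that, fact FG)+
  show ?thesis
  proof
    assume P: "F \<in> point_colorings X ut ot D1"
    show "G \<in> point_colorings X ut ot D2"
    proof (rule point_coloringsI[OF G])
      fix p assume p: "p \<in> regular D2"
      then have "\<rho> p \<in> regular D1" using \<rho>_regular reg by blast
      then show "val_before G p (G p)" "val_after G p (G p)"
        using point_coloringsD(2,3)[OF P] FG[OF p] V[OF reg[OF p]] by auto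
    next
      fix p q assume pq: "(p, q) \<in> classical D2"
      note pq' = fld[OF pq D(2)]
      have "(\<rho> p, \<rho> q) \<in> classical D1" using pq pq' \<rho>_classical by blast
      note ex = point_colorings_crossing[OF P this]
      show "crossing_colored ut ot D2 G p q"
      unfolding crossing_colored_def
        unfolding V[OF pq'(1)] V[OF pq'(2)] cross2_\<rho>[OF pq'] by (rule ex) blast
    qed
  next
    assume P: "G \<in> point_colorings X ut ot D2"
    show "F \<in> point_colorings X ut ot D1"
    proof (rule point_coloringsI[OF F])
      fix q assume "q \<in> regular D1"
      then obtain p where p: "p \<in> regular D2" "q = \<rho> p" using reg1 by blast
      then show "val_before F q (F q)" "val_after F q (F q)"
        using point_coloringsD(2,3)[OF P p(1)] FG[OF p(1)] V[OF reg[OF p(1)]] by auto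
    next
      fix p' q' assume pq: "(p', q') \<in> classical D1"
      obtain p q where *: "p' = \<rho> p" "q' = \<rho> q" and pq': "p \<in> points D2" "q \<in> points D2"
        using \<rho>_surj fld[OF pq D(1)] by metis
      have "(p, q) \<in> classical D2" using pq pq' \<rho>_classical * by blast
      note ex = point_colorings_crossing[OF P this]
      show "crossing_colored ut ot D1 F p' q'"
      unfolding crossing_colored_def
        unfolding * cross2_\<rho>[OF pq', symmetric] V[OF pq'(1), symmetric] V[OF pq'(2), symmetric] by (rule ex) blast
    qed
  qed
qed

lemma reparametrized_equivariant:
  "equivalent_point_colorings X ut ot D1 D2"
proof (rule equivariant_relI[where R = "\<lambda>F G. \<forall>p\<in>regular D2. G p = F (\<rho> p)"])
  have reg: "\<rho> p \<in> regular D1" if "p \<in> regular D2" for p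
    using that \<rho>_regular[of p] by (auto simp: regular_def)
  have reg1: "\<exists>p\<in>regular D2. \<rho> p = q" if "q \<in> regular D1" for q
    using \<rho>_surj[of q] that \<rho>_regular by (auto simp: regular_def)
  show "\<exists>G\<in>point_colorings X ut ot D2. \<forall>p\<in>regular D2. G p = F (\<rho> p)"
    if F: "F \<in> point_colorings X ut ot D1" for F
  proof (rule bexI)
    let ?G = "\<lambda>p\<in>regular D2. F (\<rho> p)"
    show "\<forall>p\<in>regular D2. ?G p = F (\<rho> p)" by simp
    have "?G \<in> regular D2 \<rightarrow>\<^sub>E X" using point_coloringsD(1)[OF F] reg by auto
    then show "?G \<in> point_colorings X ut ot D2"
      using point_colorings_\<rho>[OF point_coloringsD(1)[OF F], of ?G] F by simp
  qed
  show "\<exists>F\<in>point_colorings X ut ot D1. \<forall>p\<in>regular D2. G p = F (\<rho> p)"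
    if G: "G \<in> point_colorings X ut ot D2" for G
  proof (rule bexI)
    let ?F = "\<lambda>q\<in>regular D1. G (the_inv_into (regular D2) \<rho> q)"
    have inj: "inj_on \<rho> (regular D2)" using \<rho>_inj by (auto simp: inj_on_def regular_def)
    show *: "\<forall>p\<in>regular D2. G p = ?F (\<rho> p)"
      using reg by (simp add: the_inv_into_f_f[OF inj])
    have "?F q \<in> X" if "q \<in> regular D1" for q
      using reg1[OF that] * point_coloringsD(1)[OF G] by (metis PiE_mem)
    then have "?F \<in> regular D1 \<rightarrow>\<^sub>E X" by auto
    then show "?F \<in> point_colorings X ut ot D1"
      using point_colorings_\<rho>[OF _ point_coloringsD(1)[OF G], of ?F] G * by simp
  qed
  show "G = G'" if "G \<in> point_colorings X ut ot D2" "G' \<in> point_colorings X ut ot D2"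
    "\<forall>p\<in>regular D2. G p = F (\<rho> p)" "\<forall>p\<in>regular D2. G' p = F (\<rho> p)" for F G G'
    by (rule PiE_ext[OF point_coloringsD(1)[OF that(1)] point_coloringsD(1)[OF that(2)]]) (use that in simp)
  show "F = F'" if "F \<in> point_colorings X ut ot D1" "F' \<in> point_colorings X ut ot D1"
    "\<forall>p\<in>regular D2. G p = F (\<rho> p)" "\<forall>p\<in>regular D2. G p = F' (\<rho> p)" for F F' G
    by (rule PiE_ext[OF point_coloringsD(1)[OF that(1)] point_coloringsD(1)[OF that(2)]])
      (use that reg1 in metis)
  show "\<forall>p\<in>regular D2. compose (regular D2) \<alpha> G p = compose (regular D1) \<alpha> F (\<rho> p)"
    if "\<forall>p\<in>regular D2. G p = F (\<rho> p)" for \<alpha> F G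
    using that reg by (simp add: compose_def)
qed (use point_colorings_compose D in blast)+

end

lemma reparametrization_equivariant:
  assumes "diagram D1" "diagram D2" "reparametrization D1 D2"
  shows "equivalent_colorings X ut ot D1 D2"
proof -
  obtain \<pi> r where "ncomp D1 = ncomp D2"
     "bij_betw \<pi> {..<ncomp D2} {..<ncomp D1}"
     "\<forall>i<ncomp D2. r i C1_differentiable_on UNIV \<and> (\<forall>t. deriv (r i) t > 0) \<and>
           (\<forall>t. r i (t + 2 * pi) = r i t + 2 * pi)"
     "\<forall>i<ncomp D2. \<forall>t. curve D2 i (cis t) = curve D1 (\<pi> i) (cis (r i t))"
     "\<forall>i<ncomp D2. \<forall>j<ncomp D2. \<forall>s t.
           ((i, cis s), (j, cis t)) \<in> classical D2 \<longleftrightarrow>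
           ((\<pi> i, cis (r i s)), (\<pi> j, cis (r j t))) \<in> classical D1"
    using assms(3) unfolding reparametrization_def by blast
  then interpret reparametrized D1 D2 \<pi> r
    using assms(1,2) by unfold_locales auto
  show ?thesis by (rule equivalent_colorings_of_points[OF assms(1,2) reparametrized_equivariant])
qed

section \<open>Gluing along the box of a move\<close>

definition strand_pt :: "(nat \<Rightarrow> nat) \<Rightarrow> (nat \<Rightarrow> complex) \<Rightarrow> (nat \<Rightarrow> real) \<Rightarrow> nat \<times> real \<Rightarrow> pt" where
  "strand_pt c z \<epsilon> = (\<lambda>(j, x). (c j, z j * cis (\<epsilon> j * x)))"

definition strand_dom :: "nat \<Rightarrow> (nat \<times> real) set" where
  "strand_dom m = {..<m} \<times> {-1..1}"

text \<open>The set \<open>K\<close> of \<open>local_move\<close> in strand coordinates, over-strand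
  first. Its image under \<open>strand_pt\<close> consists of the classical crossings in the
  box.\<close>

definition crossings ::
  "nat \<Rightarrow> (nat \<Rightarrow> real \<Rightarrow> complex) \<Rightarrow> (nat \<times> real \<Rightarrow> nat \<times> real \<Rightarrow> bool) \<Rightarrow> ((nat \<times> real) \<times> (nat \<times> real)) set" where
  "crossings m M ov = {((j, x), (k, y)) | j x k y.
     (j, x) \<in> strand_dom m \<and> (k, y) \<in> strand_dom m \<and> M j x = M k y \<and> ov (j, x) (k, y)}"

definition lim_left :: "(nat \<times> real \<Rightarrow> 'a) \<Rightarrow> nat \<times> real \<Rightarrow> 'a \<Rightarrow> bool" where
  "lim_left g p v \<longleftrightarrow> (\<forall>\<^sub>F t in at_right 0. g (fst p, snd p - t) = v)"

definition lim_right :: "(nat \<times> real \<Rightarrow> 'a) \<Rightarrow> nat \<times> real \<Rightarrow> 'a \<Rightarrow> bool" where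
  "lim_right g p v \<longleftrightarrow> (\<forall>\<^sub>F t in at_right 0. g (fst p, snd p + t) = v)"

lemma lim_left_unique: "lim_left g p v \<Longrightarrow> lim_left g p w \<Longrightarrow> v = w"
  unfolding lim_left_def by (erule (1) eventually_eq_unique) simp

lemma lim_right_unique: "lim_right g p v \<Longrightarrow> lim_right g p w \<Longrightarrow> v = w"
  unfolding lim_right_def by (erule (1) eventually_eq_unique) simp

text \<open>The arguments \<open>p1\<close>, \<open>p2\<close> are the labels to the left and right
  of \<open>p\<close> along the strand parameter. A negative \<epsilon> exchanges incoming and
  outgoing labels and reverses the velocity, which is \<open>dM\<close> divided by \<epsilon>; hence
  the sign is that of the product with both \<epsilon>.\<close>

definition strand_crossing_condition where
  "strand_crossing_condition ut ot \<epsilon> dM p q p1 p2 q1 q2 \<longleftrightarrow>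
     crossing ut ot (\<epsilon> (fst p) * \<epsilon> (fst q) * cross2 (dM (fst p) (snd p)) (dM (fst q) (snd q)) > (0::real))
       (if \<epsilon> (fst p) > 0 then p1 else p2) (if \<epsilon> (fst p) > 0 then p2 else p1)
       (if \<epsilon> (fst q) > 0 then q1 else q2) (if \<epsilon> (fst q) > 0 then q2 else q1)"

definition strand_crossing_colored where
  "strand_crossing_colored ut ot \<epsilon> dM g p q \<longleftrightarrow> (\<exists>p1 p2 q1 q2.
     lim_left g p p1 \<and> lim_right g p p2 \<and> lim_left g q q1 \<and> lim_right g q q2 \<and>
     strand_crossing_condition ut ot \<epsilon> dM p q p1 p2 q1 q2)"

text \<open>At the ends -1 and 1 only the limit from inside the strand is prescribed; the outer one
  belongs to the rest of the diagram. Values at crossing points and outside the strands are left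
  open.\<close>

definition strand_colorings ::
  "'a set \<Rightarrow> ('a \<Rightarrow> 'a \<Rightarrow> 'a) \<Rightarrow> ('a \<Rightarrow> 'a \<Rightarrow> 'a) \<Rightarrow> nat \<Rightarrow> (nat \<Rightarrow> real) \<Rightarrow> (nat \<Rightarrow> real \<Rightarrow> complex) \<Rightarrow>
   ((nat \<times> real) \<times> (nat \<times> real)) set \<Rightarrow> (nat \<times> real \<Rightarrow> 'a) set" where
  "strand_colorings X ut ot m \<epsilon> dM R =
     {g. (\<forall>p\<in>strand_dom m - Field R. g p \<in> X \<and> (snd p > -1 \<longrightarrow> lim_left g p (g p)) \<and>
            (snd p < 1 \<longrightarrow> lim_right g p (g p))) \<and>
         (\<forall>(p, q)\<in>R. strand_crossing_colored ut ot \<epsilon> dM g p q)}"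

lemma strand_coloringsI:
  assumes "\<And>p. p \<in> strand_dom m \<Longrightarrow> p \<notin> Field R \<Longrightarrow> g p \<in> X"
    and "\<And>p. p \<in> strand_dom m \<Longrightarrow> p \<notin> Field R \<Longrightarrow> snd p > -1 \<Longrightarrow> lim_left g p (g p)"
    and "\<And>p. p \<in> strand_dom m \<Longrightarrow> p \<notin> Field R \<Longrightarrow> snd p < 1 \<Longrightarrow> lim_right g p (g p)"
    and "\<And>p q. (p, q) \<in> R \<Longrightarrow> strand_crossing_colored ut ot \<epsilon> dM g p q"
  shows "g \<in> strand_colorings X ut ot m \<epsilon> dM R"
  using assms unfolding strand_colorings_def by auto

lemma strand_coloringsD:
  assumes "g \<in> strand_colorings X ut ot m \<epsilon> dM R" "p \<in> strand_dom m" "p \<notin> Field R"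
  shows "g p \<in> X" "snd p > -1 \<Longrightarrow> lim_left g p (g p)" "snd p < 1 \<Longrightarrow> lim_right g p (g p)"
  using assms unfolding strand_colorings_def mem_Collect_eq by simp_all

lemma strand_colorings_crossing:
  assumes "g \<in> strand_colorings X ut ot m \<epsilon> dM R" "(p, q) \<in> R"
  obtains p1 p2 q1 q2 where "lim_left g p p1" "lim_right g p p2" "lim_left g q q1" "lim_right g q q2"
    "strand_crossing_condition ut ot \<epsilon> dM p q p1 p2 q1 q2"
  using assms unfolding strand_colorings_def strand_crossing_colored_def by blast

text \<open>The interface between the algebra in the box and the gluing: existence and uniqueness of
  labels with prescribed ends. Uniqueness is claimed off \<open>Field R2\<close> only, as strand
  colorings are unconstrained at crossing points.\<close>

definition ends_extend ::
  "nat \<Rightarrow> (nat \<times> real \<Rightarrow> 'a) set \<Rightarrow> (nat \<times> real \<Rightarrow> 'a) set \<Rightarrow> ((nat \<times> real) \<times> (nat \<times> real)) set \<Rightarrow> bool" where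
  "ends_extend m G1 G2 R2 \<longleftrightarrow>
     (\<forall>g\<in>G1. \<exists>g'\<in>G2. \<forall>j<m. g' (j, -1) = g (j, -1) \<and> g' (j, 1) = g (j, 1)) \<and>
     (\<forall>g\<in>G2. \<forall>g'\<in>G2. (\<forall>j<m. g' (j, -1) = g (j, -1) \<and> g' (j, 1) = g (j, 1)) \<longrightarrow>
        (\<forall>p\<in>strand_dom m - Field R2. g' p = g p))"

lemma eventually_at_right_scale:
  assumes "a > 0"
  shows "(\<forall>\<^sub>F t in at_right 0. P (t / a)) \<longleftrightarrow> (\<forall>\<^sub>F t in at_right (0::real). P t)"
  using filtermap_times_pos_at_right[of "inverse a" 0] assms
  by (simp add: filter_eq_iff eventually_filtermap divide_inverse mult.commute)

lemma cis_eq_close: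
  assumes "cis a = cis b" "\<bar>a - b\<bar> < 2 * pi"
  shows "a = b"
  \<comment> \<open>The fact used looks only at the point set of a diagram, so any diagram with one
    component will do.\<close>
  using rot_eq_self[of "(0, 1)" "\<lparr>ncomp = 1, curve = undefined, classical = {}\<rparr>" "a - b"] assms
  by (simp add: points_def rot_def cis_divide[symmetric])

section \<open>Strands as arcs of the circles\<close>

locale strands =
  fixes m n :: nat and c :: "nat \<Rightarrow> nat" and z :: "nat \<Rightarrow> complex" and \<epsilon> :: "nat \<Rightarrow> real"
  assumes inj: "inj_on (strand_pt c z \<epsilon>) (strand_dom m)"
    and img: "strand_pt c z \<epsilon> ` strand_dom m \<subseteq> {..<n} \<times> sphere 0 1"
begin

abbreviation "e \<equiv> strand_pt c z \<epsilon>"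
abbreviation "T \<equiv> e ` strand_dom m"

lemma e_eq: "e (j, x) = (c j, z j * cis (\<epsilon> j * x))"
  by (simp add: strand_pt_def)

lemma z_norm: "j < m \<Longrightarrow> norm (z j) = 1" and c_less: "j < m \<Longrightarrow> c j < n"
proof -
  assume "j < m"
  then have "(j, 0) \<in> strand_dom m" by (simp add: strand_dom_def)
  then have "e (j, 0) \<in> {..<n} \<times> sphere 0 1" using img by blast
  then show "norm (z j) = 1" "c j < n" by (simp_all add: e_eq)
qed

lemma eps_nz: assumes "j < m" shows "\<epsilon> j \<noteq> 0"
proof
  assume "\<epsilon> j = 0"
  then have "e (j, 0) = e (j, 1)" by (simp add: e_eq)
  then show False using inj_onD[OF inj, of "(j, 0)" "(j, 1)"] assms by (simp add: strand_dom_def)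
qed

text \<open>If the arc covered a full turn, its parameters \<open>pi / \<epsilon> j\<close> and
  \<open>- pi / \<epsilon> j\<close> would give the same point, the antipode of \<open>z j\<close>,
  against injectivity.\<close>

lemma eps_less_pi: assumes "j < m" shows "\<bar>\<epsilon> j\<bar> < pi"
proof (rule ccontr)
  assume "\<not> \<bar>\<epsilon> j\<bar> < pi"
  then have le: "pi \<le> \<bar>\<epsilon> j\<bar>" by simp
  let ?x = "pi / \<epsilon> j"
  have x: "\<bar>?x\<bar> \<le> 1" using le eps_nz[OF assms] by (simp add: abs_divide divide_le_eq)
  have "e (j, ?x) = e (j, - ?x)"
    using eps_nz[OF assms] by (simp add: e_eq cis_cnj[symmetric] cis_pi)
  moreover have "(j, ?x) \<in> strand_dom m" "(j, - ?x) \<in> strand_dom m"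
    using x assms unfolding strand_dom_def abs_le_iff by auto
  ultimately have "?x = - ?x" using inj_onD[OF inj] by blast
  then have "?x = 0" by linarith
  then show False using eps_nz[OF assms] pi_gt_zero by auto
qed

lemma rot_e: "j < m \<Longrightarrow> rot (e (j, x)) t = e (j, x + t / \<epsilon> j)"
  using eps_nz by (simp add: rot_def e_eq cis_mult mult.assoc distrib_left)

lemma val_before_e:
  assumes "j < m"
  shows "val_before F (e (j, x)) v \<longleftrightarrow>
    (if \<epsilon> j > 0 then lim_left (F \<circ> e) (j, x) v else lim_right (F \<circ> e) (j, x) v)"
proof (cases "\<epsilon> j > 0")
  case True
  have "val_before F (e (j, x)) v \<longleftrightarrow> (\<forall>\<^sub>F t in at_right 0. F (e (j, x - t / \<epsilon> j)) = v)"
    by (simp add: val_before_def rot_e[OF assms])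
  also have "\<dots> \<longleftrightarrow> lim_left (F \<circ> e) (j, x) v"
    using eventually_at_right_scale[OF True, of "\<lambda>t. F (e (j, x - t)) = v"] by (simp add: lim_left_def)
  finally show ?thesis using True by simp
next
  case False
  then have neg: "- \<epsilon> j > 0" using eps_nz[OF assms] by simp
  have "val_before F (e (j, x)) v \<longleftrightarrow> (\<forall>\<^sub>F t in at_right 0. F (e (j, x + t / (- \<epsilon> j))) = v)"
    by (simp add: val_before_def rot_e[OF assms])
  also have "\<dots> \<longleftrightarrow> lim_right (F \<circ> e) (j, x) v"
    using eventually_at_right_scale[OF neg, of "\<lambda>t. F (e (j, x + t)) = v"] by (simp add: lim_right_def)
  finally show ?thesis using False by simp
qed

lemma val_after_e:
  assumes "j < m"
  shows "val_after F (e (j, x)) v \<longleftrightarrow>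
    (if \<epsilon> j > 0 then lim_right (F \<circ> e) (j, x) v else lim_left (F \<circ> e) (j, x) v)"
proof (cases "\<epsilon> j > 0")
  case True
  have "val_after F (e (j, x)) v \<longleftrightarrow> (\<forall>\<^sub>F t in at_right 0. F (e (j, x + t / \<epsilon> j)) = v)"
    by (simp add: val_after_def rot_e[OF assms])
  also have "\<dots> \<longleftrightarrow> lim_right (F \<circ> e) (j, x) v"
    using eventually_at_right_scale[OF True, of "\<lambda>t. F (e (j, x + t)) = v"] by (simp add: lim_right_def)
  finally show ?thesis using True by simp
next
  case False
  then have neg: "- \<epsilon> j > 0" using eps_nz[OF assms] by simp
  have "val_after F (e (j, x)) v \<longleftrightarrow> (\<forall>\<^sub>F t in at_right 0. F (e (j, x - t / (- \<epsilon> j))) = v)"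
    by (simp add: val_after_def rot_e[OF assms])
  also have "\<dots> \<longleftrightarrow> lim_left (F \<circ> e) (j, x) v"
    using eventually_at_right_scale[OF neg, of "\<lambda>t. F (e (j, x - t)) = v"] by (simp add: lim_left_def)
  finally show ?thesis using False by simp
qed

lemma closed_segments:
  assumes "closed B"
  shows "closed ((\<lambda>x. e (j, x)) ` ({-1..1} \<inter> B))"
proof (rule compact_imp_closed, rule compact_continuous_image)
  show "continuous_on ({-1..1} \<inter> B) (\<lambda>x. e (j, x))"
    unfolding e_eq by (intro continuous_intros)
  show "compact ({-1..1::real} \<inter> B)" using assms by (simp add: compact_Int_closed)
qed

lemma off_T_nearby:
  assumes "p \<notin> T"
  shows "\<exists>d>0. \<forall>t. \<bar>t\<bar> < d \<longrightarrow> rot p t \<notin> T"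
proof -
  have "T = (\<Union>j<m. (\<lambda>x. e (j, x)) ` ({-1..1} \<inter> UNIV))"
    by (auto simp: strand_dom_def)
  then have "closed T" using closed_segments[of UNIV] by auto
  moreover have "continuous_on UNIV (rot p)"
    unfolding rot_def by (intro continuous_intros)
  ultimately have "closed (rot p -` T)" by (rule closed_vimage)
  then have "open (- (rot p -` T))" by (rule open_Compl)
  then have "open {t. rot p t \<notin> T}" by (simp add: Compl_eq vimage_def)
  moreover have "0 \<in> {t. rot p t \<notin> T}" using assms by simp
  ultimately obtain d where "d > 0" "ball 0 d \<subseteq> {t. rot p t \<notin> T}" by (meson openE)
  then show ?thesis by (intro exI[of _ d]) (auto simp: subset_iff)
qed

text \<open>The end itself lies in \<open>T\<close>, so closedness of \<open>T\<close> does not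
  suffice. Removing from strand \<open>j\<close> the parameters near this end (beyond 1/2 in
  direction \<sigma>) leaves a closed set that misses the end, hence also nearby points. The removed
  part is not met either: its parameter differs from \<open>\<sigma> * (1 + t)\<close> by at most 1,
  which is less than a full turn of angle.\<close>

lemma off_T_beyond_end:
  assumes j: "j < m" and \<sigma>: "\<sigma> = 1 \<or> \<sigma> = -1"
  shows "\<forall>\<^sub>F t in at_right 0. e (j, \<sigma> * (1 + t)) \<notin> T"
proof -
  let ?B = "{x. \<sigma> * x \<le> 1/2}"
  let ?T = "(\<Union>k\<in>{..<m} - {j}. (\<lambda>x. e (k, x)) ` ({-1..1} \<inter> UNIV)) \<union> (\<lambda>x. e (j, x)) ` ({-1..1} \<inter> ?B)"
  have B: "closed ?B" by (intro closed_Collect_le continuous_intros)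
  have "closed ?T" using closed_segments[of UNIV] closed_segments[OF B] by (intro closed_Un closed_UN) auto
  moreover have "continuous_on UNIV (\<lambda>t. e (j, \<sigma> * (1 + t)))"
    unfolding e_eq by (intro continuous_intros)
  ultimately have "closed ((\<lambda>t. e (j, \<sigma> * (1 + t))) -` ?T)"
    by (rule closed_vimage)
  then have op: "open (- ((\<lambda>t. e (j, \<sigma> * (1 + t))) -` ?T))" by blast
  have "e (j, \<sigma>) \<notin> ?T"
  proof
    assume "e (j, \<sigma>) \<in> ?T"
    then have "\<exists>k x. e (j, \<sigma>) = e (k, x) \<and> k < m \<and> x \<in> {-1..1} \<and> (k = j \<longrightarrow> \<sigma> * x \<le> 1/2)"
      using j by blast
    then obtain k x where kx: "e (j, \<sigma>) = e (k, x)" "k < m" "x \<in> {-1..1}" "k = j \<longrightarrow> \<sigma> * x \<le> 1/2"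
      by blast
    then have "(j, \<sigma>) = (k, x)"
      using inj_onD[OF inj, of "(j, \<sigma>)" "(k, x)"] j \<sigma> by (auto simp: strand_dom_def)
    then show False using kx(4) \<sigma> by auto
  qed
  then have "0 \<in> - ((\<lambda>t. e (j, \<sigma> * (1 + t))) -` ?T)" by simp
  with op obtain d where d: "d > 0" "ball 0 d \<subseteq> - ((\<lambda>t. e (j, \<sigma> * (1 + t))) -` ?T)" by (meson openE)
  have "e (j, \<sigma> * (1 + t)) \<notin> T" if t: "0 < t" "t < min d (1/2)" for t
  proof
    assume "e (j, \<sigma> * (1 + t)) \<in> T"
    then obtain k x where kx: "e (j, \<sigma> * (1 + t)) = e (k, x)" "k < m" "x \<in> {-1..1}"
      by (auto simp: strand_dom_def)
    have "t \<in> ball 0 d" using t by simp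
    then have "e (j, \<sigma> * (1 + t)) \<notin> ?T" using d(2) by blast
    then have nT: "e (k, x) \<notin> ?T" using kx(1) by simp
    then have "k = j" using kx(2,3) by blast
    moreover have "\<sigma> * x > 1/2"
    proof (rule ccontr)
      assume "\<not> \<sigma> * x > 1/2"
      then have "x \<in> ?B" by simp
      then show False using nT kx(3) \<open>k = j\<close> by blast
    qed
    ultimately have k: "k = j" "\<sigma> * x > 1/2" .
    have "z j \<noteq> 0" using z_norm[OF j] by auto
    then have "cis (\<epsilon> j * (\<sigma> * (1 + t))) = cis (\<epsilon> j * x)" using kx(1) k(1) by (simp add: e_eq)
    moreover have "\<bar>\<sigma> * (1 + t) - x\<bar> \<le> 1" using \<sigma> k(2) kx(3) t by auto
    then have "\<bar>\<epsilon> j\<bar> * \<bar>\<sigma> * (1 + t) - x\<bar> \<le> \<bar>\<epsilon> j\<bar> * 1" by (intro mult_left_mono) auto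
    then have "\<bar>\<epsilon> j * (\<sigma> * (1 + t)) - \<epsilon> j * x\<bar> < 2 * pi"
      using eps_less_pi[OF j] by (simp add: abs_mult right_diff_distrib[symmetric])
    ultimately have "\<epsilon> j * (\<sigma> * (1 + t)) = \<epsilon> j * x" by (rule cis_eq_close)
    then have "\<sigma> * (1 + t) = x" using eps_nz[OF j] by simp
    then show False using \<sigma> kx(3) t by auto
  qed
  then show ?thesis
    unfolding eventually_at_right_field using d(1) by (intro exI[of _ "min d (1/2)"]) auto
qed

lemma val_cong_off_T:
  assumes "p \<notin> T" "\<forall>q. q \<notin> T \<longrightarrow> F q = G q"
  shows "val_before F p v \<longleftrightarrow> val_before G p v" "val_after F p v \<longleftrightarrow> val_after G p v"
proof -
  obtain d where d: "d > 0" "\<And>t. \<bar>t\<bar> < d \<Longrightarrow> rot p t \<notin> T" using off_T_nearby[OF assms(1)] by blast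
  have ev: "\<forall>\<^sub>F t in at_right 0. F (rot p t) = G (rot p t) \<and> F (rot p (- t)) = G (rot p (- t))"
  proof -
    have "F (rot p t) = G (rot p t)" if "\<bar>t\<bar> < d" for t using assms(2) d(2)[OF that] by blast
    then show ?thesis
      unfolding eventually_at_right_field using d(1) by (intro exI[of _ d]) auto
  qed
  show "val_before F p v \<longleftrightarrow> val_before G p v"
    unfolding val_before_def by (rule eventually_cong[OF ev]) simp
  show "val_after F p v \<longleftrightarrow> val_after G p v"
    unfolding val_after_def by (rule eventually_cong[OF ev]) simp
qed

text \<open>The outer limits at the ends see only points off \<open>T\<close>. Through them the rest
  of the diagram dictates the labels at the ends of the strands.\<close>

lemma lim_end_cong:
  assumes "j < m" "\<forall>q. q \<notin> T \<longrightarrow> F q = G q"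
  shows "lim_left (F \<circ> e) (j, -1) v \<longleftrightarrow> lim_left (G \<circ> e) (j, -1) v"
    "lim_right (F \<circ> e) (j, 1) v \<longleftrightarrow> lim_right (G \<circ> e) (j, 1) v"
proof -
  have "\<forall>\<^sub>F t in at_right 0. F (e (j, -1 - t)) = G (e (j, -1 - t))"
    using off_T_beyond_end[OF assms(1), of "-1"] by (rule eventually_mono) (auto simp: assms(2))
  then show "lim_left (F \<circ> e) (j, -1) v \<longleftrightarrow> lim_left (G \<circ> e) (j, -1) v"
    unfolding lim_left_def by (rule eventually_cong) simp
  have "\<forall>\<^sub>F t in at_right 0. F (e (j, 1 + t)) = G (e (j, 1 + t))"
    using off_T_beyond_end[OF assms(1), of 1] by (rule eventually_mono) (auto simp: assms(2))
  then show "lim_right (F \<circ> e) (j, 1) v \<longleftrightarrow> lim_right (G \<circ> e) (j, 1) v"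
    unfolding lim_right_def by (rule eventually_cong) simp
qed

end

section \<open>A diagram with a given picture in the box\<close>

locale picture = strands +
  fixes D :: vdiagram and M dM :: "nat \<Rightarrow> real \<Rightarrow> complex"
    and ov :: "nat \<times> real \<Rightarrow> nat \<times> real \<Rightarrow> bool" and C :: "(pt \<times> pt) set"
  assumes D: "diagram D" and n: "n = ncomp D"
    and pos_e: "\<And>j x. (j, x) \<in> strand_dom m \<Longrightarrow> pos D (e (j, x)) = M j x"
    and classical_D: "classical D = C \<union> map_prod e e ` crossings m M ov"
    and C_off: "C \<subseteq> (- T) \<times> (- T)"
    and deriv_M: "\<And>j x. j < m \<Longrightarrow> \<bar>x\<bar> < 1 \<Longrightarrow> (M j has_vector_derivative dM j x) (at x)"
    and interior: "Field (crossings m M ov) \<subseteq> {..<m} \<times> {-1<..<1}"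
begin

abbreviation "R \<equiv> crossings m M ov"

lemma e_points: "p \<in> strand_dom m \<Longrightarrow> e p \<in> points D"
  using img n by (auto simp: points_def)

lemma Field_sub: "Field R \<subseteq> strand_dom m"
  using interior by (auto simp: strand_dom_def)

lemma e_in_Field: "p \<in> strand_dom m \<Longrightarrow> e p \<in> Field (classical D) \<longleftrightarrow> p \<in> Field R"
proof -
  assume p: "p \<in> strand_dom m"
  have F: "Field (classical D) = Field C \<union> e ` Field R"
    unfolding classical_D Field_def by (auto simp: image_iff) force+
  have "e p \<notin> Field C" using C_off p unfolding Field_def by auto
  moreover have "e p \<in> e ` Field R \<longleftrightarrow> p \<in> Field R"
    using inj_on_image_mem_iff[OF inj p Field_sub] .
  ultimately show ?thesis unfolding F by blast
qed

lemma e_regular: "p \<in> strand_dom m \<Longrightarrow> e p \<in> regular D \<longleftrightarrow> p \<notin> Field R"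
  using e_in_Field e_points by (auto simp: regular_def)

lemma off_T_Field: "p \<notin> T \<Longrightarrow> p \<in> Field (classical D) \<longleftrightarrow> p \<in> Field C"
  using Field_sub unfolding classical_D Field_def by (auto simp: image_iff)

lemma finite_Field_R: "finite (Field R)"
proof -
  have "e ` Field R \<subseteq> Field (classical D)" using e_in_Field Field_sub by blast
  then have "finite (e ` Field R)"
    using Field_classical(1)[OF D] finite_subset by blast
  then show ?thesis using finite_imageD inj_on_subset[OF inj Field_sub] by blast
qed

lemma velocity_e:
  assumes "j < m" "\<bar>x\<bar> < 1"
  shows "velocity D (e (j, x)) = (1 / \<epsilon> j) *\<^sub>R dM j x"
proof (rule velocity_eqI[OF D])
  show "e (j, x) \<in> points D" using e_points[of "(j, x)"] assms by (simp add: strand_dom_def abs_less_iff)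
  \<comment> \<open>\<open>pos D\<close> is known to be given by \<open>M j\<close> only while the
    parameter stays inside the strand, so derivatives are compared on this open set.\<close>
  let ?S = "{t. \<bar>x + t / \<epsilon> j\<bar> < 1}"
  have "((\<lambda>t. x + t / \<epsilon> j) has_vector_derivative 1 / \<epsilon> j) (at 0)"
    unfolding has_real_derivative_iff_has_vector_derivative[symmetric]
    using eps_nz[OF assms(1)] by (auto intro!: derivative_eq_intros)
  then have "((\<lambda>t. M j (x + t / \<epsilon> j)) has_vector_derivative (1 / \<epsilon> j) *\<^sub>R dM j x) (at 0)"
    using vector_diff_chain_at[of "\<lambda>t. x + t / \<epsilon> j" "1 / \<epsilon> j" 0 "M j" "dM j x"] deriv_M[OF assms]
    by (simp add: o_def)
  then show "((\<lambda>t. pos D (rot (e (j, x)) t)) has_vector_derivative (1 / \<epsilon> j) *\<^sub>R dM j x) (at 0)"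
  proof (rule has_vector_derivative_transform_within_open[where S = ?S])
    show "open ?S" by (intro open_Collect_less continuous_intros) (use eps_nz[OF assms(1)] in auto)
    show "0 \<in> ?S" using assms by simp
    show "M j (x + t / \<epsilon> j) = pos D (rot (e (j, x)) t)" if "t \<in> ?S" for t
    proof -
      have "(j, x + t / \<epsilon> j) \<in> strand_dom m" using that assms by (auto simp: strand_dom_def abs_less_iff)
      then show ?thesis using pos_e rot_e[OF assms(1)] by simp
    qed
  qed
qed

lemma cross2_e:
  assumes "j < m" "\<bar>x\<bar> < 1" "k < m" "\<bar>y\<bar> < 1"
  shows "cross2 (velocity D (e (j, x))) (velocity D (e (k, y))) > 0 \<longleftrightarrow>
    \<epsilon> j * \<epsilon> k * cross2 (dM j x) (dM k y) > 0"
proof -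
  have "cross2 (velocity D (e (j, x))) (velocity D (e (k, y))) =
      (\<epsilon> j * \<epsilon> k * cross2 (dM j x) (dM k y)) / (\<epsilon> j * \<epsilon> k)\<^sup>2"
    using eps_nz[OF assms(1)] eps_nz[OF assms(3)]
    by (simp add: velocity_e assms cross2_def field_simps power2_eq_square)
  moreover have "(\<epsilon> j * \<epsilon> k)\<^sup>2 > 0" using eps_nz assms(1,3) by simp
  ultimately show ?thesis by (simp add: zero_less_divide_iff)
qed

lemma R_interior:
  assumes "((j, x), (k, y)) \<in> R"
  shows "j < m" "\<bar>x\<bar> < 1" "k < m" "\<bar>y\<bar> < 1"
proof -
  have "(j, x) \<in> Field R" "(k, y) \<in> Field R" using assms by (auto simp: Field_def)
  then have "(j, x) \<in> {..<m} \<times> {-1<..<1}" "(k, y) \<in> {..<m} \<times> {-1<..<1}" using interior by blast+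
  then show "j < m" "\<bar>x\<bar> < 1" "k < m" "\<bar>y\<bar> < 1" by auto
qed

text \<open>Both limits exist even at the ends -1 and 1: \<open>e\<close> continues along the circle
  beyond the strand, and \<open>F\<close> colors the whole diagram.\<close>

lemma lims_of_point_coloring:
  assumes F: "F \<in> point_colorings X ut ot D" and p: "p \<in> strand_dom m" "p \<notin> Field R"
  shows "lim_left (F \<circ> e) p (F (e p))" "lim_right (F \<circ> e) p (F (e p))"
proof -
  obtain j x where jx: "p = (j, x)" by (cases p)
  have "j < m" using p(1) by (simp add: jx strand_dom_def)
  moreover have "e p \<in> regular D" using e_regular p by blast
  ultimately show "lim_left (F \<circ> e) p (F (e p))" "lim_right (F \<circ> e) p (F (e p))"
    using point_coloringsD(2,3)[OF F, of "e p"] unfolding jx val_before_e[OF \<open>j < m\<close>] val_after_e[OF \<open>j < m\<close>]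
    by (auto split: if_splits)
qed

lemma strand_coloring_of_point_coloring:
  assumes F: "F \<in> point_colorings X ut ot D"
  shows "F \<circ> e \<in> strand_colorings X ut ot m \<epsilon> dM R"
proof (rule strand_coloringsI)
  fix p assume p: "p \<in> strand_dom m" "p \<notin> Field R"
  show "(F \<circ> e) p \<in> X"
    using PiE_mem[OF point_coloringsD(1)[OF F]] e_regular[OF p(1)] p(2) by simp
  show "lim_left (F \<circ> e) p ((F \<circ> e) p)" "lim_right (F \<circ> e) p ((F \<circ> e) p)"
    using lims_of_point_coloring[OF F p] by simp_all
next
  fix p q assume pq: "(p, q) \<in> R"
  obtain j x k y where jk: "p = (j, x)" "q = (k, y)" by (cases p, cases q)
  note ri = R_interior[OF pq[unfolded jk]]
  have "map_prod e e (p, q) \<in> map_prod e e ` R" using pq by (rule imageI)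
  then have "(e p, e q) \<in> classical D" unfolding classical_D by simp
  then obtain p1 p2 q1 q2 where *: "val_before F (e p) p1" "val_after F (e p) p2" "val_before F (e q) q1"
      "val_after F (e q) q2" "crossing ut ot (cross2 (velocity D (e p)) (velocity D (e q)) > 0) p1 p2 q1 q2"
    using point_colorings_crossing[OF F] by blast
  show "strand_crossing_colored ut ot \<epsilon> dM (F \<circ> e) p q"
      unfolding strand_crossing_colored_def
    by (rule exI[of _ "if \<epsilon> j > 0 then p1 else p2"], rule exI[of _ "if \<epsilon> j > 0 then p2 else p1"],
        rule exI[of _ "if \<epsilon> k > 0 then q1 else q2"], rule exI[of _ "if \<epsilon> k > 0 then q2 else q1"])
      (use * in \<open>simp add: jk strand_crossing_condition_def cross2_e[OF ri] val_before_e val_after_e ri split: if_splits\<close>)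
qed

end

section \<open>Two diagrams that agree outside of the box\<close>

locale picture_pair =
  P1: picture m n c z \<epsilon> D1 M1 dM1 ov C + P2: picture m n c z \<epsilon> D2 M2 dM2 ov C
  for m n c z \<epsilon> D1 M1 dM1 ov C D2 M2 dM2 +
  assumes pos_off: "\<And>p. p \<in> points D1 - P1.T \<Longrightarrow> pos D1 p = pos D2 p"
begin

abbreviation "e \<equiv> P1.e"
abbreviation "T \<equiv> P1.T"

lemma flip: "picture_pair m n c z \<epsilon> D2 M2 dM2 ov C D1 M1 dM1"
proof unfold_locales
  have "points D1 = points D2" using P1.n P2.n by (simp add: points_def)
  then show "pos D2 p = pos D1 p" if "p \<in> points D2 - T" for p using pos_off[of p] that by simp
qed

lemma points_eq: "points D1 = points D2"
  using P1.n P2.n by (simp add: points_def)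

lemma regular_off: "p \<notin> T \<Longrightarrow> p \<in> regular D1 \<longleftrightarrow> p \<in> regular D2"
  using P1.off_T_Field P2.off_T_Field points_eq by (simp add: regular_def)

lemma velocity_off:
  assumes "p \<in> points D1" "p \<notin> T"
  shows "velocity D1 p = velocity D2 p"
proof (rule velocity_eqI[OF P1.D assms(1)])
  obtain d where d: "d > 0" "\<And>t. \<bar>t\<bar> < d \<Longrightarrow> rot p t \<notin> T" using P1.off_T_nearby[OF assms(2)] by blast
  have "p \<in> points D2" using assms points_eq by simp
  from point_has_velocity[OF P2.D this]
  show "((\<lambda>t. pos D1 (rot p t)) has_vector_derivative velocity D2 p) (at 0)"
  proof (rule has_vector_derivative_transform_within_open[where S = "{-d<..<d}"])
    show "pos D2 (rot p t) = pos D1 (rot p t)" if "t \<in> {-d<..<d}" for t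
      using pos_off[of "rot p t"] d(2)[of t] that assms(1) by auto
  qed (use d in auto)
qed

text \<open>An end is a regular point, so its label equals the outer limit there, and just beyond
  the end the two colorings agree.\<close>

lemma end_values:
  assumes F1: "F1 \<in> point_colorings X ut ot D1" and F2: "F2 \<in> point_colorings X ut ot D2"
    and off: "\<forall>q. q \<notin> T \<longrightarrow> F1 q = F2 q" and j: "j < m"
  shows "F1 (e (j, -1)) = F2 (e (j, -1))" "F1 (e (j, 1)) = F2 (e (j, 1))"
proof -
  have d: "(j, -1) \<in> strand_dom m" "(j, 1) \<in> strand_dom m" using j by (simp_all add: strand_dom_def)
  have f: "(j, -1) \<notin> Field P1.R" "(j, 1) \<notin> Field P1.R" "(j, -1) \<notin> Field P2.R" "(j, 1) \<notin> Field P2.R"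
    using P1.interior P2.interior by auto
  have "lim_left (F2 \<circ> e) (j, -1) (F1 (e (j, -1)))"
    using P1.lims_of_point_coloring(1)[OF F1 d(1) f(1)] unfolding P1.lim_end_cong(1)[OF j off] .
  then show "F1 (e (j, -1)) = F2 (e (j, -1))"
    by (rule lim_left_unique[OF _ P2.lims_of_point_coloring(1)[OF F2 d(1) f(3)]])
  have "lim_right (F2 \<circ> e) (j, 1) (F1 (e (j, 1)))"
    using P1.lims_of_point_coloring(2)[OF F1 d(2) f(2)] unfolding P1.lim_end_cong(2)[OF j off] .
  then show "F1 (e (j, 1)) = F2 (e (j, 1))"
    by (rule lim_right_unique[OF _ P2.lims_of_point_coloring(2)[OF F2 d(2) f(4)]])
qed

text \<open>The coloring is taken from \<open>g\<close> on the strands and from \<open>F1\<close>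
  elsewhere. All conditions are local and inherited from one of the two, except at the ends of the
  strands, where the inner limit comes from \<open>g\<close>, the outer one from \<open>F1\<close>,
  and \<open>ends\<close> makes them match.\<close>

lemma glue:
  assumes F1: "F1 \<in> point_colorings X ut ot D1" and g: "g \<in> strand_colorings X ut ot m \<epsilon> dM2 P2.R"
    and ends: "\<And>j. j < m \<Longrightarrow> g (j, -1) = F1 (e (j, -1))" "\<And>j. j < m \<Longrightarrow> g (j, 1) = F1 (e (j, 1))"
  shows "\<exists>F2\<in>point_colorings X ut ot D2. \<forall>q. q \<notin> T \<longrightarrow> F1 q = F2 q"
proof -
  let ?F = "\<lambda>p\<in>regular D2. if p \<in> T then g (the_inv_into (strand_dom m) e p) else F1 p"
  have off1: "F1 q = ?F q" if "q \<notin> T" for q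
    using regular_off[OF that] that point_coloringsD(1)[OF F1] by auto
  then have off: "\<forall>q. q \<notin> T \<longrightarrow> F1 q = ?F q" by blast
  have on: "?F (e p) = g p" if "p \<in> strand_dom m" "p \<notin> Field P2.R" for p
    using that P2.e_regular[OF that(1)] the_inv_into_f_f[OF P1.inj that(1)] by simp
  have near: "\<forall>\<^sub>F t in at_right 0. (?F \<circ> e) (j, x + \<sigma> * t) = g (j, x + \<sigma> * t)"
    if j: "j < m" and \<sigma>: "\<sigma> = 1 \<or> \<sigma> = -1" "\<sigma> * x < 1" and x: "x \<in> {-1..1}" for j x \<sigma>
  proof -
    have "\<forall>\<^sub>F t in at_right 0. \<forall>q\<in>Field P2.R. (j, x + \<sigma> * t) \<noteq> q"
      using P2.finite_Field_R
    proof (rule eventually_ball_finite, intro ballI)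
      fix q :: "nat \<times> real"
      show "\<forall>\<^sub>F t in at_right 0. (j, x + \<sigma> * t) \<noteq> q"
        unfolding eventually_at_right_field
        \<comment> \<open>The point \<open>q\<close> is reached only at time
          \<open>\<sigma> * (snd q - x)\<close>; if this is not positive, any bound works.\<close>
        by (rule exI[of _ "if \<sigma> * (snd q - x) > 0 then \<sigma> * (snd q - x) else 1"]) (use \<sigma>(1) in auto)
    qed
    moreover have "\<forall>\<^sub>F t in at_right 0. x + \<sigma> * t \<in> {-1..1}"
      unfolding eventually_at_right_field using \<sigma> x by (intro exI[of _ "1 - \<sigma> * x"]) auto
    ultimately show ?thesis
    proof eventually_elim
      case (elim t)
      have "(j, x + \<sigma> * t) \<in> strand_dom m" using elim(2) j by (simp add: strand_dom_def)
      moreover have "(j, x + \<sigma> * t) \<notin> Field P2.R" using elim(1) by blast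
      ultimately show ?case using on by (simp only: o_apply)
    qed
  qed
  have lim: "lim_left (?F \<circ> e) (j, x) v \<longleftrightarrow> lim_left g (j, x) v" if "j < m" "x \<in> {-1<..1}" for j x v
  proof -
    have "\<forall>\<^sub>F t in at_right 0. (?F \<circ> e) (j, x + (-1) * t) = g (j, x + (-1) * t)"
      by (rule near) (use that in auto)
    then show ?thesis unfolding lim_left_def by (rule eventually_cong) simp
  qed
  have lim': "lim_right (?F \<circ> e) (j, x) v \<longleftrightarrow> lim_right g (j, x) v" if "j < m" "x \<in> {-1..<1}" for j x v
  proof -
    have "\<forall>\<^sub>F t in at_right 0. (?F \<circ> e) (j, x + 1 * t) = g (j, x + 1 * t)"
      by (rule near) (use that in auto)
    then show ?thesis unfolding lim_right_def by (rule eventually_cong) simp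
  qed
  have lims: "lim_left (?F \<circ> e) p (g p)" "lim_right (?F \<circ> e) p (g p)"
    if p: "p \<in> strand_dom m" "p \<notin> Field P2.R" for p
  proof -
    obtain j x where jx: "p = (j, x)" by (cases p)
    have j: "j < m" and x: "x \<in> {-1..1}" using p(1) by (simp_all add: jx strand_dom_def)
    have d: "(j, -1) \<in> strand_dom m" "(j, 1) \<in> strand_dom m" using j by (simp_all add: strand_dom_def)
    have f: "(j, -1) \<notin> Field P1.R" "(j, 1) \<notin> Field P1.R" using P1.interior by auto
    \<comment> \<open>At the end -1 this limit comes from outside of the box, that is from
      \<open>F1\<close>; at all other parameters it is read off from \<open>g\<close>.\<close>
    show "lim_left (?F \<circ> e) p (g p)"
    proof (cases "x = -1")
      case True
      show ?thesis unfolding jx True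
        using P1.lims_of_point_coloring(1)[OF F1 d(1) f(1)]
        unfolding P1.lim_end_cong(1)[OF j off] ends(1)[OF j] .
    next
      case False
      then show ?thesis using strand_coloringsD(2)[OF g p] lim[OF j, of x "g p"] x by (auto simp: jx)
    qed
    show "lim_right (?F \<circ> e) p (g p)"
    proof (cases "x = 1")
      case True
      show ?thesis unfolding jx True
        using P1.lims_of_point_coloring(2)[OF F1 d(2) f(2)]
        unfolding P1.lim_end_cong(2)[OF j off] ends(2)[OF j] .
    next
      case False
      then show ?thesis using strand_coloringsD(3)[OF g p] lim'[OF j, of x "g p"] x by (auto simp: jx)
    qed
  qed
  have "?F \<in> point_colorings X ut ot D2"
  proof (rule point_coloringsI)
    have "?F p \<in> X" if "p \<in> regular D2" for p
    proof (cases "p \<in> T")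
      case True
      then obtain q where q: "q \<in> strand_dom m" "p = e q" by blast
      then have "q \<notin> Field P2.R" using P2.e_regular that by blast
      then show ?thesis using on[OF q(1)] strand_coloringsD(1)[OF g q(1)] q(2) by simp
    next
      case False
      then have "p \<in> regular D1" using regular_off[OF False] that by simp
      then have "F1 p \<in> X" using point_coloringsD(1)[OF F1] by (rule PiE_mem[rotated])
      then show ?thesis using off1[OF False] by simp
    qed
    then show "?F \<in> regular D2 \<rightarrow>\<^sub>E X" by auto
  next
    fix p assume p: "p \<in> regular D2"
    have "val_before ?F p (?F p) \<and> val_after ?F p (?F p)"
    proof (cases "p \<in> T")
      case True
      then obtain j x where q: "(j, x) \<in> strand_dom m" "p = e (j, x)" by auto
      have j: "j < m" using q(1) by (simp add: strand_dom_def)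
      have nf: "(j, x) \<notin> Field P2.R" using P2.e_regular[OF q(1)] p q(2) by blast
      show ?thesis
        unfolding q(2) P1.val_before_e[OF j] P1.val_after_e[OF j] on[OF q(1) nf]
        using lims[OF q(1) nf] by simp
    next
      case False
      have "p \<in> regular D1" using regular_off[OF False] p by simp
      then show ?thesis
        using point_coloringsD(2,3)[OF F1, of p]
        unfolding P1.val_cong_off_T[OF False off] off1[OF False, symmetric] by simp
    qed
    then show "val_before ?F p (?F p)" "val_after ?F p (?F p)" by blast+
  next
    fix p q assume "(p, q) \<in> classical D2"
    then consider "(p, q) \<in> C" | "(p, q) \<in> map_prod e e ` P2.R" unfolding P2.classical_D by blast
    then show "crossing_colored ut ot D2 ?F p q"
    proof cases
      case 1
      then have pq: "(p, q) \<in> classical D1" unfolding P1.classical_D by blast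
      have off_pq: "p \<notin> T" "q \<notin> T" using 1 P1.C_off by auto
      have "p \<in> points D1" "q \<in> points D1"
        using Field_classical(2)[OF P1.D] pq by (auto simp: Field_def)
      then have v: "velocity D1 p = velocity D2 p" "velocity D1 q = velocity D2 q"
        using velocity_off off_pq by blast+
      obtain p1 p2 q1 q2 where "val_before F1 p p1" "val_after F1 p p2" "val_before F1 q q1" "val_after F1 q q2"
        "crossing ut ot (cross2 (velocity D1 p) (velocity D1 q) > 0) p1 p2 q1 q2"
        using point_colorings_crossing[OF F1 pq] .
      then show ?thesis
        unfolding crossing_colored_def v P1.val_cong_off_T[OF off_pq(1) off] P1.val_cong_off_T[OF off_pq(2) off]
        by blast
    next
      case 2
      then obtain j x k y where jk: "p = e (j, x)" "q = e (k, y)" "((j, x), (k, y)) \<in> P2.R" by auto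
      note ri = P2.R_interior[OF jk(3)]
      have xy: "x \<in> {-1<..1}" "x \<in> {-1..<1}" "y \<in> {-1<..1}" "y \<in> {-1..<1}" using ri by auto
      obtain p1 p2 q1 q2 where *: "lim_left g (j, x) p1" "lim_right g (j, x) p2" "lim_left g (k, y) q1"
          "lim_right g (k, y) q2" "strand_crossing_condition ut ot \<epsilon> dM2 (j, x) (k, y) p1 p2 q1 q2"
        using strand_colorings_crossing[OF g jk(3)] .
      have l: "lim_left (?F \<circ> e) (j, x) p1" "lim_right (?F \<circ> e) (j, x) p2" "lim_left (?F \<circ> e) (k, y) q1"
          "lim_right (?F \<circ> e) (k, y) q2"
        using * lim[OF ri(1) xy(1)] lim'[OF ri(1) xy(2)] lim[OF ri(3) xy(3)] lim'[OF ri(3) xy(4)] by blast+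
      have cr: "crossing ut ot (cross2 (velocity D2 p) (velocity D2 q) > 0)
        (if \<epsilon> j > 0 then p1 else p2) (if \<epsilon> j > 0 then p2 else p1)
        (if \<epsilon> k > 0 then q1 else q2) (if \<epsilon> k > 0 then q2 else q1)"
        using *(5) unfolding jk strand_crossing_condition_def P2.cross2_e[OF ri] by simp
      have vals: "val_before ?F p (if \<epsilon> j > 0 then p1 else p2)" "val_after ?F p (if \<epsilon> j > 0 then p2 else p1)"
        "val_before ?F q (if \<epsilon> k > 0 then q1 else q2)" "val_after ?F q (if \<epsilon> k > 0 then q2 else q1)"
        unfolding jk P1.val_before_e[OF ri(1)] P1.val_after_e[OF ri(1)] P1.val_before_e[OF ri(3)] P1.val_after_e[OF ri(3)]
        using l by simp_all
      show ?thesis unfolding crossing_colored_def using vals cr by blast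
    qed
  qed
  then show ?thesis using off by blast
qed

lemma extend_one_side:
  assumes ext: "ends_extend m (strand_colorings X ut ot m \<epsilon> dM1 P1.R) (strand_colorings X ut ot m \<epsilon> dM2 P2.R) P2.R"
    and F1: "F1 \<in> point_colorings X ut ot D1"
  shows "\<exists>F2\<in>point_colorings X ut ot D2. \<forall>q. q \<notin> T \<longrightarrow> F1 q = F2 q"
    and "F2 \<in> point_colorings X ut ot D2 \<Longrightarrow> F2' \<in> point_colorings X ut ot D2 \<Longrightarrow>
      (\<forall>q. q \<notin> T \<longrightarrow> F1 q = F2 q) \<Longrightarrow> (\<forall>q. q \<notin> T \<longrightarrow> F1 q = F2' q) \<Longrightarrow> F2 = F2'"
proof -
  obtain g where g: "g \<in> strand_colorings X ut ot m \<epsilon> dM2 P2.R"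
    "\<And>j. j < m \<Longrightarrow> g (j, -1) = (F1 \<circ> e) (j, -1)" "\<And>j. j < m \<Longrightarrow> g (j, 1) = (F1 \<circ> e) (j, 1)"
    using conjunct1[OF ext[unfolded ends_extend_def], rule_format, OF P1.strand_coloring_of_point_coloring[OF F1]]
    by blast
  show "\<exists>F2\<in>point_colorings X ut ot D2. \<forall>q. q \<notin> T \<longrightarrow> F1 q = F2 q"
    by (rule glue[OF F1 g(1)]) (simp_all add: g(2,3))
  assume F2: "F2 \<in> point_colorings X ut ot D2" "\<forall>q. q \<notin> T \<longrightarrow> F1 q = F2 q"
    and F2': "F2' \<in> point_colorings X ut ot D2" "\<forall>q. q \<notin> T \<longrightarrow> F1 q = F2' q"
  have "\<forall>j<m. (F2' \<circ> e) (j, -1) = (F2 \<circ> e) (j, -1) \<and> (F2' \<circ> e) (j, 1) = (F2 \<circ> e) (j, 1)"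
    using end_values[OF F1 F2(1)] end_values[OF F1 F2'(1)] F2(2) F2'(2) by simp
  then have on: "\<forall>p\<in>strand_dom m - Field P2.R. (F2' \<circ> e) p = (F2 \<circ> e) p"
    using ext P2.strand_coloring_of_point_coloring[OF F2(1)] P2.strand_coloring_of_point_coloring[OF F2'(1)]
    unfolding ends_extend_def by blast
  show "F2 = F2'"
  proof (rule PiE_ext[OF point_coloringsD(1)[OF F2(1)] point_coloringsD(1)[OF F2'(1)]])
    fix p assume p: "p \<in> regular D2"
    show "F2 p = F2' p"
    proof (cases "p \<in> T")
      case True
      then obtain q where q: "q \<in> strand_dom m" "p = e q" by blast
      then have "q \<notin> Field P2.R" using P2.e_regular p by blast
      then show ?thesis using on q by simp
    next
      case False
      then show ?thesis using F2(2)[rule_format, OF False] F2'(2)[rule_format, OF False] by simp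
    qed
  qed
qed

lemma picture_pair_equivariant:
  assumes ext: "ends_extend m (strand_colorings X ut ot m \<epsilon> dM1 P1.R) (strand_colorings X ut ot m \<epsilon> dM2 P2.R) P2.R"
    "ends_extend m (strand_colorings X ut ot m \<epsilon> dM2 P2.R) (strand_colorings X ut ot m \<epsilon> dM1 P1.R) P1.R"
  shows "equivalent_point_colorings X ut ot D1 D2"
proof (rule equivariant_relI[where R = "\<lambda>F G. \<forall>q. q \<notin> T \<longrightarrow> F q = G q"])
  interpret fl: picture_pair m n c z \<epsilon> D2 M2 dM2 ov C D1 M1 dM1 by (rule flip)
  show "\<exists>G\<in>point_colorings X ut ot D2. \<forall>q. q \<notin> T \<longrightarrow> F q = G q" if "F \<in> point_colorings X ut ot D1" for F
    by (rule extend_one_side(1)[OF ext(1) that])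
  show "\<exists>F\<in>point_colorings X ut ot D1. \<forall>q. q \<notin> T \<longrightarrow> F q = G q" if "G \<in> point_colorings X ut ot D2" for G
    using fl.extend_one_side(1)[OF ext(2) that] by metis
  show "G = G'" if "F \<in> point_colorings X ut ot D1" "G \<in> point_colorings X ut ot D2" "G' \<in> point_colorings X ut ot D2"
    "\<forall>q. q \<notin> T \<longrightarrow> F q = G q" "\<forall>q. q \<notin> T \<longrightarrow> F q = G' q" for F G G'
    by (rule extend_one_side(2)[OF ext(1) that])
  show "F = F'" if "F \<in> point_colorings X ut ot D1" "F' \<in> point_colorings X ut ot D1" "G \<in> point_colorings X ut ot D2"
    "\<forall>q. q \<notin> T \<longrightarrow> F q = G q" "\<forall>q. q \<notin> T \<longrightarrow> F' q = G q" for F F' G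
    by (rule fl.extend_one_side(2)[OF ext(2) that(3,1,2)]) (use that(4,5) in simp_all)
  show "\<forall>q. q \<notin> T \<longrightarrow> compose (regular D1) \<alpha> F q = compose (regular D2) \<alpha> G q"
    if "\<forall>q. q \<notin> T \<longrightarrow> F q = G q" for \<alpha> F G
    using that regular_off by (simp add: compose_def restrict_def)
qed (use point_colorings_compose P1.D P2.D in blast)+

end

lemma local_move_picture_pair:
  assumes D: "diagram D1" "diagram D2" and mv: "local_move m M1 M2 ov D1 D2"
    and deriv: "\<And>j x. j < m \<Longrightarrow> \<bar>x\<bar> < 1 \<Longrightarrow> (M1 j has_vector_derivative dM1 j x) (at x)"
      "\<And>j x. j < m \<Longrightarrow> \<bar>x\<bar> < 1 \<Longrightarrow> (M2 j has_vector_derivative dM2 j x) (at x)"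
    and interior: "Field (crossings m M1 ov) \<subseteq> {..<m} \<times> {-1<..<1}" "Field (crossings m M2 ov) \<subseteq> {..<m} \<times> {-1<..<1}"
  obtains c z \<epsilon> C where "picture_pair m (ncomp D1) c z \<epsilon> D1 M1 dM1 ov C D2 M2 dM2"
proof -
  have K: "{(e (j, x), e (k, y)) | j x k y. (j, x) \<in> strand_dom m \<and> (k, y) \<in> strand_dom m \<and>
      M j x = M k y \<and> ov (j, x) (k, y)} = map_prod e e ` crossings m M ov"
    for e :: "nat \<times> real \<Rightarrow> pt" and M :: "nat \<Rightarrow> real \<Rightarrow> complex"
    unfolding crossings_def by (auto simp: image_iff) blast
  show thesis
    using mv
    unfolding local_move_def Let_def strand_pt_def[symmetric] strand_dom_def[symmetric] K
  proof (elim conjE exE, goal_cases)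
    case (1 c z \<epsilon> C)
    show thesis
      by (rule that[of c z \<epsilon> C], unfold_locales) (use 1 D deriv interior in \<open>auto simp: points_def\<close>)
  qed
qed

text \<open>Nothing but \<open>\<epsilon> j \<noteq> 0\<close> is assumed about the direction in
  which a strand is traversed, so the local claim has to cover all orientations at once.\<close>

lemma local_move_equivariant:
  assumes D: "diagram D1" "diagram D2" and mv: "local_move m M1 M2 ov D1 D2"
    and deriv: "\<And>j x. j < m \<Longrightarrow> \<bar>x\<bar> < 1 \<Longrightarrow> (M1 j has_vector_derivative dM1 j x) (at x)"
      "\<And>j x. j < m \<Longrightarrow> \<bar>x\<bar> < 1 \<Longrightarrow> (M2 j has_vector_derivative dM2 j x) (at x)"
    and interior: "Field (crossings m M1 ov) \<subseteq> {..<m} \<times> {-1<..<1}" "Field (crossings m M2 ov) \<subseteq> {..<m} \<times> {-1<..<1}"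
    and ext: "\<And>\<epsilon>. (\<And>j. j < m \<Longrightarrow> \<epsilon> j \<noteq> 0) \<Longrightarrow>
      ends_extend m (strand_colorings X ut ot m \<epsilon> dM1 (crossings m M1 ov))
        (strand_colorings X ut ot m \<epsilon> dM2 (crossings m M2 ov)) (crossings m M2 ov) \<and>
      ends_extend m (strand_colorings X ut ot m \<epsilon> dM2 (crossings m M2 ov))
        (strand_colorings X ut ot m \<epsilon> dM1 (crossings m M1 ov)) (crossings m M1 ov)"
  shows "equivalent_colorings X ut ot D1 D2"
proof -
  obtain c z \<epsilon> C where "picture_pair m (ncomp D1) c z \<epsilon> D1 M1 dM1 ov C D2 M2 dM2"
    using local_move_picture_pair[OF D mv deriv interior] by blast
  then interpret picture_pair m "ncomp D1" c z \<epsilon> D1 M1 dM1 ov C D2 M2 dM2 .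
  show ?thesis
    using ext[of \<epsilon>, OF P1.eps_nz] equivalent_colorings_of_points[OF D picture_pair_equivariant] by blast
qed

text \<open>For the virtual and mixed moves. If the strands through the classical crossings in the
  box do not move, then the crossing points on the circles and the velocities there are unchanged;
  semi-arcs, being subsets of the circles, and colorings are equal.\<close>

lemma local_move_same_crossings:
  assumes D: "diagram D1" "diagram D2" and mv: "local_move m M1 M2 ov D1 D2"
    and same: "crossings m M1 ov = crossings m M2 ov"
    and interior: "Field (crossings m M1 ov) \<subseteq> {..<m} \<times> {-1<..<1}"
    and strands: "\<And>j. j \<in> fst ` Field (crossings m M1 ov) \<Longrightarrow> M1 j = M2 j"
    and deriv: "\<And>j x. j < m \<Longrightarrow> \<bar>x\<bar> < 1 \<Longrightarrow> (M1 j has_vector_derivative dM1 j x) (at x)"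
      "\<And>j x. j < m \<Longrightarrow> \<bar>x\<bar> < 1 \<Longrightarrow> (M2 j has_vector_derivative dM2 j x) (at x)"
  shows "equivalent_colorings X ut ot D1 D2"
proof -
  obtain c z \<epsilon> C where "picture_pair m (ncomp D1) c z \<epsilon> D1 M1 dM1 ov C D2 M2 dM2"
    using local_move_picture_pair[OF D mv deriv interior interior[unfolded same]] by blast
  then interpret picture_pair m "ncomp D1" c z \<epsilon> D1 M1 dM1 ov C D2 M2 dM2 .
  have vel: "velocity D1 p = velocity D2 p" if "p \<in> Field (classical D1)" for p
  proof (cases "p \<in> T")
    case False
    then show ?thesis using velocity_off Field_classical(2)[OF D(1)] that by blast
  next
    case True
    then obtain j x where q: "(j, x) \<in> strand_dom m" "p = e (j, x)" by auto
    then have f: "(j, x) \<in> Field (crossings m M1 ov)" using P1.e_in_Field that by blast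
    then have "(j, x) \<in> {..<m} \<times> {-1<..<1}" using interior by blast
    then have jx: "j < m" "\<bar>x\<bar> < 1" by auto
    have "M1 j = M2 j" using strands f by force
    then have "dM1 j x = dM2 j x"
      using vector_derivative_unique_at[OF deriv(1)[OF jx]] deriv(2)[OF jx] by simp
    then show ?thesis unfolding q(2) P1.velocity_e[OF jx] P2.velocity_e[OF jx] by simp
  qed
  have "sgn (cross2 (velocity D1 p) (velocity D1 q)) = sgn (cross2 (velocity D2 p) (velocity D2 q))"
    if "(p, q) \<in> classical D1" for p q
    using vel that by (simp add: Field_def Domain.intros Range.intros)
  from colorings_eqI[OF P2.n _ this] show ?thesis
    using equivariant_refl P1.classical_D P2.classical_D same by metis
qed

section \<open>The algebra of crossings\<close>

text \<open>The label of a strand after passing from the right to the left of another strand: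
  \<open>u\<close> and \<open>v\<close> are the labels on the right of the respective other strand,
  and \<open>b\<close> says that the strand of \<open>u\<close> is on top.\<close>

definition act :: "('a \<Rightarrow> 'a \<Rightarrow> 'a) \<Rightarrow> ('a \<Rightarrow> 'a \<Rightarrow> 'a) \<Rightarrow> bool \<Rightarrow> 'a \<Rightarrow> 'a \<Rightarrow> 'a" where
  "act ut ot b u v = (if b then ot u v else ut u v)"

lemma act_closed:
  assumes "biquandle X ut ot" "u \<in> X" "v \<in> X"
  shows "act ut ot b u v \<in> X"
  using assms unfolding biquandle_def act_def by auto

lemma act_bij:
  assumes "biquandle X ut ot" "v \<in> X"
  shows "bij_betw (\<lambda>u. act ut ot b u v) X X"
  using assms unfolding biquandle_def act_def by (cases b) auto

lemma act_pair_bij: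
  assumes "biquandle X ut ot"
  shows "bij_betw (\<lambda>(u, v). (act ut ot b u v, act ut ot (\<not> b) v u)) (X \<times> X) (X \<times> X)"
proof -
  have S: "bij_betw (\<lambda>(x, y). (ot y x, ut x y)) (X \<times> X) (X \<times> X)"
    using assms unfolding biquandle_def by blast
  have sw: "bij_betw prod.swap (X \<times> X) (X \<times> X)"
    by (rule bij_betw_byWitness[where f' = prod.swap]) auto
  show ?thesis
  proof (cases b)
    case True
    have "(\<lambda>(u, v). (act ut ot b u v, act ut ot (\<not> b) v u)) = (\<lambda>(x, y). (ot y x, ut x y)) \<circ> prod.swap"
      using True by (auto simp: act_def fun_eq_iff)
    then show ?thesis using bij_betw_trans[OF sw S] by simp
  next
    case False
    have "(\<lambda>(u, v). (act ut ot b u v, act ut ot (\<not> b) v u)) = prod.swap \<circ> (\<lambda>(x, y). (ot y x, ut x y))"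
      using False by (auto simp: act_def fun_eq_iff)
    then show ?thesis using bij_betw_trans[OF S sw] by simp
  qed
qed

text \<open>The premise excludes the two cyclic over-relations among the eight patterns. The other
  six are the three exchange laws, each also with its last two variables interchanged.\<close>

lemma act_exchange:
  assumes "biquandle X ut ot" "p \<in> X" "q \<in> X" "r \<in> X" "pq = qr \<longrightarrow> pr = pq"
  shows "act ut ot pr (act ut ot pq p q) (act ut ot (\<not> qr) r q) =
         act ut ot pq (act ut ot pr p r) (act ut ot qr q r)"
proof -
  have ax: "ut (ut x y) (ut z y) = ut (ut x z) (ot y z)"
        "ot (ut x y) (ut z y) = ut (ot x z) (ot y z)"
        "ot (ot x y) (ot z y) = ot (ot x z) (ut y z)" if "x \<in> X" "y \<in> X" "z \<in> X" for x y z
    using assms(1) that unfolding biquandle_def by blast+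
  show ?thesis
    using assms(5) ax[OF assms(2-4)] ax[OF assms(2,4,3)]
    by (cases pq; cases qr; cases pr) (simp_all add: act_def)
qed

text \<open>A crossing of two strands \<open>a\<close> and \<open>b\<close>, both parametrized from left to right, with \<open>a\<close> above \<open>b\<close> in the
  plane before the crossing. The strand \<open>a\<close> is the over-strand iff \<open>ab\<close> holds, and \<open>ea\<close>, \<open>eb\<close> say whether
  the orientations agree with the parametrizations. The suffixes \<open>R\<close> and \<open>L\<close> refer to the side of the
  respective other strand.\<close>

definition strand_crossing ::
  "('a \<Rightarrow> 'a \<Rightarrow> 'a) \<Rightarrow> ('a \<Rightarrow> 'a \<Rightarrow> 'a) \<Rightarrow> bool \<Rightarrow> bool \<Rightarrow> bool \<Rightarrow> 'a \<Rightarrow> 'a \<Rightarrow> 'a \<Rightarrow> 'a \<Rightarrow> bool" where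
  "strand_crossing ut ot ab ea eb a1 a2 b1 b2 \<longleftrightarrow>
     (let aR = (if eb then a2 else a1); aL = (if eb then a1 else a2);
          bR = (if ea then b1 else b2); bL = (if ea then b2 else b1)
      in aL = act ut ot ab aR bR \<and> bL = act ut ot (\<not> ab) bR aR)"

text \<open>Here \<open>s\<close> is the determinant of the derivatives of \<open>a\<close> and
  \<open>b\<close> in the direction of the parameters; it is positive because \<open>a\<close> comes
  from above and leaves below.\<close>

lemma crossing_upper_over:
  assumes "\<epsilon>a \<noteq> 0" "\<epsilon>b \<noteq> 0" "s > 0"
  shows "crossing ut ot (\<epsilon>a * \<epsilon>b * s > (0::real))
      (if \<epsilon>a > 0 then a1 else a2) (if \<epsilon>a > 0 then a2 else a1)
      (if \<epsilon>b > 0 then b1 else b2) (if \<epsilon>b > 0 then b2 else b1) \<longleftrightarrow>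
    strand_crossing ut ot True (\<epsilon>a > 0) (\<epsilon>b > 0) a1 a2 b1 b2"
  using assms
  by (cases "\<epsilon>a > 0"; cases "\<epsilon>b > 0")
    (auto simp: crossing_def strand_crossing_def act_def zero_less_mult_iff mult_less_0_iff not_less)

lemma crossing_lower_over:
  assumes "\<epsilon>a \<noteq> 0" "\<epsilon>b \<noteq> 0" "s < 0"
  shows "crossing ut ot (\<epsilon>b * \<epsilon>a * s > (0::real))
      (if \<epsilon>b > 0 then b1 else b2) (if \<epsilon>b > 0 then b2 else b1)
      (if \<epsilon>a > 0 then a1 else a2) (if \<epsilon>a > 0 then a2 else a1) \<longleftrightarrow>
    strand_crossing ut ot False (\<epsilon>a > 0) (\<epsilon>b > 0) a1 a2 b1 b2"
  using assms
  by (cases "\<epsilon>a > 0"; cases "\<epsilon>b > 0")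
    (auto simp: crossing_def strand_crossing_def act_def zero_less_mult_iff mult_less_0_iff not_less)

text \<open>The orientations decide which axiom applies. The two labels at the left ends are either
  both on right sides (direct computation), both on left sides (injectivity of the pair map), or one
  of each (injectivity of one operation in its first argument).\<close>

lemma strand_crossing_unique:
  assumes X: "biquandle X ut ot"
    and in_X: "a1 \<in> X" "b1 \<in> X" "a2 \<in> X" "b2 \<in> X" "a2' \<in> X" "b2' \<in> X"
    and c: "strand_crossing ut ot ab ea eb a1 a2 b1 b2" "strand_crossing ut ot ab ea eb a1 a2' b1 b2'"
  shows "a2 = a2'" "b2 = b2'"
proof -
  have inj: "u = u'" if "act ut ot b u v = act ut ot b u' v" "u \<in> X" "u' \<in> X" "v \<in> X" for b u u' v
    using inj_onD[OF bij_betw_imp_inj_on[OF act_bij[OF X that(4)]]] that by blast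
  have inj2: "u = u' \<and> v = v'"
    if "act ut ot b u v = act ut ot b u' v'" "act ut ot (\<not> b) v u = act ut ot (\<not> b) v' u'"
      "u \<in> X" "u' \<in> X" "v \<in> X" "v' \<in> X" for b u v u' v'
    using inj_onD[OF bij_betw_imp_inj_on[OF act_pair_bij[OF X, of b]], of "(u, v)" "(u', v')"] that by simp
  have "a2 = a2' \<and> b2 = b2'"
  proof (cases ea)
    case True
    show ?thesis
    proof (cases eb)
      case eb: True
      have "a2 = a2'"
        by (rule inj[of ab _ b1]) (use c True eb in_X in \<open>simp_all add: strand_crossing_def\<close>)
      then show ?thesis using c True eb by (simp add: strand_crossing_def)
    next
      case False
      then show ?thesis using c True by (simp add: strand_crossing_def)
    qed
  next
    case False
    show ?thesis
    proof (cases eb)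
      case True
      show ?thesis
        by (rule inj2[of ab]) (use c True False in_X in \<open>simp_all add: strand_crossing_def\<close>)
    next
      case eb: False
      have "b2 = b2'"
        by (rule inj[of "\<not> ab" _ a1]) (use c False eb in_X in \<open>simp_all add: strand_crossing_def\<close>)
      then show ?thesis using c False eb by (simp add: strand_crossing_def)
    qed
  qed
  then show "a2 = a2'" "b2 = b2'" by blast+
qed

text \<open>The same four orientation cases, now using surjectivity of the corresponding
  map.\<close>

lemma strand_crossing_exists:
  assumes X: "biquandle X ut ot" and in_X: "a1 \<in> X" "b1 \<in> X"
  shows "\<exists>a2\<in>X. \<exists>b2\<in>X. strand_crossing ut ot ab ea eb a1 a2 b1 b2"
proof -
  have surj: "\<exists>u\<in>X. act ut ot b u v = w" if "v \<in> X" "w \<in> X" for b v w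
  proof -
    have "w \<in> (\<lambda>u. act ut ot b u v) ` X"
      using bij_betw_imp_surj_on[OF act_bij[OF X that(1), of b]] that(2) by simp
    then show ?thesis by blast
  qed
  have surj2: "\<exists>u\<in>X. \<exists>v\<in>X. act ut ot b u v = w \<and> act ut ot (\<not> b) v u = x" if "w \<in> X" "x \<in> X" for b w x
  proof -
    have "(w, x) \<in> (\<lambda>(u, v). (act ut ot b u v, act ut ot (\<not> b) v u)) ` (X \<times> X)"
      using bij_betw_imp_surj_on[OF act_pair_bij[OF X, of b]] that by simp
    then show ?thesis by auto
  qed
  note cl = act_closed[OF X]
  show ?thesis
  proof (cases ea)
    case True
    show ?thesis
    proof (cases eb)
      case eb: True
      obtain u where "u \<in> X" "act ut ot ab u b1 = a1" using surj[OF in_X(2,1)] by blast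
      then show ?thesis using True eb cl in_X
        by (intro bexI[of _ u] bexI[of _ "act ut ot (\<not> ab) b1 u"]) (auto simp: strand_crossing_def)
    next
      case False
      then show ?thesis using True cl in_X
        by (intro bexI[of _ "act ut ot ab a1 b1"] bexI[of _ "act ut ot (\<not> ab) b1 a1"])
          (auto simp: strand_crossing_def)
    qed
  next
    case False
    show ?thesis
    proof (cases eb)
      case True
      obtain u v where "u \<in> X" "v \<in> X" "act ut ot ab u v = a1" "act ut ot (\<not> ab) v u = b1"
        using surj2[OF in_X] by blast
      then show ?thesis using True False
        by (intro bexI[of _ u] bexI[of _ v]) (auto simp: strand_crossing_def)
    next
      case eb: False
      obtain u where "u \<in> X" "act ut ot (\<not> ab) u a1 = b1" using surj[OF in_X(1,2)] by blast
      then show ?thesis using False eb cl in_X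
        by (intro bexI[of _ "act ut ot ab a1 u"] bexI[of _ u]) (auto simp: strand_crossing_def)
    qed
  qed
qed

section \<open>The cube of labels of three strands\<close>

text \<open>The label of a strand on the sides \<open>sv\<close>, \<open>sw\<close> (where \<open>True\<close> means right) of the other two strands, when
  \<open>u\<close>, \<open>v\<close>, \<open>w\<close> are the labels of the three strands on the right of both others; \<open>uv\<close> says that
  the first strand is over the second, etc.\<close>

definition cube_label ::
  "('a \<Rightarrow> 'a \<Rightarrow> 'a) \<Rightarrow> ('a \<Rightarrow> 'a \<Rightarrow> 'a) \<Rightarrow> bool \<Rightarrow> bool \<Rightarrow> bool \<Rightarrow> 'a \<Rightarrow> 'a \<Rightarrow> 'a \<Rightarrow> bool \<Rightarrow> bool \<Rightarrow> 'a" where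
  "cube_label ut ot uv uw vw u v w sv sw =
     (if sv then (if sw then u else act ut ot uw u w)
      else if sw then act ut ot uv u v
      else act ut ot uw (act ut ot uv u v) (act ut ot (\<not> vw) w v))"

definition three :: "'a \<Rightarrow> 'a \<Rightarrow> 'a \<Rightarrow> nat \<Rightarrow> 'a" where
  "three a b c i = (if i = 0 then a else if i = 1 then b else c)"

lemma three_simps [simp]: "three a b c 0 = a" "three a b c (Suc 0) = b" "three a b c 1 = b" "three a b c 2 = c"
  by (simp_all add: three_def)

text \<open>The three labels along a strand that starts on the sides \<open>sv\<close>, \<open>sw\<close> of the other strands and crosses the
  first of them first iff \<open>first\<close> holds.\<close>

definition cube_path ::
  "('a \<Rightarrow> 'a \<Rightarrow> 'a) \<Rightarrow> ('a \<Rightarrow> 'a \<Rightarrow> 'a) \<Rightarrow> bool \<Rightarrow> bool \<Rightarrow> bool \<Rightarrow> bool \<Rightarrow> bool \<Rightarrow> bool \<Rightarrow> 'a \<Rightarrow> 'a \<Rightarrow> 'a \<Rightarrow> nat \<Rightarrow> 'a" where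
  "cube_path ut ot first uv uw vw sv sw u v w =
     (let L = cube_label ut ot uv uw vw u v w
      in three (L sv sw) (if first then L (\<not> sv) sw else L sv (\<not> sw)) (L (\<not> sv) (\<not> sw)))"

lemma cube_path_closed:
  assumes "biquandle X ut ot" "u \<in> X" "v \<in> X" "w \<in> X"
  shows "cube_path ut ot b uv uw vw sv sw u v w i \<in> X"
  using assms by (simp add: cube_path_def cube_label_def three_def Let_def act_closed)

text \<open>The strands, from top to bottom at their left ends, are \<open>p\<close>, \<open>q\<close>, \<open>r\<close>, with labels numbered from left to
  right; in the standard pictures they are the strands 1, 2, 0.\<close>

definition triangle where
  "triangle ut ot before pq pr qr ep eq er p q r \<longleftrightarrow>
     (if before then
        strand_crossing ut ot pq ep eq (p 0) (p 1) (q 0) (q (1::nat)) \<and>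
        strand_crossing ut ot pr ep er (p 1) (p (2::nat)) (r 0) (r 1) \<and>
        strand_crossing ut ot qr eq er (q 1) (q 2) (r 1) (r (2::nat))
      else
        strand_crossing ut ot qr eq er (q 0) (q 1) (r 0) (r 1) \<and>
        strand_crossing ut ot pr ep er (p 0) (p 1) (r 1) (r 2) \<and>
        strand_crossing ut ot pq ep eq (p 1) (p 2) (q 1) (q 2))"

text \<open>A crossing that lies on the right of the third strand holds by definition of the labels.
  On its left, the label of each strand on the left of both others is reached in two ways, one for
  each order of passing them; the three equations \<open>e\<close>, one for each strand, say that
  they agree.\<close>

lemma cube_triangle:
  assumes X: "biquandle X ut ot" and in_X: "x \<in> X" "y \<in> X" "z \<in> X" and o: "pq = qr \<longrightarrow> pr = pq"
  shows "triangle ut ot b pq pr qr ep eq er (cube_path ut ot b pq pr qr (\<not> eq) (\<not> er) x y z)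
    (cube_path ut ot b (\<not> pq) qr pr ep (\<not> er) y x z) (cube_path ut ot b (\<not> pr) (\<not> qr) pq ep eq z x y)"
proof -
  have e: "act ut ot pr (act ut ot pq x y) (act ut ot (\<not> qr) z y) =
         act ut ot pq (act ut ot pr x z) (act ut ot qr y z)"
    "act ut ot qr (act ut ot (\<not> pq) y x) (act ut ot (\<not> pr) z x) =
         act ut ot (\<not> pq) (act ut ot qr y z) (act ut ot pr x z)"
    "act ut ot (\<not> qr) (act ut ot (\<not> pr) z x) (act ut ot (\<not> pq) y x) =
         act ut ot (\<not> pr) (act ut ot (\<not> qr) z y) (act ut ot pq x y)"
    using act_exchange[OF X in_X, of pq qr pr] act_exchange[OF X in_X(2,1,3), of "\<not> pq" pr qr]
      act_exchange[OF X in_X(3,1,2), of "\<not> pr" pq "\<not> qr"] o by blast+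
  show ?thesis
    by (cases b; cases ep; cases eq; cases er)
      (simp_all add: triangle_def strand_crossing_def cube_path_def cube_label_def Let_def e)
qed

text \<open>A sweep from left to right: the crossings are listed in an order in which the incoming
  labels of each are already known.\<close>

lemma triangle_unique:
  assumes X: "biquandle X ut ot"
    and in_X: "\<And>i. p i \<in> X \<and> q i \<in> X \<and> r i \<in> X" "\<And>i. p' i \<in> X \<and> q' i \<in> X \<and> r' i \<in> X"
    and start: "p 0 = p' 0" "q 0 = q' 0" "r 0 = r' 0"
    and t: "triangle ut ot b pq pr qr ep eq er p q r" "triangle ut ot b pq pr qr ep eq er p' q' r'"
  shows "\<forall>i<3. p i = p' i \<and> q i = q' i \<and> r i = r' i"
proof -
  note u = strand_crossing_unique[OF X]
  have "p 1 = p' 1 \<and> p 2 = p' 2 \<and> q 1 = q' 1 \<and> q 2 = q' 2 \<and> r 1 = r' 1 \<and> r 2 = r' 2"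
  proof (cases b)
    case True
    have 1: "p 1 = p' 1" "q 1 = q' 1"
      using u[of "p 0" "q 0" "p 1" "q 1" "p' 1" "q' 1"] t in_X start True unfolding triangle_def by auto
    have 2: "p 2 = p' 2" "r 1 = r' 1"
      using u[of "p 1" "r 0" "p 2" "r 1" "p' 2" "r' 1"] t in_X start 1 True unfolding triangle_def by auto
    have "q 2 = q' 2" "r 2 = r' 2"
      using u[of "q 1" "r 1" "q 2" "r 2" "q' 2" "r' 2"] t in_X 1 2 True unfolding triangle_def by auto
    then show ?thesis using 1 2 by blast
  next
    case False
    have 1: "q 1 = q' 1" "r 1 = r' 1"
      using u[of "q 0" "r 0" "q 1" "r 1" "q' 1" "r' 1"] t in_X start False unfolding triangle_def by auto
    have 2: "p 1 = p' 1" "r 2 = r' 2"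
      using u[of "p 0" "r 1" "p 1" "r 2" "p' 1" "r' 2"] t in_X start 1 False unfolding triangle_def by auto
    have "p 2 = p' 2" "q 2 = q' 2"
      using u[of "p 1" "q 1" "p 2" "q 2" "p' 2" "q' 2"] t in_X 1 2 False unfolding triangle_def by auto
    then show ?thesis using 1 2 by blast
  qed
  then show ?thesis using start by (auto simp: less_Suc_eq numeral_3_eq_3 numeral_2_eq_2)
qed

text \<open>The map from the three labels on the right of both other strands to the labels at the
  left ends is injective on the cube of \<open>X\<close>: left ends determine both pictures by
  \<open>triangle_unique\<close>, and together the pictures show all labels, in particular
  \<open>x\<close>, \<open>y\<close>, \<open>z\<close>. Finiteness makes it onto.\<close>

lemma cube_exists:
  assumes X: "biquandle X ut ot" "finite X" and o: "pq = qr \<longrightarrow> pr = pq"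
    and in_X: "p0 \<in> X" "q0 \<in> X" "r0 \<in> X"
  shows "\<exists>x\<in>X. \<exists>y\<in>X. \<exists>z\<in>X. p0 = cube_path ut ot b pq pr qr (\<not> eq) (\<not> er) x y z 0 \<and>
     q0 = cube_path ut ot b (\<not> pq) qr pr ep (\<not> er) y x z 0 \<and>
     r0 = cube_path ut ot b (\<not> pr) (\<not> qr) pq ep eq z x y 0"
proof -
  let ?P = "\<lambda>b. cube_path ut ot b pq pr qr (\<not> eq) (\<not> er)"
    and ?Q = "\<lambda>b x y. cube_path ut ot b (\<not> pq) qr pr ep (\<not> er) y x"
    and ?R = "\<lambda>b x y z. cube_path ut ot b (\<not> pr) (\<not> qr) pq ep eq z x y"
  let ?f = "\<lambda>(x, y, z). (?P b x y z 0, ?Q b x y z 0, ?R b x y z 0)"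
  have start: "cube_path ut ot b uv uw vw sv sw u v w 0 = cube_label ut ot uv uw vw u v w sv sw"
    for b uv uw vw sv sw and u v w :: 'a
    by (simp add: cube_path_def Let_def)
  have core: "x = x' \<and> y = y' \<and> z = z'"
    if X1: "x \<in> X" "y \<in> X" "z \<in> X" and X2: "x' \<in> X" "y' \<in> X" "z' \<in> X"
      and eq0: "?P b x y z 0 = ?P b x' y' z' 0" "?Q b x y z 0 = ?Q b x' y' z' 0" "?R b x y z 0 = ?R b x' y' z' 0"
      for x y z x' y' z'
  proof -
    \<comment> \<open>The labels at the left ends do not depend on the picture, so uniqueness
      applies to either picture \<open>d\<close>, whatever \<open>b\<close> is.\<close>
    have all: "\<forall>i<3. ?P d x y z i = ?P d x' y' z' i \<and> ?Q d x y z i = ?Q d x' y' z' i \<and> ?R d x y z i = ?R d x' y' z' i" for d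
      by (rule triangle_unique[OF X(1) _ _ _ _ _ cube_triangle[OF X(1) X1 o] cube_triangle[OF X(1) X2 o]])
        (use eq0 X1 X2 in \<open>simp_all add: cube_path_closed[OF X(1)] start\<close>)
    have corner: "cube_label ut ot uv uw vw u v w True True = u" for uv uw vw and u v w :: 'a
      by (simp add: cube_label_def)
    have E: "?P True x y z i = ?P True x' y' z' i" "?Q True x y z i = ?Q True x' y' z' i" "?R True x y z i = ?R True x' y' z' i"
      "?P False x y z i = ?P False x' y' z' i" "?Q False x y z i = ?Q False x' y' z' i" "?R False x y z i = ?R False x' y' z' i"
      if "i < 3" for i using all that by blast+
    \<comment> \<open>Each picture shows three of the four labels of a strand. Where the label on
      the right of both others appears depends on the orientations, hence the case
      distinctions.\<close>
    note E' = E[of 0, unfolded cube_path_def Let_def] E[of 1, unfolded cube_path_def Let_def]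
      E[of 2, unfolded cube_path_def Let_def]
    have "x = x'" using E' by (cases eq; cases er) (simp_all add: corner)
    moreover have "y = y'" using E' by (cases ep; cases er) (simp_all add: corner)
    moreover have "z = z'" using E' by (cases ep; cases eq) (simp_all add: corner)
    ultimately show ?thesis by blast
  qed
  have "inj_on ?f (X \<times> X \<times> X)"
  proof (rule inj_onI)
    fix u u' assume u: "u \<in> X \<times> X \<times> X" "u' \<in> X \<times> X \<times> X" "?f u = ?f u'"
    obtain x y z x' y' z' where xyz: "u = (x, y, z)" "u' = (x', y', z')" by (cases u, cases u')
    show "u = u'" using core[of x y z x' y' z'] u unfolding xyz by simp
  qed
  moreover have "?f ` (X \<times> X \<times> X) \<subseteq> X \<times> X \<times> X"
    using cube_path_closed[OF X(1)] by auto
  ultimately have "?f ` (X \<times> X \<times> X) = X \<times> X \<times> X"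
    using endo_inj_surj[of "X \<times> X \<times> X" ?f] X(2) by simp
  then have "(p0, q0, r0) \<in> ?f ` (X \<times> X \<times> X)" using in_X by simp
  then show ?thesis by auto
qed

lemma triangle_exchange:
  assumes X: "biquandle X ut ot" "finite X" and o: "pq = qr \<longrightarrow> pr = pq"
    and in_X: "\<And>i. p i \<in> X \<and> q i \<in> X \<and> r i \<in> X"
    and t: "triangle ut ot b pq pr qr ep eq er p q r"
  shows "\<exists>p' q' r'. (\<forall>i. p' i \<in> X \<and> q' i \<in> X \<and> r' i \<in> X) \<and>
    (\<forall>i\<in>{0,2}. p i = p' i \<and> q i = q' i \<and> r i = r' i) \<and> triangle ut ot (\<not> b) pq pr qr ep eq er p' q' r'"
proof -
  obtain x y z where xyz: "x \<in> X" "y \<in> X" "z \<in> X" "p 0 = cube_path ut ot b pq pr qr (\<not> eq) (\<not> er) x y z 0"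
     "q 0 = cube_path ut ot b (\<not> pq) qr pr ep (\<not> er) y x z 0"
     "r 0 = cube_path ut ot b (\<not> pr) (\<not> qr) pq ep eq z x y 0"
    using cube_exists[OF X o, of "p 0" "q 0" "r 0" b eq er ep] in_X[of 0] by auto
  note c = cube_triangle[OF X(1) xyz(1-3) o, of _ ep eq er]
  have cl: "cube_path ut ot d uv uw vw sv sw x y z i \<in> X" "cube_path ut ot d uv uw vw sv sw y x z i \<in> X"
    "cube_path ut ot d uv uw vw sv sw z x y i \<in> X" for d uv uw vw sv sw i
    using cube_path_closed[OF X(1)] xyz(1-3) by simp_all
  \<comment> \<open>Only the middle label, at index 1, depends on which strand is crossed
    first.\<close>
  have ends: "cube_path ut ot (\<not> b) uv uw vw sv sw u v w i = cube_path ut ot b uv uw vw sv sw u v w i"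
    if "i \<in> {0, 2}" for uv uw vw sv sw u v w i
    using that by (auto simp: cube_path_def Let_def)
  have u: "\<forall>i<3. p i = cube_path ut ot b pq pr qr (\<not> eq) (\<not> er) x y z i \<and>
      q i = cube_path ut ot b (\<not> pq) qr pr ep (\<not> er) y x z i \<and> r i = cube_path ut ot b (\<not> pr) (\<not> qr) pq ep eq z x y i"
    by (rule triangle_unique[OF X(1) _ _ _ _ _ t c]) (use in_X xyz cl in simp_all)
  show ?thesis
  proof (intro exI conjI)
    show "\<forall>i\<in>{0,2}. p i = cube_path ut ot (\<not> b) pq pr qr (\<not> eq) (\<not> er) x y z i \<and>
      q i = cube_path ut ot (\<not> b) (\<not> pq) qr pr ep (\<not> er) y x z i \<and>
      r i = cube_path ut ot (\<not> b) (\<not> pr) (\<not> qr) pq ep eq z x y i"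
      using u by (simp add: ends)
  qed (use c cl in simp_all)
qed

text \<open>By the first axiom the pair map sends \<open>(x, x)\<close> to the diagonal point over
  \<open>ut x x\<close>, so its injectivity restricts to the diagonal; finiteness gives
  surjectivity.\<close>

lemma diagonal_bij:
  assumes X: "biquandle X ut ot" "finite X"
  shows "bij_betw (\<lambda>x. ut x x) X X"
proof -
  have d: "ut x x = ot x x" "ut x x \<in> X" if "x \<in> X" for x
    using X(1) that by (simp_all add: biquandle_def)
  have S: "bij_betw (\<lambda>(x, y). (ot y x, ut x y)) (X \<times> X) (X \<times> X)"
    using X(1) unfolding biquandle_def by blast
  have inj: "inj_on (\<lambda>x. ut x x) X"
  proof (rule inj_onI)
    fix x y assume "x \<in> X" "y \<in> X" "ut x x = ut y y"
    then show "x = y"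
      using inj_onD[OF bij_betw_imp_inj_on[OF S], of "(x, x)" "(y, y)"] d(1)[of x] d(1)[of y] by simp
  qed
  then have "(\<lambda>x. ut x x) ` X = X" by (intro endo_inj_surj[OF X(2)] image_subsetI d(2))
  then show ?thesis using inj by (simp add: bij_betw_def)
qed

section \<open>Labels of strands with two crossings\<close>

lemma strand_coloring_const:
  assumes g: "g \<in> strand_colorings X ut ot m \<epsilon> dM R" and j: "j < m"
    and I: "topological_space_class.connected I" "I \<subseteq> {-1..1}" "\<And>x. x \<in> I \<Longrightarrow> (j, x) \<notin> Field R"
    and xy: "x \<in> I" "y \<in> I"
  shows "g (j, x) = g (j, y)"
proof (rule connected_local_const[where A = I and f = "\<lambda>x. g (j, x)", OF I(1) xy], intro ballI)
  fix x assume x: "x \<in> I"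
  have d: "(j, x) \<in> strand_dom m" using x I(2) j by (auto simp: strand_dom_def)
  note D = strand_coloringsD[OF g d I(3)[OF x], simplified]
  have "\<exists>d>0. \<forall>y\<in>I. \<bar>y - x\<bar> < d \<longrightarrow> g (j, x) = g (j, y)"
  proof -
    have "\<exists>d>0. \<forall>y. x < y \<and> y < x + d \<longrightarrow> y \<in> I \<longrightarrow> g (j, y) = g (j, x)"
    proof (cases "x < 1")
      case True
      then have "\<forall>\<^sub>F t in at_right 0. g (j, x + t) = g (j, x)" using D(3) by (simp add: lim_right_def)
      then obtain d where d: "d > 0" "\<forall>t>0. t < d \<longrightarrow> g (j, x + t) = g (j, x)"
        unfolding eventually_at_right_field by blast
      have "g (j, y) = g (j, x)" if "x < y" "y < x + d" for y
        using d(2)[rule_format, of "y - x"] that by simp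
      then show ?thesis using d(1) by blast
    next
      case False
      then have "\<not> x < y" if "y \<in> I" for y using that I(2) by force
      then show ?thesis by (intro exI[of _ 1]) auto
    qed
    then obtain d1 where d1: "d1 > 0" "\<And>y. x < y \<Longrightarrow> y < x + d1 \<Longrightarrow> y \<in> I \<Longrightarrow> g (j, y) = g (j, x)" by blast
    have "\<exists>d>0. \<forall>y. x - d < y \<and> y < x \<longrightarrow> y \<in> I \<longrightarrow> g (j, y) = g (j, x)"
    proof (cases "x > -1")
      case True
      then have "\<forall>\<^sub>F t in at_right 0. g (j, x - t) = g (j, x)" using D(2) by (simp add: lim_left_def)
      then obtain d where d: "d > 0" "\<forall>t>0. t < d \<longrightarrow> g (j, x - t) = g (j, x)"
        unfolding eventually_at_right_field by blast
      have "g (j, y) = g (j, x)" if "x - d < y" "y < x" for y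
        using d(2)[rule_format, of "x - y"] that by simp
      then show ?thesis using d(1) by blast
    next
      case False
      then have "\<not> y < x" if "y \<in> I" for y using that I(2) by force
      then show ?thesis by (intro exI[of _ 1]) auto
    qed
    then obtain d2 where d2: "d2 > 0" "\<And>y. x - d2 < y \<Longrightarrow> y < x \<Longrightarrow> y \<in> I \<Longrightarrow> g (j, y) = g (j, x)" by blast
    have "g (j, x) = g (j, y)" if "y \<in> I" "\<bar>y - x\<bar> < min d1 d2" for y
    proof (cases y x rule: linorder_cases)
      case less then show ?thesis using d2(2)[of y] that by simp
    next
      case greater then show ?thesis using d1(2)[of y] that by simp
    qed simp
    then show ?thesis using d1(1) d2(1) by (intro exI[of _ "min d1 d2"]) simp
  qed
  then show "\<forall>\<^sub>F y in at x within I. g (j, x) = g (j, y)"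
    unfolding eventually_at dist_real_def by blast
qed

text \<open>The values at the breaks are arbitrary: breaks will be crossing points, where strand
  colorings are unconstrained.\<close>

definition piecewise :: "(nat \<Rightarrow> real) \<Rightarrow> (nat \<Rightarrow> real) \<Rightarrow> (nat \<Rightarrow> nat \<Rightarrow> 'a) \<Rightarrow> nat \<times> real \<Rightarrow> 'a" where
  "piecewise a b l = (\<lambda>(j, x). if x < a j then l j 0 else if x < b j then l j 1 else l j 2)"

text \<open>Meant for the breaks of strand \<open>j\<close> only: the second branch stands for the
  second break \<open>b j\<close>.\<close>

definition label_left :: "(nat \<Rightarrow> real) \<Rightarrow> (nat \<Rightarrow> nat \<Rightarrow> 'a) \<Rightarrow> nat \<times> real \<Rightarrow> 'a" where
  "label_left a l = (\<lambda>(j, x). if x = a j then l j 0 else l j 1)"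

definition label_right :: "(nat \<Rightarrow> real) \<Rightarrow> (nat \<Rightarrow> nat \<Rightarrow> 'a) \<Rightarrow> nat \<times> real \<Rightarrow> 'a" where
  "label_right a l = (\<lambda>(j, x). if x = a j then l j 1 else l j 2)"

text \<open>Membership in \<open>X\<close> is demanded for all indices and not just 0, 1, 2, in
  accordance with the lemmas on triangles; \<open>three\<close> and \<open>cube_path\<close> repeat
  their last value from index 2 on.\<close>

definition label_colorings ::
  "'a set \<Rightarrow> ('a \<Rightarrow> 'a \<Rightarrow> 'a) \<Rightarrow> ('a \<Rightarrow> 'a \<Rightarrow> 'a) \<Rightarrow> nat \<Rightarrow> (nat \<Rightarrow> real) \<Rightarrow> (nat \<Rightarrow> real \<Rightarrow> complex) \<Rightarrow>
   ((nat \<times> real) \<times> (nat \<times> real)) set \<Rightarrow> (nat \<Rightarrow> real) \<Rightarrow> (nat \<Rightarrow> nat \<Rightarrow> 'a) set" where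
  "label_colorings X ut ot m \<epsilon> dM R a =
     {l. (\<forall>j<m. \<forall>i. l j i \<in> X) \<and> (\<forall>(p, q)\<in>R. strand_crossing_condition ut ot \<epsilon> dM p q
        (label_left a l p) (label_right a l p) (label_left a l q) (label_right a l q))}"

text \<open>In both pictures of the third move, and in the second picture of the other moves, every strand \<open>j\<close> has
  exactly two crossing points \<open>a j < b j\<close> and hence three labels \<open>l j 0\<close>, \<open>l j 1\<close>, \<open>l j 2\<close>.\<close>

definition two_breaks where
  "two_breaks m a b R \<longleftrightarrow> (\<forall>j<m. -1 < a j \<and> a j < b j \<and> b j < (1::real)) \<and>
     Field R = {(j, x). j < (m::nat) \<and> (x = a j \<or> x = b j)}"

definition determined_by_ends :: "nat \<Rightarrow> (nat \<Rightarrow> nat \<Rightarrow> 'a) set \<Rightarrow> bool" where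
  "determined_by_ends m L \<longleftrightarrow> (\<forall>l\<in>L. \<forall>l'\<in>L.
     (\<forall>j<m. l j 0 = l' j 0 \<and> l j 2 = l' j 2) \<longrightarrow> (\<forall>j<m. l j 1 = l' j 1))"

lemma two_breaks_interior: "two_breaks m a b R \<Longrightarrow> Field R \<subseteq> {..<m} \<times> {-1<..<1}"
  by (force simp: two_breaks_def)

lemma strand_coloring_labels:
  assumes g: "g \<in> strand_colorings X ut ot m \<epsilon> dM R" and tb: "two_breaks m a b R"
  obtains l where "l \<in> label_colorings X ut ot m \<epsilon> dM R a"
    "\<And>p. p \<in> strand_dom m - Field R \<Longrightarrow> g p = piecewise a b l p"
    "\<And>j. j < m \<Longrightarrow> l j 0 = g (j, -1)" "\<And>j. j < m \<Longrightarrow> l j 2 = g (j, 1)"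
proof -
  have ab: "-1 < a j" "a j < b j" "b j < 1" if "j < m" for j using tb that by (auto simp: two_breaks_def)
  have F: "Field R = {(j, x). j < m \<and> (x = a j \<or> x = b j)}" using tb by (simp add: two_breaks_def)
  \<comment> \<open>The middle label is read off at the midpoint of the breaks, the outer ones at
    the ends of the strand.\<close>
  define l where "l j = three (g (j, -1)) (g (j, (a j + b j) / 2)) (g (j, 1))" for j
  have c0: "g (j, x) = l j 0" if "j < m" "x \<in> {-1..<a j}" for j x
  proof -
    have "{-1..<a j} \<subseteq> {-1..1}" by (rule subsetI) (use ab[OF that(1)] in auto)
    from strand_coloring_const[OF g that(1) _ this, of x "-1"] show ?thesis
      using ab[OF that(1)] that(2) F by (auto simp: l_def)
  qed
  have c1: "g (j, x) = l j 1" if "j < m" "x \<in> {a j<..<b j}" for j x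
  proof -
    have "{a j<..<b j} \<subseteq> {-1..1}" by (rule subsetI) (use ab[OF that(1)] in auto)
    from strand_coloring_const[OF g that(1) _ this, of x "(a j + b j) / 2"] show ?thesis
      using ab[OF that(1)] that(2) F by (auto simp: l_def)
  qed
  have c2: "g (j, x) = l j 2" if "j < m" "x \<in> {b j<..1}" for j x
  proof -
    have "{b j<..1} \<subseteq> {-1..1}" by (rule subsetI) (use ab[OF that(1)] in auto)
    from strand_coloring_const[OF g that(1) _ this, of x 1] show ?thesis
      using ab[OF that(1)] that(2) F by (auto simp: l_def)
  qed
  have lX: "l j i \<in> X" if "j < m" for j i
  proof -
    have "(j, -1) \<in> strand_dom m - Field R" "(j, (a j + b j) / 2) \<in> strand_dom m - Field R"
      "(j, 1) \<in> strand_dom m - Field R"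
      using ab[OF that] that unfolding F strand_dom_def by (auto simp: field_simps)
    then have "g (j, -1) \<in> X" "g (j, (a j + b j) / 2) \<in> X" "g (j, 1) \<in> X"
      using strand_coloringsD(1)[OF g] by blast+
    then show ?thesis by (simp add: l_def three_def)
  qed
  have lims: "lim_left g p (label_left a l p) \<and> lim_right g p (label_right a l p)" if p: "p \<in> Field R" for p
  proof -
    obtain j x where jx: "p = (j, x)" by (cases p)
    have j: "j < m" and x: "x = a j \<or> x = b j" using p by (auto simp: jx F)
    show ?thesis
    proof (cases "x = a j")
      case True
      have "\<forall>\<^sub>F t in at_right 0. g (j, x - t) = l j 0"
        unfolding eventually_at_right_field
        by (rule exI[of _ "a j + 1"]) (use ab[OF j] c0[OF j] True in auto)
      moreover have "\<forall>\<^sub>F t in at_right 0. g (j, x + t) = l j 1"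
        unfolding eventually_at_right_field
        by (rule exI[of _ "b j - a j"]) (use ab[OF j] c1[OF j] True in auto)
      ultimately show ?thesis
        using True by (simp add: jx lim_left_def lim_right_def label_left_def label_right_def)
    next
      case False
      then have x: "x = b j" using x by simp
      have "\<forall>\<^sub>F t in at_right 0. g (j, x - t) = l j 1"
        unfolding eventually_at_right_field
        by (rule exI[of _ "b j - a j"]) (use ab[OF j] c1[OF j] x in auto)
      moreover have "\<forall>\<^sub>F t in at_right 0. g (j, x + t) = l j 2"
        unfolding eventually_at_right_field
        by (rule exI[of _ "1 - b j"]) (use ab[OF j] c2[OF j] x in auto)
      ultimately show ?thesis
        using False by (simp add: jx lim_left_def lim_right_def label_left_def label_right_def)
    qed
  qed
  have "strand_crossing_condition ut ot \<epsilon> dM p q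
        (label_left a l p) (label_right a l p) (label_left a l q) (label_right a l q)"
    if pq: "(p, q) \<in> R" for p q
  proof -
    obtain p1 p2 q1 q2 where *: "lim_left g p p1" "lim_right g p p2" "lim_left g q q1" "lim_right g q q2"
        "strand_crossing_condition ut ot \<epsilon> dM p q p1 p2 q1 q2"
      using strand_colorings_crossing[OF g pq] .
    have "p \<in> Field R" "q \<in> Field R" using pq by (auto simp: Field_def)
    then have "p1 = label_left a l p" "p2 = label_right a l p" "q1 = label_left a l q" "q2 = label_right a l q"
      using lims * by (meson lim_left_unique lim_right_unique)+
    then show ?thesis using *(5) by simp
  qed
  then have "l \<in> label_colorings X ut ot m \<epsilon> dM R a" using lX unfolding label_colorings_def by blast
  moreover have "g p = piecewise a b l p" if "p \<in> strand_dom m - Field R" for p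
  proof -
    obtain j x where jx: "p = (j, x)" by (cases p)
    then have "j < m" "x \<in> {-1..1}" "x \<noteq> a j" "x \<noteq> b j" using that by (auto simp: F strand_dom_def)
    then show ?thesis using c0[of j x] c1[of j x] c2[of j x] ab[of j] by (auto simp: jx piecewise_def)
  qed
  ultimately show thesis using that by (simp add: l_def)
qed

lemma piecewise_strand_coloring:
  assumes l: "l \<in> label_colorings X ut ot m \<epsilon> dM R a" and tb: "two_breaks m a b R"
  shows "piecewise a b l \<in> strand_colorings X ut ot m \<epsilon> dM R"
proof -
  let ?g = "piecewise a b l"
  have ab: "-1 < a j" "a j < b j" "b j < 1" if "j < m" for j using tb that by (auto simp: two_breaks_def)
  have F: "Field R = {(j, x). j < m \<and> (x = a j \<or> x = b j)}" using tb by (simp add: two_breaks_def)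
  have lX: "l j i \<in> X" if "j < m" for j i using l that by (simp add: label_colorings_def)
  have const: "\<forall>\<^sub>F t in at_right 0. ?g (j, x - t) = v"
    if "s < x" "\<And>y. s < y \<Longrightarrow> y < x \<Longrightarrow> ?g (j, y) = v" for j x s v
    unfolding eventually_at_right_field using that by (intro exI[of _ "x - s"]) auto
  have const': "\<forall>\<^sub>F t in at_right 0. ?g (j, x + t) = v"
    if "x < s" "\<And>y. x < y \<Longrightarrow> y < s \<Longrightarrow> ?g (j, y) = v" for j x s v
    unfolding eventually_at_right_field using that by (intro exI[of _ "s - x"]) auto
  have left: "lim_left ?g (j, x) (if x \<le> a j then l j 0 else if x \<le> b j then l j 1 else l j 2)" if "j < m" for j x
    unfolding lim_left_def fst_conv snd_conv
    by (rule const[of "if x \<le> a j then x - 1 else if x \<le> b j then a j else b j"])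
      (use ab[OF that] in \<open>auto simp: piecewise_def split: if_splits\<close>)
  have right: "lim_right ?g (j, x) (if x < a j then l j 0 else if x < b j then l j 1 else l j 2)" if "j < m" for j x
    unfolding lim_right_def fst_conv snd_conv
    by (rule const'[of _ "if x < a j then a j else if x < b j then b j else x + 1"])
      (use ab[OF that] in \<open>auto simp: piecewise_def split: if_splits\<close>)
  show ?thesis
  proof (rule strand_coloringsI)
    fix p assume p: "p \<in> strand_dom m" "p \<notin> Field R"
    obtain j x where jx: "p = (j, x)" by (cases p)
    have j: "j < m" and x: "x \<noteq> a j" "x \<noteq> b j" using p by (auto simp: jx F strand_dom_def)
    show "?g p \<in> X" using lX[OF j] by (simp add: jx piecewise_def)
    show "lim_left ?g p (?g p)" using left[OF j, of x] x by (auto simp: jx piecewise_def split: if_splits)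
    show "lim_right ?g p (?g p)" using right[OF j, of x] x by (auto simp: jx piecewise_def split: if_splits)
  next
    fix p q assume pq: "(p, q) \<in> R"
    have lims: "lim_left ?g p (label_left a l p) \<and> lim_right ?g p (label_right a l p)" if p: "p \<in> Field R" for p
    proof -
      obtain j x where jx: "p = (j, x)" by (cases p)
      have j: "j < m" and x: "x = a j \<or> x = b j" using p by (auto simp: jx F)
      show ?thesis
        using left[OF j, of x] right[OF j, of x] x ab[OF j]
        by (auto simp: jx label_left_def label_right_def split: if_splits)
    qed
    have "p \<in> Field R" "q \<in> Field R" using pq by (auto simp: Field_def)
    moreover have "strand_crossing_condition ut ot \<epsilon> dM p q
        (label_left a l p) (label_right a l p) (label_left a l q) (label_right a l q)"
      using l pq unfolding label_colorings_def by blast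
    ultimately show "strand_crossing_colored ut ot \<epsilon> dM ?g p q"
      unfolding strand_crossing_colored_def
      using lims by blast
  qed
qed

lemma piecewise_ends:
  assumes "two_breaks m a b R" "j < m"
  shows "piecewise a b l (j, -1) = l j 0" "piecewise a b l (j, 1) = l j 2"
  using assms by (auto simp: two_breaks_def piecewise_def)

lemma label_colorings_agree:
  assumes tb: "two_breaks m a b R"
    and unique: "determined_by_ends m (label_colorings X ut ot m \<epsilon> dM R a)"
    and g: "g \<in> strand_colorings X ut ot m \<epsilon> dM R" "g' \<in> strand_colorings X ut ot m \<epsilon> dM R"
    and ends: "\<forall>j<m. g' (j, -1) = g (j, -1) \<and> g' (j, 1) = g (j, 1)"
    and p: "p \<in> strand_dom m - Field R"
  shows "g' p = g p"
proof -
  obtain l where l: "l \<in> label_colorings X ut ot m \<epsilon> dM R a" "\<And>p. p \<in> strand_dom m - Field R \<Longrightarrow> g p = piecewise a b l p"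
    "\<And>j. j < m \<Longrightarrow> l j 0 = g (j, -1)" "\<And>j. j < m \<Longrightarrow> l j 2 = g (j, 1)"
    by (rule strand_coloring_labels[OF g(1) tb]) blast
  obtain l' where l': "l' \<in> label_colorings X ut ot m \<epsilon> dM R a" "\<And>p. p \<in> strand_dom m - Field R \<Longrightarrow> g' p = piecewise a b l' p"
    "\<And>j. j < m \<Longrightarrow> l' j 0 = g' (j, -1)" "\<And>j. j < m \<Longrightarrow> l' j 2 = g' (j, 1)"
    by (rule strand_coloring_labels[OF g(2) tb]) blast
  obtain j x where jx: "p = (j, x)" by (cases p)
  have j: "j < m" using p by (auto simp: jx strand_dom_def)
  have e: "\<forall>j<m. l j 0 = l' j 0 \<and> l j 2 = l' j 2"
    using l(3,4) l'(3,4) ends by auto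
  then have "l j 1 = l' j 1" using unique l(1) l'(1) j unfolding determined_by_ends_def by blast
  then show ?thesis using e j unfolding l(2)[OF p] l'(2)[OF p] by (simp add: jx piecewise_def)
qed

lemma ends_extend_breaks:
  assumes tb: "two_breaks m a b R" "two_breaks m a' b' R'"
    and ex: "\<And>l. l \<in> label_colorings X ut ot m \<epsilon> dM R a \<Longrightarrow>
      \<exists>l'\<in>label_colorings X ut ot m \<epsilon> dM' R' a'. \<forall>j<m. l' j 0 = l j 0 \<and> l' j 2 = l j 2"
    and unique: "determined_by_ends m (label_colorings X ut ot m \<epsilon> dM' R' a')"
  shows "ends_extend m (strand_colorings X ut ot m \<epsilon> dM R) (strand_colorings X ut ot m \<epsilon> dM' R') R'"
  unfolding ends_extend_def
proof (intro conjI ballI impI)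
  fix g assume g: "g \<in> strand_colorings X ut ot m \<epsilon> dM R"
  obtain l where l: "l \<in> label_colorings X ut ot m \<epsilon> dM R a"
    "\<And>j. j < m \<Longrightarrow> l j 0 = g (j, -1)" "\<And>j. j < m \<Longrightarrow> l j 2 = g (j, 1)"
    by (rule strand_coloring_labels[OF g tb(1)]) blast
  obtain l' where l': "l'\<in>label_colorings X ut ot m \<epsilon> dM' R' a'" "\<forall>j<m. l' j 0 = l j 0 \<and> l' j 2 = l j 2"
    using ex[OF l(1)] by blast
  show "\<exists>g'\<in>strand_colorings X ut ot m \<epsilon> dM' R'. \<forall>j<m. g' (j, -1) = g (j, -1) \<and> g' (j, 1) = g (j, 1)"
    by (rule bexI[OF _ piecewise_strand_coloring[OF l'(1) tb(2)]])
      (use l' l in \<open>auto simp: piecewise_ends[OF tb(2)]\<close>)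
next
  show "g' p = g p" if "g \<in> strand_colorings X ut ot m \<epsilon> dM' R'" "g' \<in> strand_colorings X ut ot m \<epsilon> dM' R'"
    "\<forall>j<m. g' (j, -1) = g (j, -1) \<and> g' (j, 1) = g (j, 1)" "p \<in> strand_dom m - Field R'" for g g' p
    by (rule label_colorings_agree[OF tb(2) unique that])
qed

section \<open>Pictures without classical crossings\<close>

lemma trivial_strand_coloring:
  assumes "g \<in> strand_colorings X ut ot m \<epsilon> dM {}" "j < m"
  shows "x \<in> {-1..1} \<Longrightarrow> g (j, x) = g (j, -1)" "g (j, -1) \<in> X"
  using strand_coloring_const[OF assms, of "{-1..1}" x "-1"]
    strand_coloringsD(1)[OF assms(1), of "(j, -1)"] assms(2)
  by (auto simp: strand_dom_def)

lemma ends_extend_from_trivial: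
  assumes tb: "two_breaks m a b R"
    and ex: "\<And>l0. (\<And>j. j < m \<Longrightarrow> l0 j \<in> X) \<Longrightarrow>
      \<exists>l\<in>label_colorings X ut ot m \<epsilon> dM' R a. \<forall>j<m. l j 0 = l0 j \<and> l j 2 = l0 j"
    and unique: "determined_by_ends m (label_colorings X ut ot m \<epsilon> dM' R a)"
  shows "ends_extend m (strand_colorings X ut ot m \<epsilon> dM {}) (strand_colorings X ut ot m \<epsilon> dM' R) R"
  unfolding ends_extend_def
proof (intro conjI ballI impI)
  fix g assume g: "g \<in> strand_colorings X ut ot m \<epsilon> dM {}"
  obtain l where l: "l\<in>label_colorings X ut ot m \<epsilon> dM' R a" "\<forall>j<m. l j 0 = g (j, -1) \<and> l j 2 = g (j, -1)"
    using ex[of "\<lambda>j. g (j, -1)"] trivial_strand_coloring(2)[OF g] by blast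
  show "\<exists>g'\<in>strand_colorings X ut ot m \<epsilon> dM' R. \<forall>j<m. g' (j, -1) = g (j, -1) \<and> g' (j, 1) = g (j, 1)"
    by (rule bexI[OF _ piecewise_strand_coloring[OF l(1) tb]])
      (use l trivial_strand_coloring(1)[OF g, of _ 1] in \<open>auto simp: piecewise_ends[OF tb]\<close>)
next
  show "g' p = g p" if "g \<in> strand_colorings X ut ot m \<epsilon> dM' R" "g' \<in> strand_colorings X ut ot m \<epsilon> dM' R"
    "\<forall>j<m. g' (j, -1) = g (j, -1) \<and> g' (j, 1) = g (j, 1)" "p \<in> strand_dom m - Field R" for g g' p
    by (rule label_colorings_agree[OF tb unique that])
qed

lemma ends_extend_to_trivial:
  assumes tb: "two_breaks m a b R"
    and ex: "\<And>l j. l \<in> label_colorings X ut ot m \<epsilon> dM' R a \<Longrightarrow> j < m \<Longrightarrow> l j 0 = l j 2"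
  shows "ends_extend m (strand_colorings X ut ot m \<epsilon> dM' R) (strand_colorings X ut ot m \<epsilon> dM {}) {}"
  unfolding ends_extend_def
proof (intro conjI ballI impI)
  fix g assume g: "g \<in> strand_colorings X ut ot m \<epsilon> dM' R"
  obtain l where l: "l \<in> label_colorings X ut ot m \<epsilon> dM' R a"
    "\<And>j. j < m \<Longrightarrow> l j 0 = g (j, -1)" "\<And>j. j < m \<Longrightarrow> l j 2 = g (j, 1)"
    by (rule strand_coloring_labels[OF g tb]) blast
  have X: "l j 0 \<in> X" if "j < m" for j using l(1) that by (simp add: label_colorings_def)
  have "(\<lambda>(j, x). l j 0) \<in> strand_colorings X ut ot m \<epsilon> dM {}"
    by (rule strand_coloringsI) (auto simp: strand_dom_def X lim_left_def lim_right_def)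
  then show "\<exists>g'\<in>strand_colorings X ut ot m \<epsilon> dM {}. \<forall>j<m. g' (j, -1) = g (j, -1) \<and> g' (j, 1) = g (j, 1)"
    by (rule bexI[rotated]) (use l ex[OF l(1)] in auto)
next
  fix g g' p assume g: "g \<in> strand_colorings X ut ot m \<epsilon> dM {}" "g' \<in> strand_colorings X ut ot m \<epsilon> dM {}"
    and ends: "\<forall>j<m. g' (j, -1) = g (j, -1) \<and> g' (j, 1) = g (j, 1)" and p: "p \<in> strand_dom m - Field {}"
  obtain j x where jx: "p = (j, x)" by (cases p)
  have "j < m" "x \<in> {-1..1}" using p by (auto simp: jx strand_dom_def)
  then show "g' p = g p"
    using trivial_strand_coloring(1)[OF g(1), of j x] trivial_strand_coloring(1)[OF g(2), of j x] ends by (simp add: jx)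
qed

text \<open>The common frame of the first two classical moves. A strand without crossings has one
  label, so after the move the two end labels must be equal, arbitrary such end labels must occur,
  and they must determine the middle labels.\<close>

lemma local_move_from_trivial:
  assumes D: "diagram D1" "diagram D2" and mv: "local_move m M1 M2 ov D1 D2"
    and deriv: "\<And>j x. (M1 j has_vector_derivative dM1 j x) (at x)" "\<And>j x. (M2 j has_vector_derivative dM2 j x) (at x)"
    and R: "crossings m M1 ov = {}" "crossings m M2 ov = R" and tb: "two_breaks m a b R"
    and ex: "\<And>\<epsilon> l0. (\<And>j. j < m \<Longrightarrow> \<epsilon> j \<noteq> 0) \<Longrightarrow> (\<And>j. j < m \<Longrightarrow> l0 j \<in> X) \<Longrightarrow>
      \<exists>l\<in>label_colorings X ut ot m \<epsilon> dM2 R a. \<forall>j<m. l j 0 = l0 j \<and> l j 2 = l0 j"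
    and unique: "\<And>\<epsilon>. (\<And>j. j < m \<Longrightarrow> \<epsilon> j \<noteq> 0) \<Longrightarrow> determined_by_ends m (label_colorings X ut ot m \<epsilon> dM2 R a)"
    and ends: "\<And>\<epsilon> l j. (\<And>j. j < m \<Longrightarrow> \<epsilon> j \<noteq> 0) \<Longrightarrow> l \<in> label_colorings X ut ot m \<epsilon> dM2 R a \<Longrightarrow> j < m \<Longrightarrow> l j 0 = l j 2"
  shows "equivalent_colorings X ut ot D1 D2"
proof (rule local_move_equivariant[OF D mv deriv])
  fix \<epsilon> :: "nat \<Rightarrow> real" assume e: "\<And>j. j < m \<Longrightarrow> \<epsilon> j \<noteq> 0"
  show "ends_extend m (strand_colorings X ut ot m \<epsilon> dM1 (crossings m M1 ov))
        (strand_colorings X ut ot m \<epsilon> dM2 (crossings m M2 ov)) (crossings m M2 ov) \<and>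
      ends_extend m (strand_colorings X ut ot m \<epsilon> dM2 (crossings m M2 ov))
        (strand_colorings X ut ot m \<epsilon> dM1 (crossings m M1 ov)) (crossings m M1 ov)"
    unfolding R
  proof
    show "ends_extend m (strand_colorings X ut ot m \<epsilon> dM1 {}) (strand_colorings X ut ot m \<epsilon> dM2 R) R"
    proof (rule ends_extend_from_trivial[OF tb])
      show "determined_by_ends m (label_colorings X ut ot m \<epsilon> dM2 R a)" by (rule unique) (rule e)
    qed (rule ex, rule e)
    show "ends_extend m (strand_colorings X ut ot m \<epsilon> dM2 R) (strand_colorings X ut ot m \<epsilon> dM1 {}) {}"
      by (rule ends_extend_to_trivial[OF tb], rule ends) (rule e)
  qed
qed (use R two_breaks_interior[OF tb] in simp_all)

text \<open>In the pictures of the second and third moves the parameter of a strand is its abscissa,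
  so both preimages of a crossing have the same parameter. The over-strand comes first.\<close>

definition crossing_pair :: "bool \<Rightarrow> nat \<Rightarrow> nat \<Rightarrow> real \<Rightarrow> (nat \<times> real) \<times> (nat \<times> real)" where
  "crossing_pair uv u v x = (if uv then ((u, x), (v, x)) else ((v, x), (u, x)))"

lemma crossing_pair_condition:
  assumes "\<epsilon> u \<noteq> 0" "\<epsilon> v \<noteq> 0" "cross2 (dM u x) (dM v x) > 0"
  shows "(case crossing_pair uv u v x of (p, q) \<Rightarrow> strand_crossing_condition ut ot \<epsilon> dM p q
      (label_left a l p) (label_right a l p) (label_left a l q) (label_right a l q)) \<longleftrightarrow>
    strand_crossing ut ot uv (\<epsilon> u > 0) (\<epsilon> v > 0)
      (label_left a l (u, x)) (label_right a l (u, x)) (label_left a l (v, x)) (label_right a l (v, x))"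
proof -
  have neg: "cross2 (dM v x) (dM u x) < 0" using assms(3) by (simp add: cross2_def algebra_simps)
  show ?thesis
    unfolding crossing_pair_def strand_crossing_condition_def
    using crossing_upper_over[OF assms] crossing_lower_over[OF assms(1,2) neg]
    by (cases uv) (simp_all only: if_True if_False prod.case fst_conv snd_conv)
qed

section \<open>The Reidemeister moves\<close>

lemma move_picture_derivatives:
  "(R1_before j has_vector_derivative Complex 1 (2 * x)) (at x)"
  "(R1_after j has_vector_derivative Complex (1 - 4 * (1 - x\<^sup>2)\<^sup>2 + 16 * x\<^sup>2 * (1 - x\<^sup>2)) (2 * x)) (at x)"
  "(R2_before j has_vector_derivative Complex 1 0) (at x)"
  "(R2_after j has_vector_derivative Complex 1 (if j = 0 then 0 else 4 * x * (1 - x\<^sup>2))) (at x)"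
  "(R3_before j has_vector_derivative
     Complex 1 (if j = 0 then 1 else if j = 1 then -1 else - (2 * x * (1 - x\<^sup>2)))) (at x)"
  "(R3_after j has_vector_derivative
     Complex 1 (if j = 0 then 1 else if j = 1 then -1 else 2 * x * (1 - x\<^sup>2))) (at x)"
proof -
  show "(R1_before j has_vector_derivative Complex 1 (2 * x)) (at x)"
    unfolding has_vector_derivative_complex_iff R1_before_def by (auto intro!: derivative_eq_intros)
  show "(R1_after j has_vector_derivative Complex (1 - 4 * (1 - x\<^sup>2)\<^sup>2 + 16 * x\<^sup>2 * (1 - x\<^sup>2)) (2 * x)) (at x)"
    unfolding has_vector_derivative_complex_iff R1_after_def
    by (auto intro!: derivative_eq_intros simp: power2_eq_square algebra_simps)
  show "(R2_before j has_vector_derivative Complex 1 0) (at x)"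
    by (cases "j = 0")
      (auto simp: has_vector_derivative_complex_iff R2_before_def intro!: derivative_eq_intros)
  show "(R2_after j has_vector_derivative Complex 1 (if j = 0 then 0 else 4 * x * (1 - x\<^sup>2))) (at x)"
    by (cases "j = 0")
      (auto simp: has_vector_derivative_complex_iff R2_after_def intro!: derivative_eq_intros)
  show "(R3_before j has_vector_derivative
     Complex 1 (if j = 0 then 1 else if j = 1 then -1 else - (2 * x * (1 - x\<^sup>2)))) (at x)"
    by (cases "j = 0"; cases "j = 1")
      (auto simp: has_vector_derivative_complex_iff R3_before_def intro!: derivative_eq_intros)
  show "(R3_after j has_vector_derivative
     Complex 1 (if j = 0 then 1 else if j = 1 then -1 else 2 * x * (1 - x\<^sup>2))) (at x)"
    by (cases "j = 0"; cases "j = 1")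
      (auto simp: has_vector_derivative_complex_iff R3_after_def intro!: derivative_eq_intros)
qed

text \<open>The left side says that the pair map sends \<open>(u, v)\<close> to
  \<open>(w, w)\<close>. By \<open>diagonal_bij\<close> some \<open>(y, y)\<close> is sent there
  too, and injectivity gives \<open>u = v = y\<close>.\<close>

lemma kink_iff:
  assumes X: "biquandle X ut ot" "finite X" and in_X: "u \<in> X" "v \<in> X" "w \<in> X"
  shows "ut u v = w \<and> ot v u = w \<longleftrightarrow> u = v \<and> ut u u = w"
proof
  assume uv: "ut u v = w \<and> ot v u = w"
  have S: "bij_betw (\<lambda>(x, y). (ot y x, ut x y)) (X \<times> X) (X \<times> X)"
    using X(1) unfolding biquandle_def by blast
  have "w \<in> (\<lambda>x. ut x x) ` X"
    using bij_betw_imp_surj_on[OF diagonal_bij[OF X]] in_X(3) by simp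
  then obtain y where y: "y \<in> X" "ut y y = w" by blast
  have "ot y y = w" using X(1) y by (simp add: biquandle_def)
  then have "(u, v) = (y, y)"
    using inj_onD[OF bij_betw_imp_inj_on[OF S], of "(u, v)" "(y, y)"] uv y in_X by simp
  then show "u = v \<and> ut u u = w" using y(2) by simp
next
  assume "u = v \<and> ut u u = w"
  then show "ut u v = w \<and> ot v u = w" using X(1) in_X by (auto simp: biquandle_def)
qed

text \<open>The labels before, on and after the loop are \<open>a\<close>, \<open>b\<close>,
  \<open>c\<close>. The first claim has the first passage on top, the second claim the second one;
  the sign of \<open>t\<close> differs because the determinant is taken in the order over, under.
  The outcome is the same.\<close>

lemma kink_condition:
  assumes X: "biquandle X ut ot" "finite X" and in_X: "a \<in> X" "b \<in> X" "c \<in> X" and e: "e \<noteq> (0::real)"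
  shows "t > 0 \<Longrightarrow> crossing ut ot (e * e * t > 0) (if e > 0 then a else b) (if e > 0 then b else a)
      (if e > 0 then b else c) (if e > 0 then c else b) \<longleftrightarrow> a = c \<and> (if e > 0 then ut b b = a else ut a a = b)"
    and "t < 0 \<Longrightarrow> crossing ut ot (e * e * t > 0) (if e > 0 then b else c) (if e > 0 then c else b)
      (if e > 0 then a else b) (if e > 0 then b else a) \<longleftrightarrow> a = c \<and> (if e > 0 then ut b b = a else ut a a = b)"
proof -
  have ee: "e * e > 0" using e by (auto simp: zero_less_mult_iff)
  have d: "ut b b = ot b b" using X(1) in_X by (simp add: biquandle_def)
  note k = kink_iff[OF X in_X(3,1,2)] kink_iff[OF X in_X(1,3,2)]
  show "crossing ut ot (e * e * t > 0) (if e > 0 then a else b) (if e > 0 then b else a)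
      (if e > 0 then b else c) (if e > 0 then c else b) \<longleftrightarrow> a = c \<and> (if e > 0 then ut b b = a else ut a a = b)"
    if "t > 0"
  proof -
    have "e * e * t > 0" using ee that by simp
    then show ?thesis using d k by (auto simp: crossing_def)
  qed
  show "crossing ut ot (e * e * t > 0) (if e > 0 then b else c) (if e > 0 then c else b)
      (if e > 0 then a else b) (if e > 0 then b else a) \<longleftrightarrow> a = c \<and> (if e > 0 then ut b b = a else ut a a = b)"
    if "t < 0"
  proof -
    have "\<not> e * e * t > 0" using mult_pos_neg[OF ee that] by simp
    then show ?thesis using d k by (auto simp: crossing_def)
  qed
qed

text \<open>Equal heights force \<open>y = - x\<close>; then the abscissa equals its own negative
  and vanishes. Of the two roots for \<open>1 - x\<^sup>2\<close> only 1/2 is possible, since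
  \<bar>x\<bar> is at most 1.\<close>

lemma R1_after_eq_iff:
  assumes "x \<in> {-1..1}" "y \<in> {-1..1}" "x \<noteq> y"
  shows "R1_after j x = R1_after j y \<longleftrightarrow> y = - x \<and> (x = sqrt (1/2) \<or> x = - sqrt (1/2))"
proof
  assume eq: "R1_after j x = R1_after j y"
  then have "x\<^sup>2 = y\<^sup>2" by (simp add: R1_after_def)
  then have y: "y = - x" using assms(3) by (simp add: power2_eq_iff)
  then have "x \<noteq> 0" using assms(3) by simp
  moreover have "x * (1 - 4 * (1 - x\<^sup>2)\<^sup>2) = - x * (1 - 4 * (1 - x\<^sup>2)\<^sup>2)"
    using eq y by (simp add: R1_after_def)
  ultimately have "4 * (1 - x\<^sup>2)\<^sup>2 = 1" by auto
  moreover have "(2 * u)\<^sup>2 = 4 * u\<^sup>2" for u :: real by (simp add: power2_eq_square)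
  ultimately have "(2 * (1 - x\<^sup>2))\<^sup>2 = 1" by presburger
  then have "2 * (1 - x\<^sup>2) = 1 \<or> 2 * (1 - x\<^sup>2) = -1" by (simp add: power2_eq_1_iff)
  moreover have "x\<^sup>2 \<le> 1" using assms(1) by (simp add: abs_square_le_1 abs_le_iff)
  ultimately have "x\<^sup>2 = 1/2" by auto
  then have "x\<^sup>2 = (sqrt (1/2))\<^sup>2" by simp
  then show "y = - x \<and> (x = sqrt (1/2) \<or> x = - sqrt (1/2))" using y by (simp only: power2_eq_iff)
next
  assume a: "y = - x \<and> (x = sqrt (1/2) \<or> x = - sqrt (1/2))"
  then have "x\<^sup>2 = 1/2" by (auto simp: real_sqrt_divide power_divide)
  then have "1 - 4 * (1 - x\<^sup>2)\<^sup>2 = 0" by (simp only:) (simp add: power2_eq_square)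
  then show "R1_after j x = R1_after j y" using a by (simp add: R1_after_def)
qed

lemma R1_before_inj: "R1_before j x = R1_before k y \<Longrightarrow> x = y"
  by (simp add: R1_before_def)

lemma R1_equivariant:
  assumes X: "biquandle X ut ot" "finite X" and D: "diagram D1" "diagram D2"
    and mv: "local_move 1 R1_before R1_after ov D1 D2"
    and ov: "ov = (\<lambda>(j, x) (k, y). x < y) \<or> ov = (\<lambda>(j, x) (k, y). x > y)"
  shows "equivalent_colorings X ut ot D1 D2"
proof -
  \<comment> \<open>Keeps 1, used as an index of strands and labels, from being rewritten to
    \<open>Suc 0\<close>.\<close>
  note [simp del] = One_nat_def
  define dM :: "nat \<Rightarrow> real \<Rightarrow> complex"
    where "dM j x = Complex (1 - 4 * (1 - x\<^sup>2)\<^sup>2 + 16 * x\<^sup>2 * (1 - x\<^sup>2)) (2 * x)" for j x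
  define s where "s = sqrt (1/2)"
  have s: "0 < s" "s < 1" "s\<^sup>2 = 1/2" unfolding s_def by simp_all
  have R0: "crossings 1 R1_before ov = {}"
    using ov unfolding crossings_def by (auto dest: R1_before_inj)
  let ?p = "(0::nat, - s)" and ?q = "(0::nat, s)"
  have mem: "((j, x), (k, y)) \<in> crossings 1 R1_after ov \<longleftrightarrow>
      j = 0 \<and> k = 0 \<and> y = - x \<and> (x = s \<or> x = - s) \<and> ov (0, x) (0, y)" for j x k y
  proof -
    have "x \<noteq> y" if "ov (0, x) (0, y)" using that ov by auto
    moreover have "s \<in> {-1..1}" "-s \<in> {-1..1}" using s by auto
    ultimately show ?thesis
      using R1_after_eq_iff[of x y 0] unfolding crossings_def strand_dom_def s_def[symmetric] by auto
  qed
  have "crossings 1 R1_after ov = {(?p, ?q)} \<and> ov = (\<lambda>(j, x) (k, y). x < y) \<or>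
      crossings 1 R1_after ov = {(?q, ?p)} \<and> ov = (\<lambda>(j, x) (k, y). x > y)"
    using ov
  proof
    assume o: "ov = (\<lambda>(j, x) (k, y). x < y)"
    have "r \<in> crossings 1 R1_after ov \<longleftrightarrow> r \<in> {(?p, ?q)}" for r
    proof -
      obtain j x k y where "r = ((j, x), (k, y))" by (metis surj_pair)
      then show ?thesis using mem[of j x k y] s(1) by (auto simp: o)
    qed
    then show ?thesis using o by blast
  next
    assume o: "ov = (\<lambda>(j, x) (k, y). x > y)"
    have "r \<in> crossings 1 R1_after ov \<longleftrightarrow> r \<in> {(?q, ?p)}" for r
    proof -
      obtain j x k y where "r = ((j, x), (k, y))" by (metis surj_pair)
      then show ?thesis using mem[of j x k y] s(1) by (auto simp: o)
    qed
    then show ?thesis using o by blast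
  qed
  then have R: "crossings 1 R1_after ov = {(?p, ?q)} \<or> crossings 1 R1_after ov = {(?q, ?p)}" by blast
  then have F: "Field (crossings 1 R1_after ov) = {?p, ?q}" by (auto simp: Field_def)
  have tb: "two_breaks 1 (\<lambda>_. - s) (\<lambda>_. s) (crossings 1 R1_after ov)"
    unfolding two_breaks_def F using s by auto
  have cr: "cross2 (dM 0 (- s)) (dM 0 s) > 0" "cross2 (dM 0 s) (dM 0 (- s)) < 0"
  proof -
    \<comment> \<open>At the double point the square of the parameter is 1/2, and the first
      coordinate of the derivative is 1 - 1 + 4.\<close>
    have "dM 0 s = Complex 4 (2 * s)" "dM 0 (- s) = Complex 4 (- (2 * s))"
      unfolding dM_def power2_minus s(3) by (simp_all add: power_divide)
    then show "cross2 (dM 0 (- s)) (dM 0 s) > 0" "cross2 (dM 0 s) (dM 0 (- s)) < 0"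
      using s(1) by (simp_all add: cross2_def)
  qed
  have LC: "l \<in> label_colorings X ut ot 1 \<epsilon> dM (crossings 1 R1_after ov) (\<lambda>_. - s) \<longleftrightarrow>
      (\<forall>i. l 0 i \<in> X) \<and> l 0 0 = l 0 2 \<and> (if \<epsilon> 0 > 0 then ut (l 0 1) (l 0 1) = l 0 0 else ut (l 0 0) (l 0 0) = l 0 1)"
    if e: "\<epsilon> 0 \<noteq> 0" for l and \<epsilon> :: "nat \<Rightarrow> real"
  proof (cases "\<forall>i. l 0 i \<in> X")
    case True
    note k = kink_condition[OF X True[rule_format, of 0] True[rule_format, of 1] True[rule_format, of 2] e]
    have "(\<forall>(p, q)\<in>crossings 1 R1_after ov. strand_crossing_condition ut ot \<epsilon> dM p q
        (label_left (\<lambda>_. - s) l p) (label_right (\<lambda>_. - s) l p) (label_left (\<lambda>_. - s) l q) (label_right (\<lambda>_. - s) l q)) \<longleftrightarrow>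
      l 0 0 = l 0 2 \<and> (if \<epsilon> 0 > 0 then ut (l 0 1) (l 0 1) = l 0 0 else ut (l 0 0) (l 0 0) = l 0 1)"
      using R
    proof
      assume R: "crossings 1 R1_after ov = {(?p, ?q)}"
      show ?thesis using k(1)[OF cr(1)] s(1)
        by (simp add: R strand_crossing_condition_def label_left_def label_right_def cong del: if_weak_cong split del: if_split)
    next
      assume R: "crossings 1 R1_after ov = {(?q, ?p)}"
      show ?thesis using k(2)[OF cr(2)] s(1)
        by (simp add: R strand_crossing_condition_def label_left_def label_right_def cong del: if_weak_cong split del: if_split)
    qed
    then show ?thesis using True by (simp add: label_colorings_def)
  next
    case False
    then show ?thesis by (auto simp: label_colorings_def)
  qed
  have diag: "bij_betw (\<lambda>x. ut x x) X X" by (rule diagonal_bij[OF X])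
  show ?thesis
  proof (rule local_move_from_trivial[OF D mv move_picture_derivatives(1) _ R0 refl tb])
    show "(R1_after j has_vector_derivative dM j x) (at x)" for j x
      unfolding dM_def by (rule move_picture_derivatives)
    fix \<epsilon> :: "nat \<Rightarrow> real" assume "\<And>j. j < 1 \<Longrightarrow> \<epsilon> j \<noteq> 0"
    then have e: "\<epsilon> 0 \<noteq> 0" by simp
    note LC = LC[where \<epsilon> = \<epsilon>, OF e]
    let ?LC = "label_colorings X ut ot 1 \<epsilon> dM (crossings 1 R1_after ov) (\<lambda>_. - s)"
    show "l j 0 = l j 2" if "l \<in> ?LC" "j < 1" for l j using that by (simp add: LC)
    show "\<exists>l\<in>?LC. \<forall>j<1. l j 0 = l0 j \<and> l j 2 = l0 j" if "\<And>j. j < 1 \<Longrightarrow> l0 j \<in> X" for l0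
    proof -
      have a: "l0 0 \<in> X" using that by simp
      \<comment> \<open>For positive \<epsilon> the loop needs a label whose diagonal product is the
        outer label; surjectivity of the diagonal map provides it. For negative \<epsilon> the loop
        label is the diagonal product of the outer one.\<close>
      then have "l0 0 \<in> (\<lambda>x. ut x x) ` X" using bij_betw_imp_surj_on[OF diag] by simp
      then obtain b where b: "b \<in> X" "ut b b = l0 0" by auto
      have c: "ut (l0 0) (l0 0) \<in> X" using X(1) a by (simp add: biquandle_def)
      show ?thesis
        by (rule bexI[of _ "\<lambda>j. three (l0 0) (if \<epsilon> 0 > 0 then b else ut (l0 0) (l0 0)) (l0 0)"])
          (use a b c in \<open>auto simp: LC three_def\<close>)
    qed
    show "determined_by_ends 1 ?LC"
      unfolding determined_by_ends_def
    proof (intro ballI impI)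
      fix l l' assume l: "l \<in> ?LC" "l' \<in> ?LC" "\<forall>j<1. l j 0 = l' j 0 \<and> l j 2 = l' j 2"
      have "l 0 1 = l' 0 1"
      proof (cases "\<epsilon> 0 > 0")
        case True
        then have "ut (l 0 1) (l 0 1) = ut (l' 0 1) (l' 0 1)" using l by (simp add: LC)
        then show ?thesis
          using inj_onD[OF bij_betw_imp_inj_on[OF diag]] l(1,2) unfolding LC by blast
      next
        case False
        then have "ut (l 0 0) (l 0 0) = l 0 1" "ut (l' 0 0) (l' 0 0) = l' 0 1"
          using l(1,2) by (auto simp: LC)
        moreover have "l 0 0 = l' 0 0" using l(3) by simp
        ultimately show ?thesis by metis
      qed
      then show "\<forall>j<1. l j 1 = l' j 1" by simp
    qed
  qed
qed

text \<open>The relation depends only on which label of each strand is on the right or left of the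
  other. At the second crossing of the second move strand 0 comes from above; read from outside to
  inside, that crossing imposes the same relation as the first one.\<close>

lemma strand_crossing_reverse:
  "strand_crossing ut ot (\<not> ab) eb ea b2 b1 a2 a1 \<longleftrightarrow> strand_crossing ut ot ab ea eb a1 a2 b1 b2"
  by (cases ea; cases eb) (auto simp: strand_crossing_def)

text \<open>The crossings of \<open>R2_after\<close> are the zeros of
  \<open>1/2 - (1 - x\<^sup>2)\<^sup>2\<close>; since \<open>1 - x\<^sup>2\<close> is nonnegative in
  the box, it must be the positive root.\<close>

lemma R2_height:
  defines "s \<equiv> sqrt (1 - 1 / sqrt 2)"
  shows "0 < s" "s < 1" "\<And>x. x \<in> {-1..1} \<Longrightarrow> (1 - x\<^sup>2)\<^sup>2 = 1/2 \<longleftrightarrow> x = s \<or> x = - s"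
proof -
  define w where "w = 1 / sqrt (2 :: real)"
  have w: "0 < w" "w < 1" "w\<^sup>2 = 1/2" unfolding w_def by (simp_all add: real_less_rsqrt power_divide)
  have s_w: "s = sqrt (1 - w)" by (simp add: s_def w_def)
  show "0 < s" "s < 1" using w(1,2) unfolding s_w by simp_all
  have s2: "s\<^sup>2 = 1 - w" using w(2) unfolding s_w by simp
  fix x :: real assume "x \<in> {-1..1}"
  then have nn: "1 - x\<^sup>2 \<ge> 0" by (simp add: abs_square_le_1 abs_le_iff)
  have "(1 - x\<^sup>2)\<^sup>2 = 1/2 \<longleftrightarrow> (1 - x\<^sup>2)\<^sup>2 = w\<^sup>2" by (simp only: w(3))
  also have "\<dots> \<longleftrightarrow> 1 - x\<^sup>2 = w" using nn w(1) by (intro power2_eq_iff_nonneg) simp_all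
  also have "\<dots> \<longleftrightarrow> x\<^sup>2 = s\<^sup>2" unfolding s2 by auto
  also have "\<dots> \<longleftrightarrow> x = s \<or> x = - s" by (rule power2_eq_iff)
  finally show "(1 - x\<^sup>2)\<^sup>2 = 1/2 \<longleftrightarrow> x = s \<or> x = - s" .
qed

text \<open>An entry \<open>(u, v, uv, x)\<close> of \<open>P\<close> is a crossing at parameter
  \<open>x\<close> where \<open>u\<close> comes from above, which the positive determinant
  expresses, and \<open>uv\<close> says that \<open>u\<close> is the over-strand.\<close>

lemma label_coloring_crossing_pairs:
  assumes "\<And>u v uv x. (u, v, uv, x) \<in> P \<Longrightarrow> \<epsilon> u \<noteq> 0 \<and> \<epsilon> v \<noteq> 0 \<and> cross2 (dM u x) (dM v x) > 0"
    and "R = (\<lambda>(u, v, uv, x). crossing_pair uv u v x) ` P"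
  shows "l \<in> label_colorings X ut ot m \<epsilon> dM R a \<longleftrightarrow> (\<forall>j<m. \<forall>i. l j i \<in> X) \<and>
    (\<forall>(u, v, uv, x)\<in>P. strand_crossing ut ot uv (\<epsilon> u > 0) (\<epsilon> v > 0)
      (label_left a l (u, x)) (label_right a l (u, x)) (label_left a l (v, x)) (label_right a l (v, x)))"
proof -
  have "(\<forall>r\<in>R. case r of (p, q) \<Rightarrow> strand_crossing_condition ut ot \<epsilon> dM p q
        (label_left a l p) (label_right a l p) (label_left a l q) (label_right a l q)) \<longleftrightarrow>
    (\<forall>(u, v, uv, x)\<in>P. strand_crossing ut ot uv (\<epsilon> u > 0) (\<epsilon> v > 0)
      (label_left a l (u, x)) (label_right a l (u, x)) (label_left a l (v, x)) (label_right a l (v, x)))"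
    unfolding assms(2) ball_simps(9)
  proof (rule ball_cong[OF refl])
    fix t assume t: "t \<in> P"
    obtain u v uv x where t': "t = (u, v, uv, x)" by (metis surj_pair)
    show "(case (case t of (u, v, uv, x) \<Rightarrow> crossing_pair uv u v x) of (p, q) \<Rightarrow> strand_crossing_condition ut ot \<epsilon> dM p q
        (label_left a l p) (label_right a l p) (label_left a l q) (label_right a l q)) \<longleftrightarrow>
     (case t of (u, v, uv, x) \<Rightarrow> strand_crossing ut ot uv (\<epsilon> u > 0) (\<epsilon> v > 0)
      (label_left a l (u, x)) (label_right a l (u, x)) (label_left a l (v, x)) (label_right a l (v, x)))"
      unfolding t' prod.case
      by (rule crossing_pair_condition) (use assms(1) t t' in blast)+
  qed
  then show ?thesis unfolding label_colorings_def by simp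
qed

lemma R2_equivariant:
  assumes X: "biquandle X ut ot" and D: "diagram D1" "diagram D2"
    and mv: "local_move 2 R2_before R2_after (\<lambda>(j, x) (k, y). j = a \<and> k = b) D1 D2"
    and ab: "(a, b) \<in> {(0, 1), (1, 0)}"
  shows "equivalent_colorings X ut ot D1 D2"
proof -
  note [simp del] = One_nat_def
  let ?ov = "\<lambda>(j :: nat, x :: real) (k :: nat, y :: real). j = a \<and> k = b"
  define s where "s = sqrt (1 - 1 / sqrt 2)"
  note s = R2_height[folded s_def]
  define dM :: "nat \<Rightarrow> real \<Rightarrow> complex"
    where "dM j x = Complex 1 (if j = 0 then 0 else 4 * x * (1 - x\<^sup>2))" for j x
  have ab': "a = 0 \<and> b = 1 \<or> a = 1 \<and> b = 0" using ab by auto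
  have R0: "crossings 2 R2_before ?ov = {}"
    using ab' unfolding crossings_def R2_before_def by auto
  have mem: "((j, x), (k, y)) \<in> crossings 2 R2_after ?ov \<longleftrightarrow> j = a \<and> k = b \<and> x = y \<and> (x = s \<or> x = - s)" for j x k y
  proof -
    have "R2_after a x = R2_after b y \<longleftrightarrow> x = y \<and> (1 - x\<^sup>2)\<^sup>2 = 1/2"
      using ab' by (auto simp: R2_after_def)
    moreover have "s \<in> {-1..1}" "- s \<in> {-1..1}" using s(1,2) by auto
    ultimately show ?thesis
      using ab' s(3)[of x] unfolding crossings_def strand_dom_def by auto
  qed
  \<comment> \<open>Strand 1 descends through the axis at \<open>- s\<close> and comes back from
    below at \<open>s\<close>, where strand 0 is the upper one.\<close>
  let ?P = "{(1, 0, a = 1, - s), (0, 1, a = 0, s)}"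
  have R: "crossings 2 R2_after ?ov = (\<lambda>(u, v, uv, x). crossing_pair uv u v x) ` ?P"
  proof (rule set_eqI)
    fix r :: "(nat \<times> real) \<times> (nat \<times> real)"
    obtain j x k y where "r = ((j, x), (k, y))" by (metis surj_pair)
    then show "r \<in> crossings 2 R2_after ?ov \<longleftrightarrow> r \<in> (\<lambda>(u, v, uv, x). crossing_pair uv u v x) ` ?P"
      using mem[of j x k y] ab' by (auto simp: crossing_pair_def)
  qed
  have F: "Field (crossings 2 R2_after ?ov) = {(j, x). j < 2 \<and> (x = - s \<or> x = s)}"
    using ab' unfolding R by (auto simp: Field_def crossing_pair_def less_2_cases_iff)
  have tb: "two_breaks 2 (\<lambda>_. - s) (\<lambda>_. s) (crossings 2 R2_after ?ov)"
    unfolding two_breaks_def F using s(1,2) by auto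
  have cr: "cross2 (dM 1 (- s)) (dM 0 (- s)) > 0" "cross2 (dM 0 s) (dM 1 s) > 0"
  proof -
    have "s * s < 1 * 1" using s(1,2) by (intro mult_strict_mono) auto
    then have "0 < s * (1 - s\<^sup>2)" using s(1) by (simp add: power2_eq_square)
    then show "cross2 (dM 1 (- s)) (dM 0 (- s)) > 0" "cross2 (dM 0 s) (dM 1 s) > 0"
      by (simp_all add: cross2_def dM_def)
  qed
  have ll: "label_left (\<lambda>_. - s) l (j, - s) = l j 0" "label_right (\<lambda>_. - s) l (j, - s) = l j 1"
    "label_left (\<lambda>_. - s) l (j, s) = l j 1" "label_right (\<lambda>_. - s) l (j, s) = l j 2"
    for j and l :: "nat \<Rightarrow> nat \<Rightarrow> 'a"
    using s(1) by (auto simp: label_left_def label_right_def)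
  have LC: "l \<in> label_colorings X ut ot 2 \<epsilon> dM (crossings 2 R2_after ?ov) (\<lambda>_. - s) \<longleftrightarrow>
      (\<forall>j<2. \<forall>i. l j i \<in> X) \<and>
      strand_crossing ut ot (a = 1) (\<epsilon> 1 > 0) (\<epsilon> 0 > 0) (l 1 0) (l 1 1) (l 0 0) (l 0 1) \<and>
      strand_crossing ut ot (a = 1) (\<epsilon> 1 > 0) (\<epsilon> 0 > 0) (l 1 2) (l 1 1) (l 0 2) (l 0 1)"
    if "\<epsilon> 0 \<noteq> 0" "\<epsilon> 1 \<noteq> 0" for l and \<epsilon> :: "nat \<Rightarrow> real"
  proof -
    have "(a = 0) = (\<not> a = 1)" using ab' by auto
    then have "strand_crossing ut ot (a = 0) (\<epsilon> 0 > 0) (\<epsilon> 1 > 0) (l 0 1) (l 0 2) (l 1 1) (l 1 2) \<longleftrightarrow>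
      strand_crossing ut ot (a = 1) (\<epsilon> 1 > 0) (\<epsilon> 0 > 0) (l 1 2) (l 1 1) (l 0 2) (l 0 1)"
      by (simp only: strand_crossing_reverse)
    moreover have "l \<in> label_colorings X ut ot 2 \<epsilon> dM (crossings 2 R2_after ?ov) (\<lambda>_. - s) \<longleftrightarrow>
      (\<forall>j<2. \<forall>i. l j i \<in> X) \<and>
      (\<forall>(u, v, uv, x)\<in>?P. strand_crossing ut ot uv (\<epsilon> u > 0) (\<epsilon> v > 0)
        (label_left (\<lambda>_. - s) l (u, x)) (label_right (\<lambda>_. - s) l (u, x))
        (label_left (\<lambda>_. - s) l (v, x)) (label_right (\<lambda>_. - s) l (v, x)))"
      by (rule label_coloring_crossing_pairs[OF _ R]) (use cr that in auto)
    ultimately show ?thesis by (simp add: ll)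
  qed
  show ?thesis
  proof (rule local_move_from_trivial[OF D mv move_picture_derivatives(3) _ R0 refl tb])
    show "(R2_after j has_vector_derivative dM j x) (at x)" for j x
      unfolding dM_def by (rule move_picture_derivatives)
    fix \<epsilon> :: "nat \<Rightarrow> real" assume "\<And>j. j < 2 \<Longrightarrow> \<epsilon> j \<noteq> 0"
    then have e: "\<epsilon> 0 \<noteq> 0" "\<epsilon> 1 \<noteq> 0" by simp_all
    note LCe = LC[of \<epsilon>, OF e]
    let ?LC = "label_colorings X ut ot 2 \<epsilon> dM (crossings 2 R2_after ?ov) (\<lambda>_. - s)"
    show "\<exists>l\<in>?LC. \<forall>j<2. l j 0 = l0 j \<and> l j 2 = l0 j" if "\<And>j. j < 2 \<Longrightarrow> l0 j \<in> X" for l0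
    proof -
      have l0: "l0 0 \<in> X" "l0 1 \<in> X" using that by simp_all
      obtain u v where uv: "u \<in> X" "v \<in> X"
        "strand_crossing ut ot (a = 1) (\<epsilon> 1 > 0) (\<epsilon> 0 > 0) (l0 1) u (l0 0) v"
        using strand_crossing_exists[OF X l0(2,1)] by blast
      show ?thesis
      proof (rule bexI)
        show "(\<lambda>j. three (l0 j) (if j = 1 then u else v) (l0 j)) \<in> ?LC"
          unfolding LCe using l0 uv by (auto simp: three_def less_2_cases_iff One_nat_def)
      qed simp
    qed
    show "determined_by_ends 2 ?LC"
      unfolding determined_by_ends_def
    proof (intro ballI impI)
      fix l l' assume l: "l \<in> ?LC" "l' \<in> ?LC" and ends: "\<forall>j<2. l j 0 = l' j 0 \<and> l j 2 = l' j 2"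
      have X1: "l 0 i \<in> X" "l 1 i \<in> X" "l' 0 i \<in> X" "l' 1 i \<in> X" for i
        using l by (simp_all add: label_colorings_def)
      have eq0: "l 0 0 = l' 0 0" "l 1 0 = l' 1 0" using ends by simp_all
      have c: "strand_crossing ut ot (a = 1) (\<epsilon> 1 > 0) (\<epsilon> 0 > 0) (l 1 0) (l 1 1) (l 0 0) (l 0 1)"
        "strand_crossing ut ot (a = 1) (\<epsilon> 1 > 0) (\<epsilon> 0 > 0) (l 1 0) (l' 1 1) (l 0 0) (l' 0 1)"
        using l unfolding LCe eq0 by blast+
      have "l 1 1 = l' 1 1" "l 0 1 = l' 0 1"
        using strand_crossing_unique[OF X X1(2,1) X1(2,1) X1(4,3) c] by blast+
      then show "\<forall>j<2. l j 1 = l' j 1" by (auto simp: less_2_cases_iff One_nat_def)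
    qed
    show "l j 0 = l j 2" if l: "l \<in> ?LC" and j: "j < 2" for l j
    proof -
      have X1: "l 0 i \<in> X" "l 1 i \<in> X" for i
        using l by (simp_all add: label_colorings_def)
      \<comment> \<open>Read from inside to outside, both crossings start from the same pair of
        middle labels, so uniqueness identifies the labels at the two ends.\<close>
      have "strand_crossing ut ot (\<not> a = 1) (\<epsilon> 0 > 0) (\<epsilon> 1 > 0) (l 0 1) (l 0 0) (l 1 1) (l 1 0)"
        "strand_crossing ut ot (\<not> a = 1) (\<epsilon> 0 > 0) (\<epsilon> 1 > 0) (l 0 1) (l 0 2) (l 1 1) (l 1 2)"
        using l unfolding LCe strand_crossing_reverse by blast+
      from strand_crossing_unique[OF X X1 X1 X1 this]
      have "l 0 0 = l 0 2" "l 1 0 = l 1 2" by blast+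
      then show ?thesis using j by (auto simp: less_2_cases_iff One_nat_def)
    qed
  qed
qed

text \<open>The parameter at which strand 2 of \<open>R3_before\<close> meets the rising diagonal.
  It exists by the intermediate value theorem and is unique because the difference of heights
  decreases on the nonnegative side; reflection gives the falling diagonal.\<close>

lemma R3_height:
  obtains c :: real where "0 < c" "c < 1"
    "\<And>x. x \<in> {-1..1} \<Longrightarrow> (1 - x\<^sup>2)\<^sup>2 / 2 = x \<longleftrightarrow> x = c"
    "\<And>x. x \<in> {-1..1} \<Longrightarrow> (1 - x\<^sup>2)\<^sup>2 / 2 = - x \<longleftrightarrow> x = - c"
proof -
  let ?f = "\<lambda>x::real. (1 - x\<^sup>2)\<^sup>2 / 2 - x"
  have "\<exists>x\<ge>0. x \<le> 1 \<and> ?f x = 0"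
    by (rule IVT2') (auto intro!: continuous_intros)
  then obtain c where c: "0 \<le> c" "c \<le> 1" "?f c = 0" by blast
  have "c \<noteq> 0" "c \<noteq> 1" using c(3) by auto
  then have c01: "0 < c" "c < 1" using c by simp_all
  have anti: "?f y < ?f x" if "0 \<le> x" "x < y" "y \<le> 1" for x y
  proof -
    have "x\<^sup>2 < y\<^sup>2" using that by (simp add: power_strict_mono)
    moreover have "y\<^sup>2 \<le> 1" using that by (simp add: power_le_one)
    ultimately have "(1 - y\<^sup>2)\<^sup>2 \<le> (1 - x\<^sup>2)\<^sup>2" by (intro power_mono) auto
    then show ?thesis using that by simp
  qed
  have 1: "(1 - x\<^sup>2)\<^sup>2 / 2 = x \<longleftrightarrow> x = c" if "x \<in> {-1..1}" for x
  proof
    assume eq: "(1 - x\<^sup>2)\<^sup>2 / 2 = x"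
    have "0 \<le> (1 - x\<^sup>2)\<^sup>2 / 2" by simp
    then have "0 \<le> x" using eq by simp
    then show "x = c"
      using anti[of x c] anti[of c x] c c01 eq that by (cases x c rule: linorder_cases) auto
  qed (use c(3) in simp)
  have 2: "(1 - x\<^sup>2)\<^sup>2 / 2 = - x \<longleftrightarrow> x = - c" if "x \<in> {-1..1}" for x
    using 1[of "- x"] that by auto
  show thesis by (rule that[OF c01 1 2])
qed

text \<open>The Boolean is the flag of \<open>triangle\<close> and \<open>cube_path\<close>, so both
  directions of the move become one argument.\<close>

definition R3_picture :: "bool \<Rightarrow> nat \<Rightarrow> real \<Rightarrow> complex" where
  "R3_picture before = (if before then R3_before else R3_after)"

lemma R3_crossings:
  assumes c: "0 < c" "c < 1"
    "\<And>x. x \<in> {-1..1} \<Longrightarrow> (1 - x\<^sup>2)\<^sup>2 / 2 = x \<longleftrightarrow> x = c"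
    "\<And>x. x \<in> {-1..1} \<Longrightarrow> (1 - x\<^sup>2)\<^sup>2 / 2 = - x \<longleftrightarrow> x = - c"
    and h: "inj_on (h :: nat \<Rightarrow> nat) {..<3}" and d: "d = (if before then c else - c)"
  shows "crossings 3 (R3_picture before) (\<lambda>(j, x) (k, y). h j > h k) =
    (\<lambda>(u, v, uv, x). crossing_pair uv u v x) ` {(1, 0, h 1 > h 0, 0), (2, 0, h 2 > h 0, d), (1, 2, h 1 > h 2, - d)}"
    (is "_ = _ ` ?P")
proof -
  note [simp del] = One_nat_def
  let ?M = "R3_picture before"
  have j3: "j < 3 \<longleftrightarrow> j = 0 \<or> j = 1 \<or> j = 2" for j :: nat by auto
  have hd: "h 0 \<noteq> h 1" "h 0 \<noteq> h 2" "h 1 \<noteq> h 2"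
    using inj_onD[OF h, of 0 1] inj_onD[OF h, of 0 2] inj_onD[OF h, of 1 2] by auto
  have I: "d \<in> {-1..1}" "- d \<in> {-1..1}" "0 \<in> {-1..1::real}" using c(1,2) d by auto
  have pair_eq: "((j, x), (k, y)) = crossing_pair uv u v w \<longleftrightarrow>
      x = w \<and> y = w \<and> (if uv then j = u \<and> k = v else j = v \<and> k = u)" for j k x y uv u v w
    by (auto simp: crossing_pair_def)
  have M: "?M 0 x = ?M 1 y \<longleftrightarrow> x = y \<and> x = 0" "?M 0 x = ?M 2 y \<longleftrightarrow> x = y \<and> x = d"
      "?M 1 x = ?M 2 y \<longleftrightarrow> x = y \<and> x = - d" if "x \<in> {-1..1}" for x y
    using c(3,4)[OF that] by (auto simp: R3_picture_def R3_before_def R3_after_def d)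
  show ?thesis
  proof (rule set_eqI)
    fix r :: "(nat \<times> real) \<times> (nat \<times> real)"
    obtain j x k y where r: "r = ((j, x), (k, y))" by (metis surj_pair)
    have l: "r \<in> crossings 3 ?M (\<lambda>(j, x) (k, y). h j > h k) \<longleftrightarrow>
        j < 3 \<and> k < 3 \<and> x \<in> {-1..1} \<and> y \<in> {-1..1} \<and> ?M j x = ?M k y \<and> h j > h k"
      unfolding r crossings_def strand_dom_def by auto
    have rr: "r \<in> (\<lambda>(u, v, uv, x). crossing_pair uv u v x) ` ?P \<longleftrightarrow>
        x = 0 \<and> y = 0 \<and> (if h 1 > h 0 then j = 1 \<and> k = 0 else j = 0 \<and> k = 1) \<or>
        x = d \<and> y = d \<and> (if h 2 > h 0 then j = 2 \<and> k = 0 else j = 0 \<and> k = 2) \<or>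
        x = - d \<and> y = - d \<and> (if h 1 > h 2 then j = 1 \<and> k = 2 else j = 2 \<and> k = 1)"
      unfolding r image_insert image_empty prod.case insert_iff empty_iff pair_eq by (simp only: simp_thms)
    show "r \<in> crossings 3 ?M (\<lambda>(j, x) (k, y). h j > h k) \<longleftrightarrow> r \<in> (\<lambda>(u, v, uv, x). crossing_pair uv u v x) ` ?P"
    proof (cases "j < 3 \<and> k < 3 \<and> j \<noteq> k")
      case False
      then show ?thesis unfolding l rr by (auto split: if_splits)
    next
      case True
      then consider "j = 0" "k = 1" | "j = 1" "k = 0" | "j = 0" "k = 2" | "j = 2" "k = 0" | "j = 1" "k = 2" | "j = 2" "k = 1"
        using j3[of j] j3[of k] by blast
      then show ?thesis
      proof cases
        case 1
        then show ?thesis unfolding l rr using M(1)[of x y] I hd by auto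
      next
        case 2
        then show ?thesis unfolding l rr using M(1)[of y x] I hd by auto
      next
        case 3
        then show ?thesis unfolding l rr using M(2)[of x y] I hd by auto
      next
        case 4
        then show ?thesis unfolding l rr using M(2)[of y x] I hd by auto
      next
        case 5
        then show ?thesis unfolding l rr using M(3)[of x y] I hd by auto
      next
        case 6
        then show ?thesis unfolding l rr using M(3)[of y x] I hd by auto
      qed
    qed
  qed
qed

lemma Field_crossing_pair:
  "Field (insert (crossing_pair uv u v x) R) = insert (u, x) (insert (v, x) (Field R))"
  by (cases uv) (auto simp: crossing_pair_def Field_insert)

lemma R3_equivariant:
  assumes X: "biquandle X ut ot" "finite X" and D: "diagram D1" "diagram D2"
    and mv: "local_move 3 R3_before R3_after (\<lambda>(j, x) (k, y). h j > h k) D1 D2"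
    and h: "inj_on (h :: nat \<Rightarrow> nat) {..<3}"
  shows "equivalent_colorings X ut ot D1 D2"
proof -
  note [simp del] = One_nat_def
  obtain c :: real where c: "0 < c" "c < 1"
    "\<And>x. x \<in> {-1..1} \<Longrightarrow> (1 - x\<^sup>2)\<^sup>2 / 2 = x \<longleftrightarrow> x = c"
    "\<And>x. x \<in> {-1..1} \<Longrightarrow> (1 - x\<^sup>2)\<^sup>2 / 2 = - x \<longleftrightarrow> x = - c"
    by (rule R3_height) blast
  define d where "d before = (if before then c else - c)" for before
  define R where "R before = crossings 3 (R3_picture before) (\<lambda>(j, x) (k, y). h j > h k)" for before
  define dM :: "bool \<Rightarrow> nat \<Rightarrow> real \<Rightarrow> complex" where
    "dM before j x = Complex 1 (if j = 0 then 1 else if j = 1 then -1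
       else if before then - (2 * x * (1 - x\<^sup>2)) else 2 * x * (1 - x\<^sup>2))" for before j x
  \<comment> \<open>Before the move strand 0 has its breaks at 0 and \<open>c\<close>, strand 1 at
    \<open>- c\<close> and 0; after it these are interchanged. Strand 2 has its breaks at
    \<open>- c\<close> and \<open>c\<close> in both pictures.\<close>
  define a b :: "bool \<Rightarrow> nat \<Rightarrow> real" where
    "a before j = (if j = (if before then 0 else 1) then 0 else - c)" and
    "b before j = (if j = (if before then 1 else 0) then 0 else c)" for before j
  have R: "R t = (\<lambda>(u, v, uv, x). crossing_pair uv u v x) `
      {(1, 0, h 1 > h 0, 0), (2, 0, h 2 > h 0, d t), (1, 2, h 1 > h 2, - d t)}" for t
    unfolding R_def by (rule R3_crossings[OF c(1,2) _ _ h d_def], fact c(3), fact c(4))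
  have all3: "(\<forall>j<3. Q j) \<longleftrightarrow> Q 0 \<and> Q 1 \<and> Q 2" for Q :: "nat \<Rightarrow> bool" by (auto simp: numeral_3_eq_3 numeral_2_eq_2 less_Suc_eq One_nat_def)
  have j3: "j < 3 \<longleftrightarrow> j = 0 \<or> j = 1 \<or> j = 2" for j :: nat by auto
  have F: "Field (R t) = {(j, x). j < 3 \<and> (x = a t j \<or> x = b t j)}" for t
    unfolding R image_insert image_empty prod.case Field_crossing_pair Field_empty j3
    by (cases t) (auto simp: a_def b_def d_def split: if_splits)
  have tb: "two_breaks 3 (a t) (b t) (R t)" for t
    unfolding two_breaks_def F using c(1,2) by (auto simp: a_def b_def)
  have "c * c < 1 * 1" using c(1,2) by (intro mult_strict_mono) auto
  then have pos: "0 < c * (1 - c\<^sup>2)" using c(1) by (simp add: power2_eq_square)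
  have cr: "cross2 (dM t 1 0) (dM t 0 0) > 0" "cross2 (dM t 2 (d t)) (dM t 0 (d t)) > 0"
    "cross2 (dM t 1 (- d t)) (dM t 2 (- d t)) > 0" for t
    using pos by (auto simp: cross2_def dM_def d_def)
  have LC: "l \<in> label_colorings X ut ot 3 \<epsilon> (dM t) (R t) (a t) \<longleftrightarrow> (\<forall>j<3. \<forall>i. l j i \<in> X) \<and>
      triangle ut ot t (h 1 > h 2) (h 1 > h 0) (h 2 > h 0) (\<epsilon> 1 > 0) (\<epsilon> 2 > 0) (\<epsilon> 0 > 0) (l 1) (l 2) (l 0)"
    if e: "\<epsilon> 0 \<noteq> 0" "\<epsilon> 1 \<noteq> 0" "\<epsilon> 2 \<noteq> 0" for \<epsilon> :: "nat \<Rightarrow> real" and l t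
    by (subst label_coloring_crossing_pairs[OF _ R])
      (use e cr[of t] c(1) in \<open>auto simp: triangle_def label_left_def label_right_def a_def d_def\<close>)
  \<comment> \<open>The over-relation comes from heights, which are linearly ordered; this rules out
    the cyclic patterns excluded in \<open>act_exchange\<close>.\<close>
  have order: "(h 1 > h 2) = (h 2 > h 0) \<longrightarrow> (h 1 > h 0) = (h 1 > h 2)"
    using inj_onD[OF h, of 0 1] inj_onD[OF h, of 0 2] inj_onD[OF h, of 1 2] by auto
  have ext: "ends_extend 3 (strand_colorings X ut ot 3 \<epsilon> (dM t) (R t)) (strand_colorings X ut ot 3 \<epsilon> (dM (\<not> t)) (R (\<not> t))) (R (\<not> t))"
    if e: "\<And>j. j < 3 \<Longrightarrow> \<epsilon> j \<noteq> 0" for \<epsilon> :: "nat \<Rightarrow> real" and t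
  proof (rule ends_extend_breaks[OF tb tb])
    have e: "\<epsilon> 0 \<noteq> 0" "\<epsilon> 1 \<noteq> 0" "\<epsilon> 2 \<noteq> 0" using e by simp_all
    let ?LC = "\<lambda>t. label_colorings X ut ot 3 \<epsilon> (dM t) (R t) (a t)"
    note L = LC[of \<epsilon>, OF e]
    show "determined_by_ends 3 (?LC (\<not> t))"
      unfolding determined_by_ends_def
    proof (intro ballI impI)
      fix l l' assume l: "l \<in> ?LC (\<not> t)" "l' \<in> ?LC (\<not> t)" "\<forall>j<3. l j 0 = l' j 0 \<and> l j 2 = l' j 2"
      have "\<forall>i<3. l 1 i = l' 1 i \<and> l 2 i = l' 2 i \<and> l 0 i = l' 0 i"
        by (rule triangle_unique[OF X(1) _ _ _ _ _ conjunct2[OF iffD1[OF L l(1)]] conjunct2[OF iffD1[OF L l(2)]]])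
          (use l in \<open>auto simp: label_colorings_def\<close>)
      then show "\<forall>j<3. l j 1 = l' j 1" unfolding all3 by simp
    qed
    fix l assume l: "l \<in> ?LC t"
    have "l 1 i \<in> X \<and> l 2 i \<in> X \<and> l 0 i \<in> X" for i using l by (simp add: label_colorings_def)
    from triangle_exchange[OF X order this conjunct2[OF iffD1[OF L l]]]
    obtain p q r where pqr: "\<forall>i. p i \<in> X \<and> q i \<in> X \<and> r i \<in> X"
      "\<forall>i\<in>{0,2}. l 1 i = p i \<and> l 2 i = q i \<and> l 0 i = r i"
      "triangle ut ot (\<not> t) (h 1 > h 2) (h 1 > h 0) (h 2 > h 0) (\<epsilon> 1 > 0) (\<epsilon> 2 > 0) (\<epsilon> 0 > 0) p q r"
      by blast
    let ?l = "\<lambda>j::nat. if j = 1 then p else if j = 2 then q else r"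
    have "?l \<in> ?LC (\<not> t)" unfolding L using pqr(1,3) by simp
    then show "\<exists>l'\<in>?LC (\<not> t). \<forall>j<3. l' j 0 = l j 0 \<and> l' j 2 = l j 2"
      by (rule bexI[rotated]) (use pqr(2) in \<open>simp add: all3\<close>)
  qed
  have RR: "crossings 3 R3_before (\<lambda>(j, x) (k, y). h j > h k) = R True"
    "crossings 3 R3_after (\<lambda>(j, x) (k, y). h j > h k) = R False"
    by (simp_all add: R_def R3_picture_def)
  show ?thesis
  proof (rule local_move_equivariant[OF D mv, where ?dM1.0 = "dM True" and ?dM2.0 = "dM False"])
    show "(R3_before j has_vector_derivative dM True j x) (at x)" for j x
      unfolding dM_def if_True by (rule move_picture_derivatives)
    show "(R3_after j has_vector_derivative dM False j x) (at x)" for j x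
      unfolding dM_def if_False by (rule move_picture_derivatives)
  qed (use ext[of _ True] ext[of _ False] two_breaks_interior[OF tb] in \<open>auto simp only: RR simp_thms\<close>)
qed

lemma reidemeister_move_equivariant:
  assumes X: "biquandle X ut ot" "finite X" and D: "diagram D1" "diagram D2"
    and mv: "reidemeister_move D1 D2"
  shows "equivalent_colorings X ut ot D1 D2"
  using mv D
proof cases
  case (classical_R1 ov)
  then show ?thesis using R1_equivariant[OF X D] by blast
next
  case (classical_R2 a b)
  then show ?thesis using R2_equivariant[OF X(1) D] by blast
next
  case (classical_R3 h)
  then show ?thesis using R3_equivariant[OF X D] by blast
next
  case virtual_R1
  have e: "crossings m M (\<lambda>_ _. False) = {}" for m M by (auto simp: crossings_def)
  show ?thesis
    by (rule local_move_same_crossings[OF D virtual_R1]) (auto simp: e intro: move_picture_derivatives)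
next
  case virtual_R2
  have e: "crossings m M (\<lambda>_ _. False) = {}" for m M by (auto simp: crossings_def)
  show ?thesis
    by (rule local_move_same_crossings[OF D virtual_R2]) (auto simp: e intro: move_picture_derivatives)
next
  case virtual_R3
  have e: "crossings m M (\<lambda>_ _. False) = {}" for m M by (auto simp: crossings_def)
  show ?thesis
    by (rule local_move_same_crossings[OF D virtual_R3]) (auto simp: e intro: move_picture_derivatives)
next
  case (mixed a b)
  let ?ov = "\<lambda>(j :: nat, x :: real) (k :: nat, y :: real). j = a \<and> k = b"
  have ab: "a = 0 \<and> b = 1 \<or> a = 1 \<and> b = 0" using mixed(2) by auto
  \<comment> \<open>The only classical crossing is that of the two diagonals, which the move leaves
    in place; strand 2 has only virtual crossings.\<close>
  have "crossings 3 R3_before ?ov = {((a, 0), (b, 0))}" "crossings 3 R3_after ?ov = {((a, 0), (b, 0))}"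
    using ab by (auto simp: crossings_def strand_dom_def R3_before_def R3_after_def)
  note R = this
  have F: "Field {((a, 0::real), (b, 0::real))} = {(0, 0), (1, 0)}" using ab by (auto simp: Field_def)
  show ?thesis
  proof (rule local_move_same_crossings[OF D mixed(1)])
    show "crossings 3 R3_before ?ov = crossings 3 R3_after ?ov" by (simp only: R)
    show "Field (crossings 3 R3_before ?ov) \<subseteq> {..<3} \<times> {-1<..<1}" unfolding R F by simp
    show "R3_before j = R3_after j" if "j \<in> fst ` Field (crossings 3 R3_before ?ov)" for j
      using that unfolding R F by (auto simp: R3_before_def R3_after_def fun_eq_iff)
  qed (rule move_picture_derivatives)+
qed

theorem theorem1p0p2:
  fixes X :: "'a set" and ut ot :: "'a \<Rightarrow> 'a \<Rightarrow> 'a"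
    and m :: nat and S :: "nat \<Rightarrow> ('a \<Rightarrow> 'a) set"
    and L1 L2 :: vdiagram
  assumes "finite X" and "biquandle X ut ot"
    and "endo_filtration X ut ot m S"
    and "diagram L1" and "diagram L2"
    and "virtually_equivalent L1 L2"
  shows "isomorphic_filtrations m
           (coloring_quiver_filtration X ut ot S L1)
           (coloring_quiver_filtration X ut ot S L2)"
proof (rule isomorphic_filtrations_of_equivalent_colorings[OF assms(3-5)])
  show "equivalent_colorings X ut ot L1 L2"
    using equivalent_colorings_of_virtually_equivalent[OF _ assms(6)]
      reparametrization_equivariant planar_isotopy_equivariant
      reidemeister_move_equivariant[OF assms(2,1)] by metis
qed

end
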